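(* Let $\delta>0$ and set $$\alpha=\delta(3+\delta),\qquad \beta=\delta(2+3\delta+2\delta^2).$$ Let $u$ be the solution of $u''+\alpha u'+\beta u+Au=0$ for $t>0$, with $u(0)=u_0\in D(A)$, $u'(0)=u_1\in D(A^{1/2})$. Then the energy $$\mathcal{E}^{(1)}(u)(t)=\tfrac12\left(\|u'(t)\|^2+\|A^{1/2}u(t)\|^2\right)$$ decays exponentially, that is, there is a positive constant $C(\lambda_1,\delta)$, depending only on $\lambda_1$ and $\delta$ and with $C(\lambda_1,\delta)=O(\delta^3)$ as $\delta\to\infty$, such that $$\mathcal{E}^{(1)}(u)(t)\le C(\lambda_1,\delta)\,e^{-\delta t}\,\mathcal{E}^{(1)}(u)(0),\qquad t\ge0.$$
   Context: $\Omega\subset\mathbb{R}^d$ is a convex polygonal or polyhedral domain. $\mathbf{A}(x)$ is a real symmetric, uniformly positive definite matrix and $a_0(x)\ge 0$, with smooth coefficients. $(\cdot,\cdot)$ and $\|\cdot\|$ are the inner product and norm of $L^2(\Omega)$. $A$ is the self-adjoint positive definite operator on $L^2(\Omega)$ given by $A\phi=-\nabla\cdot(\mathbf{A}(x)\nabla\phi)+a_0(x)\phi$ with domain $D(A)=H^2(\Omega)\cap H^1_0(\Omega)$; $D(A^{1/2})=H^1_0(\Omega)$. $\lambda_1>0$ is the principal (smallest) eigenvalue of $A$. $\alpha$ and $\beta$ are the (constant) viscous damping and compensation coefficients. The solution is the strong solution, with $u$, $u'$, $u''$ locally bounded in time with values in $D(A)$, $D(A^{1/2})$, $L^2(\Omega)$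 respectively (time-continuous representatives are used for pointwise values). *)

theory Defs
  imports "HOL-Analysis.Analysis" "HOL-Library.Landau_Symbols"
begin

section \<open>The Hilbert space \<open>L\<^sup>2(\<Omega>)\<close>\<close>

text \<open>Elements of \<open>L\<^sup>2\<close> are represented by functions; equality in \<open>L\<^sup>2\<close> is equality almost
  everywhere and is always written out as such.\<close>

definition L2 :: "'a measure \<Rightarrow> ('a \<Rightarrow> real) set" where
  "L2 M = {f. f \<in> borel_measurable M \<and> integrable M (\<lambda>x. (f x)\<^sup>2)}"

definition l2_inner :: "'a measure \<Rightarrow> ('a \<Rightarrow> real) \<Rightarrow> ('a \<Rightarrow> real) \<Rightarrow> real" where
  "l2_inner M f g = (\<integral>x. f x * g x \<partial>M)"

definition l2_norm :: "'a measure \<Rightarrow> ('a \<Rightarrow> real) \<Rightarrow> real" where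
  "l2_norm M f = sqrt (l2_inner M f f)"

section \<open>Unbounded operators on \<open>L\<^sup>2\<close>\<close>

text \<open>An unbounded operator is given by its domain \<open>D\<close> and its action \<open>T\<close> on \<open>D\<close>; the values of \<open>T\<close>
  outside \<open>D\<close> are irrelevant. The first clause says that \<open>D\<close> and \<open>T\<close> are well defined on classes
  of functions modulo equality almost everywhere.\<close>

definition L2_operator :: "'a measure \<Rightarrow> ('a \<Rightarrow> real) set \<Rightarrow> (('a \<Rightarrow> real) \<Rightarrow> 'a \<Rightarrow> real) \<Rightarrow> bool" where
  "L2_operator M D T \<longleftrightarrow>
     (\<forall>\<phi>\<in>D. \<forall>\<psi>\<in>L2 M. (AE x in M. \<phi> x = \<psi> x) \<longrightarrow> \<psi> \<in> D \<and> (AE x in M. T \<phi> x = T \<psi> x)) \<and>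
     D \<subseteq> L2 M \<and> (\<lambda>x. 0) \<in> D \<and>
     (\<forall>\<phi>\<in>D. T \<phi> \<in> L2 M) \<and>
     (\<forall>\<phi>\<in>D. \<forall>\<psi>\<in>D. \<forall>a b. (\<lambda>x. a * \<phi> x + b * \<psi> x) \<in> D \<and>
        (AE x in M. T (\<lambda>x. a * \<phi> x + b * \<psi> x) x = a * T \<phi> x + b * T \<psi> x))"

definition densely_defined :: "'a measure \<Rightarrow> ('a \<Rightarrow> real) set \<Rightarrow> bool" where
  "densely_defined M D \<longleftrightarrow> (\<forall>f\<in>L2 M. \<forall>\<epsilon>>0. \<exists>\<phi>\<in>D. l2_norm M (\<lambda>x. f x - \<phi> x) < \<epsilon>)"

text \<open>Self-adjointness: \<open>T\<close> is densely defined and symmetric, and the domain of its adjoint is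
  contained in \<open>D\<close>.\<close>

definition self_adjoint :: "'a measure \<Rightarrow> ('a \<Rightarrow> real) set \<Rightarrow> (('a \<Rightarrow> real) \<Rightarrow> 'a \<Rightarrow> real) \<Rightarrow> bool" where
  "self_adjoint M D T \<longleftrightarrow>
     L2_operator M D T \<and> densely_defined M D \<and>
     (\<forall>\<phi>\<in>D. \<forall>\<psi>\<in>D. l2_inner M (T \<phi>) \<psi> = l2_inner M \<phi> (T \<psi>)) \<and>
     (\<forall>\<phi>\<in>L2 M. (\<exists>f\<in>L2 M. \<forall>\<psi>\<in>D. l2_inner M \<phi> (T \<psi>) = l2_inner M f \<psi>) \<longrightarrow> \<phi> \<in> D)"

text \<open>\<open>(E, S)\<close> is the nonnegative self-adjoint square root \<open>T\<^sup>1\<^sup>/\<^sup>2\<close> of \<open>(D, T)\<close>, including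
  the equality of the domains of \<open>S\<^sup>2\<close> and \<open>T\<close>. Up to equality almost everywhere it is unique.\<close>

definition is_sqrt_operator ::
  "'a measure \<Rightarrow> ('a \<Rightarrow> real) set \<Rightarrow> (('a \<Rightarrow> real) \<Rightarrow> 'a \<Rightarrow> real)
     \<Rightarrow> ('a \<Rightarrow> real) set \<Rightarrow> (('a \<Rightarrow> real) \<Rightarrow> 'a \<Rightarrow> real) \<Rightarrow> bool" where
  "is_sqrt_operator M D T E S \<longleftrightarrow>
     self_adjoint M E S \<and>
     (\<forall>\<phi>\<in>E. 0 \<le> l2_inner M (S \<phi>) \<phi>) \<and>
     D = {\<phi>\<in>E. S \<phi> \<in> E} \<and>
     (\<forall>\<phi>\<in>D. AE x in M. S (S \<phi>) x = T \<phi> x)"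

definition is_eigenvalue ::
  "'a measure \<Rightarrow> ('a \<Rightarrow> real) set \<Rightarrow> (('a \<Rightarrow> real) \<Rightarrow> 'a \<Rightarrow> real) \<Rightarrow> real \<Rightarrow> bool" where
  "is_eigenvalue M D T \<mu> \<longleftrightarrow>
     (\<exists>\<phi>\<in>D. \<not> (AE x in M. \<phi> x = 0) \<and> (AE x in M. T \<phi> x = \<mu> * \<phi> x))"

section \<open>Smooth functions and Sobolev spaces\<close>

definition partial :: "'n \<Rightarrow> (real^'n \<Rightarrow> real) \<Rightarrow> real^'n \<Rightarrow> real" where
  "partial i f x = frechet_derivative f (at x) (axis i 1)"

text \<open>\<open>C_on k f U\<close> is meant for open \<open>U\<close>.\<close>

primrec C_on :: "nat \<Rightarrow> (real^'n \<Rightarrow> real) \<Rightarrow> (real^'n) set \<Rightarrow> bool" where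
  "C_on 0 f U = continuous_on U f"
| "C_on (Suc k) f U = ((\<forall>x\<in>U. f differentiable at x) \<and> (\<forall>i. C_on k (partial i f) U))"

text \<open>Smoothness up to the boundary of \<open>\<Omega>\<close>.\<close>

definition smooth_on_closure :: "(real^'n) set \<Rightarrow> (real^'n \<Rightarrow> real) \<Rightarrow> bool" where
  "smooth_on_closure \<Omega> f \<longleftrightarrow> (\<exists>U. open U \<and> closure \<Omega> \<subseteq> U \<and> (\<forall>k. C_on k f U))"

text \<open>\<open>C\<^sub>c\<^sup>\<infinity>(\<Omega>)\<close>, extended by zero.\<close>

definition test_functions :: "(real^'n) set \<Rightarrow> (real^'n \<Rightarrow> real) set" where
  "test_functions \<Omega> =
     {\<psi>. (\<forall>k. C_on k \<psi> UNIV) \<and> (\<exists>K. compact K \<and> K \<subseteq> \<Omega> \<and> (\<forall>x. x \<notin> K \<longrightarrow> \<psi> x = 0))}"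

abbreviation L2_on :: "(real^'n) set \<Rightarrow> (real^'n \<Rightarrow> real) set" where
  "L2_on \<Omega> \<equiv> L2 (lebesgue_on \<Omega>)"

definition is_weak_partial ::
  "(real^'n) set \<Rightarrow> 'n \<Rightarrow> (real^'n \<Rightarrow> real) \<Rightarrow> (real^'n \<Rightarrow> real) \<Rightarrow> bool" where
  "is_weak_partial \<Omega> i \<phi> g \<longleftrightarrow>
     (\<forall>\<psi>\<in>test_functions \<Omega>.
        (\<integral>x. \<phi> x * partial i \<psi> x \<partial>lebesgue_on \<Omega>) = - (\<integral>x. g x * \<psi> x \<partial>lebesgue_on \<Omega>))"

definition weakly_differentiable :: "(real^'n) set \<Rightarrow> 'n \<Rightarrow> (real^'n \<Rightarrow> real) \<Rightarrow> bool" where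
  "weakly_differentiable \<Omega> i \<phi> \<longleftrightarrow> (\<exists>g\<in>L2_on \<Omega>. is_weak_partial \<Omega> i \<phi> g)"

text \<open>A representative of the weak partial derivative, which is unique almost everywhere.\<close>

definition weak_partial :: "(real^'n) set \<Rightarrow> 'n \<Rightarrow> (real^'n \<Rightarrow> real) \<Rightarrow> real^'n \<Rightarrow> real" where
  "weak_partial \<Omega> i \<phi> = (SOME g. g \<in> L2_on \<Omega> \<and> is_weak_partial \<Omega> i \<phi> g)"

definition H1 :: "(real^'n) set \<Rightarrow> (real^'n \<Rightarrow> real) set" where
  "H1 \<Omega> = {\<phi>\<in>L2_on \<Omega>. \<forall>i. weakly_differentiable \<Omega> i \<phi>}"

definition H2 :: "(real^'n) set \<Rightarrow> (real^'n \<Rightarrow> real) set" where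
  "H2 \<Omega> = {\<phi>\<in>H1 \<Omega>. \<forall>i. weak_partial \<Omega> i \<phi> \<in> H1 \<Omega>}"

text \<open>\<open>H\<^sup>1\<^sub>0(\<Omega>)\<close>: the closure of the test functions in \<open>H\<^sup>1(\<Omega>)\<close>.\<close>

definition H10 :: "(real^'n) set \<Rightarrow> (real^'n \<Rightarrow> real) set" where
  "H10 \<Omega> = {\<phi>\<in>H1 \<Omega>. \<forall>\<epsilon>>0. \<exists>\<psi>\<in>test_functions \<Omega>.
     l2_norm (lebesgue_on \<Omega>) (\<lambda>x. \<phi> x - \<psi> x) < \<epsilon> \<and>
     (\<forall>i. l2_norm (lebesgue_on \<Omega>) (\<lambda>x. weak_partial \<Omega> i \<phi> x - partial i \<psi> x) < \<epsilon>)}"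

section \<open>The elliptic operator\<close>

definition elliptic_domain :: "(real^'n) set \<Rightarrow> (real^'n \<Rightarrow> real) set" where
  "elliptic_domain \<Omega> = H2 \<Omega> \<inter> H10 \<Omega>"

text \<open>\<open>A \<phi> = - \<nabla> \<cdot> (\<AA>(x) \<nabla> \<phi>) + a\<^sub>0(x) \<phi>\<close>, with weak derivatives.\<close>

definition elliptic_op ::
  "(real^'n) set \<Rightarrow> (real^'n \<Rightarrow> real^'n^'n) \<Rightarrow> (real^'n \<Rightarrow> real)
     \<Rightarrow> (real^'n \<Rightarrow> real) \<Rightarrow> real^'n \<Rightarrow> real" where
  "elliptic_op \<Omega> \<AA> a0 \<phi> = (\<lambda>x.
     - (\<Sum>i\<in>UNIV. weak_partial \<Omega> i (\<lambda>y. \<Sum>j\<in>UNIV. \<AA> y $ i $ j * weak_partial \<Omega> j \<phi> y) x)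
     + a0 x * \<phi> x)"

text \<open>A bounded convex polygonal (polyhedral, polytopal) domain.\<close>

definition convex_polyhedral_domain :: "(real^'n) set \<Rightarrow> bool" where
  "convex_polyhedral_domain \<Omega> \<longleftrightarrow> \<Omega> \<noteq> {} \<and> (\<exists>P. polytope P \<and> \<Omega> = interior P)"

definition admissible_coefficients ::
  "(real^'n) set \<Rightarrow> (real^'n \<Rightarrow> real^'n^'n) \<Rightarrow> (real^'n \<Rightarrow> real) \<Rightarrow> bool" where
  "admissible_coefficients \<Omega> \<AA> a0 \<longleftrightarrow>
     (\<forall>i j. smooth_on_closure \<Omega> (\<lambda>x. \<AA> x $ i $ j)) \<and> smooth_on_closure \<Omega> a0 \<and>
     (\<forall>x\<in>\<Omega>. transpose (\<AA> x) = \<AA> x) \<and>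
     (\<exists>c>0. \<forall>x\<in>\<Omega>. \<forall>\<xi>. c * (\<xi> \<bullet> \<xi>) \<le> \<xi> \<bullet> (\<AA> x *v \<xi>)) \<and>
     (\<forall>x\<in>\<Omega>. 0 \<le> a0 x)"

text \<open>The standing assumptions: \<open>A\<close> is self-adjoint with domain \<open>H\<^sup>2(\<Omega>) \<inter> H\<^sup>1\<^sub>0(\<Omega>)\<close>, \<open>S\<close> is its
  square root \<open>A\<^sup>1\<^sup>/\<^sup>2\<close>, with domain \<open>H\<^sup>1\<^sub>0(\<Omega>)\<close>, and \<open>lam\<close> is the smallest eigenvalue of \<open>A\<close>. For
  convex \<open>\<Omega>\<close> and admissible coefficients the self-adjointness, the domain of the square root
  and the positivity of \<open>lam\<close> are theorems, so that they restrict nothing.\<close>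

definition elliptic_setting ::
  "(real^'n) set \<Rightarrow> (real^'n \<Rightarrow> real^'n^'n) \<Rightarrow> (real^'n \<Rightarrow> real)
     \<Rightarrow> ((real^'n \<Rightarrow> real) \<Rightarrow> real^'n \<Rightarrow> real) \<Rightarrow> real \<Rightarrow> bool" where
  "elliptic_setting \<Omega> \<AA> a0 S lam \<longleftrightarrow>
     (let M = lebesgue_on \<Omega>; D = elliptic_domain \<Omega>; A = elliptic_op \<Omega> \<AA> a0 in
       convex_polyhedral_domain \<Omega> \<and> admissible_coefficients \<Omega> \<AA> a0 \<and>
       self_adjoint M D A \<and>
       is_sqrt_operator M D A (H10 \<Omega>) S \<and>
       0 < lam \<and> is_eigenvalue M D A lam \<and> (\<forall>\<mu>. is_eigenvalue M D A \<mu> \<longrightarrow> lam \<le> \<mu>))"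

section \<open>Strong solutions and their energy\<close>

text \<open>\<open>g\<close> is the derivative at time \<open>t\<close>, in the norm of \<open>L\<^sup>2\<close>, of \<open>f : [0,\<infinity>) \<rightarrow> L\<^sup>2\<close>
  (one-sided at \<open>t = 0\<close>).\<close>

definition has_L2_derivative ::
  "'a measure \<Rightarrow> (real \<Rightarrow> 'a \<Rightarrow> real) \<Rightarrow> ('a \<Rightarrow> real) \<Rightarrow> real \<Rightarrow> bool" where
  "has_L2_derivative M f g t \<longleftrightarrow>
     ((\<lambda>s. l2_norm M (\<lambda>x. (f s x - f t x) / (s - t) - g x)) \<longlongrightarrow> 0) (at t within {0..})"

definition L2_continuous :: "'a measure \<Rightarrow> (real \<Rightarrow> 'a \<Rightarrow> real) \<Rightarrow> bool" where
  "L2_continuous M f \<longleftrightarrow>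
     (\<forall>t\<ge>0. ((\<lambda>s. l2_norm M (\<lambda>x. f s x - f t x)) \<longlongrightarrow> 0) (at t within {0..}))"

text \<open>Strong solutions of \<open>u'' + \<alpha> u' + \<beta> u + A u = 0\<close>, \<open>u(0) = u0\<close>, \<open>u'(0) = u1\<close>, where
  \<open>S = A\<^sup>1\<^sup>/\<^sup>2\<close>. The derivative \<open>u'\<close> belongs to \<open>W\<^sup>1\<^sup>,\<^sup>\<infinity>(0,T; L\<^sup>2)\<close> for every \<open>T\<close>. As \<open>L\<^sup>2\<close> is a
  Hilbert space, this means for its time-continuous representative that it is Lipschitz on
  \<open>[0,T]\<close>; the derivative \<open>u''\<close> then exists almost everywhere in the norm of \<open>L\<^sup>2\<close>. The domains
  of \<open>A\<close> and \<open>A\<^sup>1\<^sup>/\<^sup>2\<close> carry their graph norms.\<close>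

definition strong_solution ::
  "(real^'n) set \<Rightarrow> (real^'n \<Rightarrow> real^'n^'n) \<Rightarrow> (real^'n \<Rightarrow> real)
     \<Rightarrow> ((real^'n \<Rightarrow> real) \<Rightarrow> real^'n \<Rightarrow> real) \<Rightarrow> real \<Rightarrow> real
     \<Rightarrow> (real^'n \<Rightarrow> real) \<Rightarrow> (real^'n \<Rightarrow> real)
     \<Rightarrow> (real \<Rightarrow> real^'n \<Rightarrow> real) \<Rightarrow> (real \<Rightarrow> real^'n \<Rightarrow> real) \<Rightarrow> (real \<Rightarrow> real^'n \<Rightarrow> real) \<Rightarrow> bool" where
  "strong_solution \<Omega> \<AA> a0 S \<alpha> \<beta> u0 u1 u u' u'' \<longleftrightarrow>
     (let M = lebesgue_on \<Omega>; D = elliptic_domain \<Omega>; A = elliptic_op \<Omega> \<AA> a0 in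
       u0 \<in> D \<and> (AE x in M. u 0 x = u0 x) \<and>
       u1 \<in> H10 \<Omega> \<and> (AE x in M. u' 0 x = u1 x) \<and>
       (\<forall>t\<ge>0. u t \<in> H10 \<Omega> \<and> u' t \<in> L2_on \<Omega>) \<and>
       L2_continuous M (\<lambda>t. S (u t)) \<and>
       (\<forall>t\<ge>0. has_L2_derivative M u (u' t) t) \<and>
       (\<forall>T>0. \<exists>K. \<forall>s\<in>{0..T}. \<forall>t\<in>{0..T}. l2_norm M (\<lambda>x. u' s x - u' t x) \<le> K * \<bar>s - t\<bar>) \<and>
       (\<forall>T>0. \<exists>K. AE t in lebesgue_on {0<..<T}.
          u t \<in> D \<and> l2_norm M (u t) \<le> K \<and> l2_norm M (A (u t)) \<le> K \<and>
          u' t \<in> H10 \<Omega> \<and> l2_norm M (u' t) \<le> K \<and> l2_norm M (S (u' t)) \<le> K \<and>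
          u'' t \<in> L2_on \<Omega> \<and> l2_norm M (u'' t) \<le> K) \<and>
       (AE t in lebesgue_on {0<..}. has_L2_derivative M u' (u'' t) t) \<and>
       (AE t in lebesgue_on {0<..}. AE x in M.
          u'' t x + \<alpha> * u' t x + \<beta> * u t x + A (u t) x = 0))"

definition energy1 ::
  "(real^'n) set \<Rightarrow> ((real^'n \<Rightarrow> real) \<Rightarrow> real^'n \<Rightarrow> real)
     \<Rightarrow> (real \<Rightarrow> real^'n \<Rightarrow> real) \<Rightarrow> (real \<Rightarrow> real^'n \<Rightarrow> real) \<Rightarrow> real \<Rightarrow> real" where
  "energy1 \<Omega> S u u' t =
     1 / 2 * ((l2_norm (lebesgue_on \<Omega>) (u' t))\<^sup>2 + (l2_norm (lebesgue_on \<Omega>) (S (u t)))\<^sup>2)"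

text \<open>As a dimension is a type here, a constant that is existentially quantified inside a statement
  cannot range over all dimensions at once. The theorem therefore asserts one constant that serves
  polygonal domains (\<open>real^2\<close>), polyhedral domains (\<open>real^3\<close>) and domains in \<open>real^'n\<close> for an
  arbitrary \<open>'n\<close> simultaneously.\<close>

end

theory Submission
  imports Defs
begin

text \<open>
  With \<open>v = u' + \<delta> u\<close> and \<open>\<gamma> = \<delta> (2 + \<delta> + \<delta>\<^sup>2)\<close>, the choice of \<open>\<alpha>\<close> and \<open>\<beta>\<close> turns the equation into the first
  order system \<open>v' = -\<delta> (2 + \<delta>) v - \<gamma> u - A u\<close>, \<open>u' = v - \<delta> u\<close>. In the time derivative of the functional
  \<open>F = 1/2 (\<parallel>v\<parallel>\<^sup>2 + \<parallel>A\<^sup>1\<^sup>/\<^sup>2 u\<parallel>\<^sup>2 + \<gamma> \<parallel>u\<parallel>\<^sup>2)\<close> the coupling terms cancel, and \<open>F' \<le> - 2 \<delta> F\<close> remains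
  (\<open>damped_wave_lyapunov_decay\<close>). So \<open>F\<close> even decays like \<open>exp (- 2 \<delta> t)\<close>. The energy is at most \<open>2 F\<close>; in
  the other direction, at time \<open>0\<close>, \<open>F\<close> contains \<open>\<parallel>u\<parallel>\<^sup>2\<close> with a factor of order \<open>\<delta>\<^sup>3\<close>, and
  \<open>\<lambda>\<^sub>1 \<parallel>u\<parallel>\<^sup>2 \<le> \<parallel>A\<^sup>1\<^sup>/\<^sup>2 u\<parallel>\<^sup>2\<close> bounds this by the energy (\<open>lyapunov_energy_comparison\<close>). This explains the constant
  (\<open>decay_constant\<close>) and its cubic growth.

  Two points take work. The first one is the inequality just used, because \<open>\<lambda>\<^sub>1\<close> is given as the
  smallest eigenvalue, not as an infimum of the Rayleigh quotient. If the quotient had a smaller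
  infimum, a minimizing sequence would, by compactness, have a limit, and self-adjointness would make
  this limit an eigenfunction (\<open>rayleigh_quotient_infimum_is_eigenvalue\<close>). Compactness comes from
  coercivity, that is, integration by parts for the elliptic operator (\<open>elliptic_op_coercive\<close>), and
  from Rellich's theorem (\<open>test_functions_rellich\<close>), which rests on approximation by means over small
  cubes (\<open>friedrichs_inequality\<close>) and on the completeness of \<open>L\<^sup>2\<close> (\<open>L2_complete\<close>).

  The second point is that \<open>F\<close> is differentiable only at almost every time. It is, however, Lipschitz on
  bounded intervals (for \<open>\<parallel>A\<^sup>1\<^sup>/\<^sup>2 u\<parallel>\<^sup>2\<close>, see \<open>sqrt_energy_lipschitz\<close> and \<open>sqrt_energy_derivative\<close>), and a Lipschitz
  function whose derivative is nonpositive almost everywhere does not increase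
  (\<open>lipschitz_derivative_nonpos_AE_imp_le\<close>).
\<close>

section \<open>The seminormed space \<open>L\<^sup>2\<close>\<close>

lemma L2_integrable_mult:
  assumes "f \<in> L2 M" "g \<in> L2 M"
  shows "integrable M (\<lambda>x. f x * g x)"
proof (rule Bochner_Integration.integrable_bound)
  show "integrable M (\<lambda>x. (f x)\<^sup>2 + (g x)\<^sup>2)"
    using assms by (auto simp: L2_def)
  show "(\<lambda>x. f x * g x) \<in> borel_measurable M"
    using assms by (auto simp: L2_def)
  show "AE x in M. norm (f x * g x) \<le> norm ((f x)\<^sup>2 + (g x)\<^sup>2)"
  proof (rule AE_I2)
    fix x
    have "0 \<le> (\<bar>f x\<bar> - \<bar>g x\<bar>)\<^sup>2" by simp
    then have "2 * (\<bar>f x\<bar> * \<bar>g x\<bar>) \<le> (f x)\<^sup>2 + (g x)\<^sup>2"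
      by (simp add: power2_diff)
    moreover have "0 \<le> \<bar>f x\<bar> * \<bar>g x\<bar>" by simp
    ultimately have "\<bar>f x\<bar> * \<bar>g x\<bar> \<le> (f x)\<^sup>2 + (g x)\<^sup>2" by linarith
    then show "norm (f x * g x) \<le> norm ((f x)\<^sup>2 + (g x)\<^sup>2)"
      by (simp add: abs_mult)
  qed
qed

lemma L2_measurable: "f \<in> L2 M \<Longrightarrow> f \<in> borel_measurable M"
  by (simp add: L2_def)

lemma L2_integrable_square: "f \<in> L2 M \<Longrightarrow> integrable M (\<lambda>x. (f x)\<^sup>2)"
  by (simp add: L2_def)

lemma L2_cmult [simp]: "f \<in> L2 M \<Longrightarrow> (\<lambda>x. a * f x) \<in> L2 M"
  by (auto simp: L2_def power_mult_distrib)

lemma L2_add [simp]: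
  assumes "f \<in> L2 M" "g \<in> L2 M"
  shows "(\<lambda>x. f x + g x) \<in> L2 M"
  using assms L2_integrable_mult[OF assms]
  by (auto simp: L2_def power2_sum mult.assoc)

lemma L2_diff [simp]:
  assumes "f \<in> L2 M" "g \<in> L2 M"
  shows "(\<lambda>x. f x - g x) \<in> L2 M"
  using L2_add[OF assms(1) L2_cmult[OF assms(2), of "-1"]] by simp

lemma L2_divide [simp]: "f \<in> L2 M \<Longrightarrow> (\<lambda>x. f x / a) \<in> L2 M"
  using L2_cmult[of f M "1 / a"] by simp

lemma L2_uminus [simp]: "f \<in> L2 M \<Longrightarrow> (\<lambda>x. - f x) \<in> L2 M"
  using L2_cmult[of f M "-1"] by simp

lemma L2_zero [simp]: "(\<lambda>x. 0) \<in> L2 M"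
  by (simp add: L2_def)

lemma L2_sum [simp]:
  "finite I \<Longrightarrow> (\<And>i. i \<in> I \<Longrightarrow> f i \<in> L2 M) \<Longrightarrow> (\<lambda>x. \<Sum>i\<in>I. f i x) \<in> L2 M"
  by (induction I rule: finite_induct) auto

lemma l2_inner_commute: "l2_inner M f g = l2_inner M g f"
  by (simp add: l2_inner_def mult.commute)

lemma l2_inner_add_left:
  "f \<in> L2 M \<Longrightarrow> g \<in> L2 M \<Longrightarrow> h \<in> L2 M \<Longrightarrow>
    l2_inner M (\<lambda>x. f x + g x) h = l2_inner M f h + l2_inner M g h"
  by (simp add: l2_inner_def distrib_right L2_integrable_mult)

lemma l2_inner_diff_left:
  "f \<in> L2 M \<Longrightarrow> g \<in> L2 M \<Longrightarrow> h \<in> L2 M \<Longrightarrow>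
    l2_inner M (\<lambda>x. f x - g x) h = l2_inner M f h - l2_inner M g h"
  by (simp add: l2_inner_def left_diff_distrib L2_integrable_mult)

lemma l2_inner_add_right:
  "f \<in> L2 M \<Longrightarrow> g \<in> L2 M \<Longrightarrow> h \<in> L2 M \<Longrightarrow>
    l2_inner M h (\<lambda>x. f x + g x) = l2_inner M h f + l2_inner M h g"
  by (simp add: l2_inner_def distrib_left L2_integrable_mult)

lemma l2_inner_diff_right:
  "f \<in> L2 M \<Longrightarrow> g \<in> L2 M \<Longrightarrow> h \<in> L2 M \<Longrightarrow>
    l2_inner M h (\<lambda>x. f x - g x) = l2_inner M h f - l2_inner M h g"
  by (simp add: l2_inner_def right_diff_distrib L2_integrable_mult)

lemma l2_inner_cmult_left: "l2_inner M (\<lambda>x. a * f x) h = a * l2_inner M f h"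
  by (simp add: l2_inner_def mult.assoc)

lemma l2_inner_cmult_right: "l2_inner M h (\<lambda>x. a * f x) = a * l2_inner M h f"
  by (simp add: l2_inner_def mult.left_commute)

lemma l2_inner_divide_left: "l2_inner M (\<lambda>x. f x / a) h = l2_inner M f h / a"
  using l2_inner_cmult_left[of M "1/a" f h] by simp

lemma l2_inner_divide_right: "l2_inner M h (\<lambda>x. f x / a) = l2_inner M h f / a"
  using l2_inner_cmult_right[of M h "1/a" f] by simp

lemmas l2_inner_algebra =
  l2_inner_add_left l2_inner_diff_left l2_inner_add_right l2_inner_diff_right
  l2_inner_cmult_left l2_inner_cmult_right l2_inner_divide_left l2_inner_divide_right

lemma l2_inner_cong_AE:
  assumes "f \<in> L2 M" "f' \<in> L2 M" "g \<in> L2 M" "g' \<in> L2 M"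
    and "AE x in M. f x = f' x" "AE x in M. g x = g' x"
  shows "l2_inner M f g = l2_inner M f' g'"
  unfolding l2_inner_def
proof (rule integral_cong_AE)
  show "AE x in M. f x * g x = f' x * g' x" using assms(5,6) by eventually_elim simp
qed (use assms in \<open>auto intro!: borel_measurable_times dest: L2_measurable\<close>)

lemma l2_inner_self_nonneg: "0 \<le> l2_inner M f f"
  by (simp add: l2_inner_def)

lemma l2_norm_nonneg [simp]: "0 \<le> l2_norm M f"
  by (simp add: l2_norm_def l2_inner_self_nonneg)

lemma l2_norm_square: "(l2_norm M f)\<^sup>2 = l2_inner M f f"
  by (simp add: l2_norm_def l2_inner_self_nonneg)

lemma l2_norm_minus_commute: "l2_norm M (\<lambda>x. f x - g x) = l2_norm M (\<lambda>x. g x - f x)"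
  by (simp add: l2_norm_def l2_inner_def algebra_simps)

lemma l2_norm_cmult: "l2_norm M (\<lambda>x. a * f x) = \<bar>a\<bar> * l2_norm M f"
  by (simp add: l2_norm_def l2_inner_cmult_left l2_inner_cmult_right real_sqrt_mult
      flip: mult.assoc power2_eq_square)

text \<open>Used twice: for the Cauchy-Schwarz inequality, and for a self-adjoint operator bounded below by
  its bottom \<open>m\<close>, where the vanishing of one diagonal coefficient forces the mixed coefficient to
  vanish.\<close>

lemma quadratic_nonneg_imp_discriminant:
  fixes a b c :: real
  assumes "\<And>t. 0 \<le> a + 2 * t * c + t\<^sup>2 * b"
  shows "c\<^sup>2 \<le> a * b"
proof (cases "b = 0")
  case True
  have "c = 0"
  proof (rule ccontr)
    assume "c \<noteq> 0"
    then have "2 * (-(a + 1) / (2 * c)) * c = -(a + 1)" by simp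
    then show False using assms[of "-(a + 1) / (2 * c)"] True by simp
  qed
  then show ?thesis using True by simp
next
  case False
  have "0 \<le> b"
  proof (rule ccontr)
    assume b: "\<not> 0 \<le> b"
    define t where "t = (\<bar>a\<bar> + 2 * \<bar>c\<bar> + 1) / (-b) + 1"
    have t: "t \<ge> 1" "t * (-b) \<ge> \<bar>a\<bar> + 2 * \<bar>c\<bar> + 1"
      using b by (auto simp: t_def field_simps divide_nonneg_neg divide_nonneg_pos)
    have "t * (t * (-b)) \<ge> t * (\<bar>a\<bar> + 2 * \<bar>c\<bar> + 1)"
      using t by (intro mult_left_mono) auto
    moreover have "t * \<bar>a\<bar> \<ge> \<bar>a\<bar>" "t * \<bar>c\<bar> \<ge> t * c"
      using t by (auto simp: mult_left_mono mult_le_cancel_right1)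
    ultimately have "a + 2 * t * c + t\<^sup>2 * b \<le> -t"
      by (simp add: algebra_simps power2_eq_square)
    then show False using assms[of t] t(1) by linarith
  qed
  then show ?thesis using assms[of "- c / b"] False
    by (simp add: field_simps power2_eq_square)
qed

lemma l2_Cauchy_Schwarz:
  assumes f: "f \<in> L2 M" and g: "g \<in> L2 M"
  shows "\<bar>l2_inner M f g\<bar> \<le> l2_norm M f * l2_norm M g"
proof -
  have "(l2_inner M f g)\<^sup>2 \<le> l2_inner M f f * l2_inner M g g"
  proof (rule quadratic_nonneg_imp_discriminant)
    fix t
    have "0 \<le> l2_inner M (\<lambda>x. f x + t * g x) (\<lambda>x. f x + t * g x)"
      by (rule l2_inner_self_nonneg)
    then show "0 \<le> l2_inner M f f + 2 * t * l2_inner M f g + t\<^sup>2 * l2_inner M g g"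
      using f g by (simp add: l2_inner_algebra l2_inner_commute[of M g f] power2_eq_square
          algebra_simps)
  qed
  then have "sqrt ((l2_inner M f g)\<^sup>2) \<le> sqrt (l2_inner M f f * l2_inner M g g)"
    by (rule real_sqrt_le_mono)
  then show ?thesis by (simp add: l2_norm_def real_sqrt_mult)
qed

lemma l2_norm_triangle:
  assumes f: "f \<in> L2 M" and g: "g \<in> L2 M"
  shows "l2_norm M (\<lambda>x. f x + g x) \<le> l2_norm M f + l2_norm M g"
proof (rule power2_le_imp_le)
  have "(l2_norm M (\<lambda>x. f x + g x))\<^sup>2
      = (l2_norm M f)\<^sup>2 + 2 * l2_inner M f g + (l2_norm M g)\<^sup>2"
    using f g by (simp add: l2_norm_square l2_inner_algebra l2_inner_commute[of M g f])
  then show "(l2_norm M (\<lambda>x. f x + g x))\<^sup>2 \<le> (l2_norm M f + l2_norm M g)\<^sup>2"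
    using l2_Cauchy_Schwarz[OF f g] by (simp add: power2_sum)
qed simp

lemma l2_norm_triangle_diff:
  assumes "f \<in> L2 M" "g \<in> L2 M" "h \<in> L2 M"
  shows "l2_norm M (\<lambda>x. f x - h x)
    \<le> l2_norm M (\<lambda>x. f x - g x) + l2_norm M (\<lambda>x. g x - h x)"
  using l2_norm_triangle[of "\<lambda>x. f x - g x" M "\<lambda>x. g x - h x"] assms by simp

lemma l2_norm_triangle_le:
  assumes "f \<in> L2 M" "g \<in> L2 M"
  shows "l2_norm M f \<le> l2_norm M (\<lambda>x. f x - g x) + l2_norm M g"
  using l2_norm_triangle[of "\<lambda>x. f x - g x" M g] assms by simp

lemma l2_norm_eq_0_imp_AE:
  assumes "f \<in> L2 M" "l2_norm M f = 0"
  shows "AE x in M. f x = 0"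
proof -
  have "(\<integral>x. (f x)\<^sup>2 \<partial>M) = 0"
    using assms(2) by (simp add: l2_norm_def l2_inner_def power2_eq_square)
  then have "AE x in M. (f x)\<^sup>2 = 0"
    using integral_nonneg_eq_0_iff_AE[OF L2_integrable_square[OF assms(1)]] by simp
  then show ?thesis by simp
qed

lemma l2_inner_tendsto:
  assumes f: "eventually (\<lambda>s. f s \<in> L2 M) F" and g: "eventually (\<lambda>s. g s \<in> L2 M) F"
    and l: "l \<in> L2 M" and m: "m \<in> L2 M"
    and fl: "((\<lambda>s. l2_norm M (\<lambda>x. f s x - l x)) \<longlongrightarrow> 0) F"
    and gm: "((\<lambda>s. l2_norm M (\<lambda>x. g s x - m x)) \<longlongrightarrow> 0) F"
  shows "((\<lambda>s. l2_inner M (f s) (g s)) \<longlongrightarrow> l2_inner M l m) F"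
proof (rule LIM_zero_cancel, rule Lim_null_comparison)
  let ?p = "\<lambda>s. l2_norm M (\<lambda>x. f s x - l x)" and ?q = "\<lambda>s. l2_norm M (\<lambda>x. g s x - m x)"
  show "((\<lambda>s. ?p s * ?q s + ?p s * l2_norm M m + l2_norm M l * ?q s) \<longlongrightarrow> 0) F"
    using fl gm by (auto intro!: tendsto_eq_intros)
  show "\<forall>\<^sub>F s in F. norm (l2_inner M (f s) (g s) - l2_inner M l m)
      \<le> ?p s * ?q s + ?p s * l2_norm M m + l2_norm M l * ?q s"
    using f g
  proof eventually_elim
    case (elim s)
    have "l2_inner M (f s) (g s) - l2_inner M l m =
      l2_inner M (\<lambda>x. f s x - l x) (\<lambda>x. g s x - m x) +
      l2_inner M (\<lambda>x. f s x - l x) m + l2_inner M l (\<lambda>x. g s x - m x)"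
      using elim l m by (simp add: l2_inner_algebra)
    moreover have "\<bar>l2_inner M (\<lambda>x. f s x - l x) (\<lambda>x. g s x - m x)\<bar> \<le> ?p s * ?q s"
      "\<bar>l2_inner M (\<lambda>x. f s x - l x) m\<bar> \<le> ?p s * l2_norm M m"
      "\<bar>l2_inner M l (\<lambda>x. g s x - m x)\<bar> \<le> l2_norm M l * ?q s"
      using elim l m by (auto intro!: l2_Cauchy_Schwarz)
    ultimately show ?case by simp
  qed
qed

lemma l2_norm_const_tendsto:
  "((\<lambda>s. l2_norm M (\<lambda>x. f x - f x)) \<longlongrightarrow> 0) F"
  by (simp add: l2_norm_def l2_inner_def)

text \<open>With \<open>d\<^sub>k = \<bar>Y (k+1) - Y k\<bar>\<close>, the series of the \<open>2^k d\<^sub>k\<^sup>2\<close> has finite integral and is therefore finite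
  almost everywhere. It controls the series of the \<open>d\<^sub>k\<close> themselves, because
  \<open>2 d\<^sub>k \<le> 2^(-k) + 2^k d\<^sub>k\<^sup>2\<close>.\<close>

lemma L2_geometric_subsequence_converges_AE:
  fixes Y :: "nat \<Rightarrow> 'a \<Rightarrow> real"
  assumes Y: "\<And>k. Y k \<in> L2 M"
    and d: "\<And>k. l2_norm M (\<lambda>x. Y (Suc k) x - Y k x) \<le> (1/2) ^ k"
  shows "AE x in M. convergent (\<lambda>k. Y k x)"
proof -
  let ?d = "\<lambda>k x. (Y (Suc k) x - Y k x)\<^sup>2"
  have [measurable]: "Y k \<in> borel_measurable M" for k using Y L2_measurable by blast
  have bound: "(\<integral>\<^sup>+x. ennreal (2 ^ k * ?d k x) \<partial>M) \<le> ennreal ((1/2) ^ k)" for k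
  proof -
    have int: "integrable M (?d k)" using Y by (intro L2_integrable_square) auto
    have "(\<integral>x. ?d k x \<partial>M) = (l2_norm M (\<lambda>x. Y (Suc k) x - Y k x))\<^sup>2"
      unfolding l2_norm_square l2_inner_def by (simp add: power2_eq_square)
    also have "\<dots> \<le> ((1/2) ^ k)\<^sup>2" using d by (intro power_mono) auto
    finally have "2 ^ k * (\<integral>x. ?d k x \<partial>M) \<le> 2 ^ k * ((1/2) ^ k)\<^sup>2" by simp
    also have "\<dots> = (1/2) ^ k"
      by (simp add: power2_eq_square flip: power_mult_distrib)
    finally show ?thesis using int by (subst nn_integral_eq_integral) (auto intro: ennreal_leI)
  qed
  have "(\<integral>\<^sup>+x. (\<Sum>k. ennreal (2 ^ k * ?d k x)) \<partial>M)
      = (\<Sum>k. \<integral>\<^sup>+x. ennreal (2 ^ k * ?d k x) \<partial>M)"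
    by (rule nn_integral_suminf) measurable
  also have "\<dots> \<le> (\<Sum>k. ennreal ((1/2) ^ k))"
    by (rule suminf_le) (use bound in auto)
  also have "\<dots> < \<infinity>"
    by (subst suminf_ennreal2) auto
  finally have "AE x in M. (\<Sum>k. ennreal (2 ^ k * ?d k x)) \<noteq> \<infinity>"
    by (intro nn_integral_PInf_AE) (auto simp: less_top)
  then show ?thesis
  proof eventually_elim
    case (elim x)
    then have s: "summable (\<lambda>k. 2 ^ k * ?d k x)"
      by (intro summable_suminf_not_top) auto
    have "summable (\<lambda>k. Y (Suc k) x - Y k x)"
    proof (rule summable_comparison_test)
      show "summable (\<lambda>k. (1/2) ^ k + 2 ^ k * ?d k x)"
        using s by (intro summable_add) auto
      have "\<bar>Y (Suc k) x - Y k x\<bar> \<le> (1/2) ^ k + 2 ^ k * ?d k x" for k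
      proof -
        let ?e = "\<bar>Y (Suc k) x - Y k x\<bar>"
        have "0 \<le> (1/2) ^ k * (1 - 2 ^ k * ?e)\<^sup>2" by simp
        also have "\<dots> = (1/2) ^ k - 2 * ?e + 2 ^ k * ?d k x"
          by (simp add: power2_eq_square algebra_simps flip: power_mult_distrib)
        finally have "2 * ?e \<le> (1/2) ^ k + 2 ^ k * ?d k x" by simp
        moreover have "?e \<le> 2 * ?e" by simp
        ultimately show ?thesis by (rule order_trans[rotated])
      qed
      then show "\<exists>N. \<forall>k\<ge>N. norm (Y (Suc k) x - Y k x) \<le> (1/2) ^ k + 2 ^ k * ?d k x"
        by simp
    qed
    then have "convergent (\<lambda>n. \<Sum>k<n. Y (Suc k) x - Y k x)"
      by (simp add: summable_iff_convergent)
    then have "convergent (\<lambda>n. (\<Sum>k<n. Y (Suc k) x - Y k x) + Y 0 x)"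
      by (intro convergent_add convergent_const)
    moreover have "(\<lambda>n. (\<Sum>k<n. Y (Suc k) x - Y k x) + Y 0 x) = (\<lambda>n. Y n x)"
      by (simp add: sum_lessThan_telescope[of "\<lambda>k. Y k x"])
    ultimately show ?case by (simp only:)
  qed
qed

text \<open>The Riesz-Fischer theorem. A subsequence with geometrically small increments converges almost
  everywhere; Fatou's lemma turns its pointwise limit into the limit of the whole sequence in the
  norm.\<close>

lemma L2_complete:
  fixes X :: "nat \<Rightarrow> 'a \<Rightarrow> real"
  assumes X: "\<And>n. X n \<in> L2 M"
    and C: "\<And>e. e > 0 \<Longrightarrow> \<exists>N. \<forall>m\<ge>N. \<forall>n\<ge>N. l2_norm M (\<lambda>x. X m x - X n x) < e"
  shows "\<exists>l\<in>L2 M. (\<lambda>n. l2_norm M (\<lambda>x. X n x - l x)) \<longlonglongrightarrow> 0"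
proof -
  have "\<exists>N. \<forall>k. \<forall>m\<ge>N k. \<forall>n\<ge>N k. l2_norm M (\<lambda>x. X m x - X n x) < (1/2) ^ k"
    by (rule choice) (simp add: C)
  then obtain N where
    N: "\<And>k m n. m \<ge> N k \<Longrightarrow> n \<ge> N k \<Longrightarrow> l2_norm M (\<lambda>x. X m x - X n x) < (1/2) ^ k"
    by blast
  \<comment> \<open>A sum of the \<open>N j\<close> makes the indices monotone, so that \<open>r j \<ge> N k\<close> for all \<open>j \<ge> k\<close>.\<close>
  define r where "r k = (\<Sum>j\<le>k. N j)" for k
  have rN: "N k \<le> r j" if "k \<le> j" for k j
    unfolding r_def using that by (intro member_le_sum) auto
  define Y where "Y k = X (r k)" for k
  have Y [simp]: "Y k \<in> L2 M" for k by (simp add: Y_def X)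
  have [measurable]: "Y k \<in> borel_measurable M" for k using Y L2_measurable by blast
  have "AE x in M. convergent (\<lambda>k. Y k x)"
    by (rule L2_geometric_subsequence_converges_AE[OF Y])
       (auto simp: Y_def intro!: less_imp_le N rN)
  define l where "l x = lim (\<lambda>k. Y k x)" for x
  have lm [measurable]: "l \<in> borel_measurable M"
    unfolding l_def by (rule borel_measurable_lim_metric) measurable
  have lim: "AE x in M. (\<lambda>k. Y k x) \<longlonglongrightarrow> l x"
    using \<open>AE x in M. convergent (\<lambda>k. Y k x)\<close>
    by eventually_elim (simp add: l_def convergent_LIMSEQ_iff)
  have bound: "(\<integral>\<^sup>+x. ennreal ((X n x - l x)\<^sup>2) \<partial>M) \<le> ennreal (((1/2) ^ k)\<^sup>2)"
    if n: "n \<ge> N k" for n k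
  proof -
    have [measurable]: "X n \<in> borel_measurable M" using X L2_measurable by blast
    have "(\<integral>\<^sup>+x. ennreal ((X n x - l x)\<^sup>2) \<partial>M)
        = (\<integral>\<^sup>+x. liminf (\<lambda>j. ennreal ((X n x - Y j x)\<^sup>2)) \<partial>M)"
    proof (rule nn_integral_cong_AE)
      show "AE x in M. ennreal ((X n x - l x)\<^sup>2) = liminf (\<lambda>j. ennreal ((X n x - Y j x)\<^sup>2))"
        using lim
      proof eventually_elim
        case (elim x)
        have "(\<lambda>j. ennreal ((X n x - Y j x)\<^sup>2)) \<longlonglongrightarrow> ennreal ((X n x - l x)\<^sup>2)"
          by (intro tendsto_intros elim)
        then show ?case by (intro lim_imp_Liminf[symmetric]) simp_all
      qed
    qed
    also have "\<dots> \<le> liminf (\<lambda>j. \<integral>\<^sup>+x. ennreal ((X n x - Y j x)\<^sup>2) \<partial>M)"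
      by (rule nn_integral_liminf) measurable
    also have "\<dots> \<le> liminf (\<lambda>j. ennreal (((1/2) ^ k)\<^sup>2))"
    proof (rule Liminf_mono)
      show "\<forall>\<^sub>F j in sequentially.
          (\<integral>\<^sup>+x. ennreal ((X n x - Y j x)\<^sup>2) \<partial>M) \<le> ennreal (((1/2) ^ k)\<^sup>2)"
        using eventually_ge_at_top[of k]
      proof eventually_elim
        case (elim j)
        have "integrable M (\<lambda>x. (X n x - Y j x)\<^sup>2)"
          by (intro L2_integrable_square L2_diff X Y)
        then have "(\<integral>\<^sup>+x. ennreal ((X n x - Y j x)\<^sup>2) \<partial>M)
            = ennreal ((l2_norm M (\<lambda>x. X n x - Y j x))\<^sup>2)"
          by (subst nn_integral_eq_integral)
             (auto simp: l2_norm_square l2_inner_def simp flip: power2_eq_square)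
        also have "\<dots> \<le> ennreal (((1/2) ^ k)\<^sup>2)"
          using N[OF n rN[OF elim]]
          by (intro ennreal_leI power_mono) (auto simp: Y_def)
        finally show ?case .
      qed
    qed
    finally show ?thesis by (simp add: Liminf_const)
  qed
  have dL2: "(\<lambda>x. X n x - l x) \<in> L2 M" if n: "n \<ge> N 0" for n
  proof -
    have [measurable]: "X n \<in> borel_measurable M" using X L2_measurable by blast
    have "integrable M (\<lambda>x. (X n x - l x)\<^sup>2)"
      using bound[OF n] by (intro integrableI_nonneg) (auto intro: le_less_trans)
    then show ?thesis by (auto simp: L2_def)
  qed
  have l: "l \<in> L2 M"
    using L2_diff[OF X[of "N 0"] dL2[of "N 0"]] by simp
  have nb: "l2_norm M (\<lambda>x. X n x - l x) \<le> (1/2) ^ k" if n: "n \<ge> N k" for n k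
  proof -
    have "integrable M (\<lambda>x. (X n x - l x)\<^sup>2)"
      by (intro L2_integrable_square L2_diff X l)
    then have "ennreal ((l2_norm M (\<lambda>x. X n x - l x))\<^sup>2)
        = (\<integral>\<^sup>+x. ennreal ((X n x - l x)\<^sup>2) \<partial>M)"
      by (subst nn_integral_eq_integral)
         (auto simp: l2_norm_square l2_inner_def simp flip: power2_eq_square)
    also have "\<dots> \<le> ennreal (((1/2) ^ k)\<^sup>2)" by (rule bound[OF n])
    finally have "(l2_norm M (\<lambda>x. X n x - l x))\<^sup>2 \<le> ((1/2) ^ k)\<^sup>2"
      by (simp add: ennreal_le_iff)
    then show ?thesis by (rule power2_le_imp_le) simp
  qed
  have "(\<lambda>n. l2_norm M (\<lambda>x. X n x - l x)) \<longlonglongrightarrow> 0"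
  proof (rule LIMSEQ_I)
    fix e :: real assume "e > 0"
    then obtain k where k: "(1/2 :: real) ^ k < e"
      using real_arch_pow_inv[of e "1/2"] by auto
    then have "norm (l2_norm M (\<lambda>x. X n x - l x) - 0) < e" if "n \<ge> N k" for n
      using nb[OF that] by simp
    then show "\<exists>no. \<forall>n\<ge>no. norm (l2_norm M (\<lambda>x. X n x - l x) - 0) < e" by blast
  qed
  with l show ?thesis by blast
qed

section \<open>Smooth functions\<close>

lemma partial_cong_open:
  assumes "open U" "x \<in> U" "\<And>y. y \<in> U \<Longrightarrow> f y = g y"
  shows "partial i f x = partial i g x"
proof -
  have "(f has_derivative D) (at x) \<longleftrightarrow> (g has_derivative D) (at x)" for D
    using assms by (metis has_derivative_transform_within_open)
  then show ?thesis by (simp add: partial_def frechet_derivative_def)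
qed

lemma differentiable_cong_open:
  assumes "open U" "x \<in> U" "\<And>y. y \<in> U \<Longrightarrow> f y = g y"
  shows "f differentiable at x \<longleftrightarrow> g differentiable at x"
  unfolding differentiable_def using assms by (metis has_derivative_transform_within_open)

lemma C_on_cong_open:
  assumes "open U" "\<And>y. y \<in> U \<Longrightarrow> f y = g y"
  shows "C_on k f U \<longleftrightarrow> C_on k g U"
  using assms(2)
proof (induction k arbitrary: f g)
  case 0
  then show ?case by (auto cong: continuous_on_cong)
next
  case (Suc k)
  have "C_on k (partial i f) U \<longleftrightarrow> C_on k (partial i g) U" for i
    using partial_cong_open[OF assms(1)] Suc by (intro Suc.IH) blast
  moreover have "(\<forall>x\<in>U. f differentiable at x) \<longleftrightarrow> (\<forall>x\<in>U. g differentiable at x)"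
    using differentiable_cong_open[OF assms(1)] Suc.prems by blast
  ultimately show ?case by simp
qed

text \<open>Smoothness is local. This glues a function that is smooth near \<open>\<Omega>\<close> and a function that vanishes
  off a compact subset of \<open>\<Omega>\<close>.\<close>

lemma C_on_Un_open:
  assumes "open U" "open V" "C_on k f U" "C_on k f V"
  shows "C_on k f (U \<union> V)"
  using assms(3,4)
  by (induction k arbitrary: f) (use assms(1,2) continuous_on_open_Un in auto)

lemma C_on_zero: "C_on k (\<lambda>x :: real^'n. 0) U"
proof (induction k)
  case (Suc k)
  have "partial i (\<lambda>x :: real^'n. 0) = (\<lambda>x. 0)" for i by (simp add: partial_def fun_eq_iff)
  with Suc show ?case by simp
qed simp

lemma C_on_subset: "C_on k f U \<Longrightarrow> V \<subseteq> U \<Longrightarrow> C_on k f V"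
  by (induction k arbitrary: f) (auto intro: continuous_on_subset)

lemma C_on_imp_continuous: "open U \<Longrightarrow> C_on k f U \<Longrightarrow> continuous_on U f"
  by (cases k) (auto intro!: continuous_at_imp_continuous_on differentiable_imp_continuous_within)

lemma C_on_Suc_imp: "open U \<Longrightarrow> C_on (Suc k) f U \<Longrightarrow> C_on k f U"
proof (induction k arbitrary: f)
  case 0
  then show ?case using C_on_imp_continuous by (metis C_on.simps(1))
next
  case (Suc k)
  then have "C_on k (partial i f) U" for i by (auto intro: Suc.IH)
  with Suc.prems show ?case by simp
qed

lemma partial_mult:
  assumes "f differentiable at x" "g differentiable at x"
  shows "partial i (\<lambda>y. f y * g y) x = f x * partial i g x + partial i f x * g x"
proof -
  have "((\<lambda>y. f y * g y) has_derivative
      (\<lambda>h. f x * frechet_derivative g (at x) h + frechet_derivative f (at x) h * g x)) (at x)"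
    by (intro has_derivative_mult) (use assms frechet_derivative_works in blast)+
  then show ?thesis
    unfolding partial_def by (simp flip: frechet_derivative_at)
qed

lemma partial_add:
  assumes "f differentiable at x" "g differentiable at x"
  shows "partial i (\<lambda>y. f y + g y) x = partial i f x + partial i g x"
proof -
  have "((\<lambda>y. f y + g y) has_derivative
      (\<lambda>h. frechet_derivative f (at x) h + frechet_derivative g (at x) h)) (at x)"
    by (intro has_derivative_add) (use assms frechet_derivative_works in blast)+
  then show ?thesis
    unfolding partial_def by (simp flip: frechet_derivative_at)
qed

lemma C_on_add:
  assumes "open U" "C_on k f U" "C_on k g U"
  shows "C_on k (\<lambda>x. f x + g x) U"
  using assms(2,3)
proof (induction k arbitrary: f g)
  case 0
  then show ?case by (auto intro: continuous_on_add)
next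
  case (Suc k)
  have "C_on k (partial i (\<lambda>x. f x + g x)) U" for i
  proof -
    have "C_on k (\<lambda>x. partial i f x + partial i g x) U"
      using Suc by (intro Suc.IH) auto
    then show ?thesis
      using Suc.prems by (subst C_on_cong_open[OF assms(1)]) (auto simp: partial_add)
  qed
  with Suc.prems show ?case by (auto intro: differentiable_add)
qed

lemma C_on_mult:
  assumes "open U" "C_on k f U" "C_on k g U"
  shows "C_on k (\<lambda>x. f x * g x) U"
  using assms(2,3)
proof (induction k arbitrary: f g)
  case 0
  then show ?case by (auto intro: continuous_on_mult)
next
  case (Suc k)
  have "C_on k (partial i (\<lambda>x. f x * g x)) U" for i
  proof -
    have "C_on k (\<lambda>x. f x * partial i g x + partial i f x * g x) U"
      using Suc.prems C_on_Suc_imp[OF assms(1)]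
      by (intro C_on_add assms(1) Suc.IH) (auto simp del: C_on.simps simp: C_on.simps(2))
    then show ?thesis
      using Suc.prems by (subst C_on_cong_open[OF assms(1)]) (auto simp: partial_mult)
  qed
  with Suc.prems show ?case by (auto intro: differentiable_mult)
qed

lemma test_functionsE:
  assumes "\<psi> \<in> test_functions \<Omega>"
  obtains K where "compact K" "K \<subseteq> \<Omega>" "\<And>x. x \<notin> K \<Longrightarrow> \<psi> x = 0"
  using assms by (auto simp: test_functions_def)

lemma test_function_differentiable: "\<psi> \<in> test_functions \<Omega> \<Longrightarrow> \<psi> differentiable at x"
  unfolding test_functions_def by (auto dest!: spec[of _ "Suc 0"])

lemma test_function_continuous: "\<psi> \<in> test_functions \<Omega> \<Longrightarrow> continuous_on UNIV \<psi>"
  unfolding test_functions_def by (auto dest!: spec[of _ 0])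

lemma partial_test_function:
  assumes "\<psi> \<in> test_functions \<Omega>"
  shows "partial i \<psi> \<in> test_functions \<Omega>"
proof -
  obtain K where K: "compact K" "K \<subseteq> \<Omega>" "\<And>x. x \<notin> K \<Longrightarrow> \<psi> x = 0"
    using assms by (rule test_functionsE) blast
  have "partial i \<psi> x = 0" if "x \<notin> K" for x
    using partial_cong_open[of "- K" x \<psi> "\<lambda>x. 0" i] that K
    by (simp add: compact_imp_closed open_Compl) (simp add: partial_def)
  moreover have "C_on k (partial i \<psi>) UNIV" for k
    using assms by (auto simp: test_functions_def dest!: spec[of _ "Suc k"])
  ultimately show ?thesis using K by (auto simp: test_functions_def)
qed

text \<open>The coefficient is smooth only near the closure of \<open>\<Omega>\<close>. The product is smooth there, and
  vanishes identically on the complement of the support of \<open>\<psi>\<close>; these two open sets cover the whole space.\<close>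

lemma smooth_mult_test_function:
  assumes a: "smooth_on_closure \<Omega> a" and \<psi>: "\<psi> \<in> test_functions \<Omega>"
  shows "(\<lambda>x. a x * \<psi> x) \<in> test_functions \<Omega>"
proof -
  obtain K where K: "compact K" "K \<subseteq> \<Omega>" "\<And>x. x \<notin> K \<Longrightarrow> \<psi> x = 0"
    using \<psi> by (rule test_functionsE) blast
  obtain U where U: "open U" "closure \<Omega> \<subseteq> U" "\<And>k. C_on k a U"
    using a by (auto simp: smooth_on_closure_def)
  have oK: "open (- K)" using K by (simp add: compact_imp_closed open_Compl)
  have "C_on k (\<lambda>x. a x * \<psi> x) UNIV" for k
  proof -
    have "C_on k \<psi> UNIV" using \<psi> by (simp add: test_functions_def)
    then have "C_on k (\<lambda>x. a x * \<psi> x) U"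
      using U by (intro C_on_mult) (auto intro: C_on_subset)
    moreover have "C_on k (\<lambda>x. a x * \<psi> x) (- K)"
      using K by (subst C_on_cong_open[OF oK, of _ "\<lambda>x. 0"]) (auto simp: C_on_zero)
    ultimately have "C_on k (\<lambda>x. a x * \<psi> x) (U \<union> - K)"
      using U oK by (intro C_on_Un_open)
    moreover have "U \<union> - K = UNIV" using K U closure_subset by blast
    ultimately show ?thesis by simp
  qed
  with K show ?thesis by (auto simp: test_functions_def)
qed

lemma smooth_on_closure_differentiable:
  assumes "smooth_on_closure \<Omega> a" "x \<in> \<Omega>"
  shows "a differentiable at x"
  using assms closure_subset unfolding smooth_on_closure_def
  by (force dest: spec[of _ "Suc 0"])

lemma smooth_on_closure_partial:
  "smooth_on_closure \<Omega> a \<Longrightarrow> smooth_on_closure \<Omega> (partial i a)"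
  unfolding smooth_on_closure_def by (metis C_on.simps(2))

lemma smooth_on_closure_bounded:
  assumes a: "smooth_on_closure \<Omega> a" and \<Omega>: "bounded \<Omega>"
  obtains B where "\<And>x. x \<in> \<Omega> \<Longrightarrow> \<bar>a x\<bar> \<le> B"
proof -
  obtain U where U: "open U" "closure \<Omega> \<subseteq> U" "\<And>k. C_on k a U"
    using a by (auto simp: smooth_on_closure_def)
  have "continuous_on (closure \<Omega>) a"
    using C_on_imp_continuous[OF U(1) U(3)] U(2) by (rule continuous_on_subset)
  then have "compact (a ` closure \<Omega>)" using \<Omega> by (intro compact_continuous_image) auto
  then obtain B where "\<And>y. y \<in> a ` closure \<Omega> \<Longrightarrow> norm y \<le> B"
    using bounded_iff compact_imp_bounded by metis
  then show ?thesis using closure_subset by (intro that[of B]) (auto simp: subset_iff)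
qed

lemma smooth_on_closure_measurable:
  assumes a: "smooth_on_closure \<Omega> a" and \<Omega>: "\<Omega> \<in> sets lebesgue"
  shows "a \<in> borel_measurable (lebesgue_on \<Omega>)"
proof -
  obtain U where U: "open U" "closure \<Omega> \<subseteq> U" "\<And>k. C_on k a U"
    using a by (auto simp: smooth_on_closure_def)
  have "continuous_on \<Omega> a"
    using C_on_imp_continuous[OF U(1) U(3)] U(2) closure_subset
    by (meson continuous_on_subset subset_trans)
  then show ?thesis by (intro continuous_imp_measurable_on_sets_lebesgue \<Omega>)
qed

lemma L2_mult_bounded:
  assumes f: "f \<in> L2 M" and a: "a \<in> borel_measurable M" and B: "\<And>x. x \<in> space M \<Longrightarrow> \<bar>a x\<bar> \<le> B"
  shows "(\<lambda>x. a x * f x) \<in> L2 M"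
proof -
  have "integrable M (\<lambda>x. (a x * f x)\<^sup>2)"
  proof (rule Bochner_Integration.integrable_bound)
    show "integrable M (\<lambda>x. B\<^sup>2 * (f x)\<^sup>2)" using L2_integrable_square[OF f] by simp
    show "(\<lambda>x. (a x * f x)\<^sup>2) \<in> borel_measurable M" using a L2_measurable[OF f] by measurable
    show "AE x in M. norm ((a x * f x)\<^sup>2) \<le> norm (B\<^sup>2 * (f x)\<^sup>2)"
    proof (rule AE_I2)
      fix x assume "x \<in> space M"
      then have "\<bar>a x\<bar>\<^sup>2 \<le> B\<^sup>2" using B by (intro power_mono) auto
      then show "norm ((a x * f x)\<^sup>2) \<le> norm (B\<^sup>2 * (f x)\<^sup>2)"
        by (simp add: power_mult_distrib mult_right_mono abs_mult)
    qed
  qed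
  then show ?thesis using a L2_measurable[OF f] by (auto simp: L2_def)
qed

lemma L2_smooth_mult:
  assumes "smooth_on_closure \<Omega> a" "bounded \<Omega>" "\<Omega> \<in> sets lebesgue" "f \<in> L2_on \<Omega>"
  shows "(\<lambda>x. a x * f x) \<in> L2_on \<Omega>"
proof -
  obtain B where "\<And>x. x \<in> \<Omega> \<Longrightarrow> \<bar>a x\<bar> \<le> B"
    using smooth_on_closure_bounded[OF assms(1,2)] by blast
  then show ?thesis
    using assms by (intro L2_mult_bounded[where B=B] smooth_on_closure_measurable) auto
qed

lemma test_function_L2:
  assumes \<psi>: "\<psi> \<in> test_functions \<Omega>" and \<Omega>: "\<Omega> \<in> sets lebesgue"
  shows "\<psi> \<in> L2_on \<Omega>"
proof -
  obtain K where K: "compact K" "K \<subseteq> \<Omega>" "\<And>x. x \<notin> K \<Longrightarrow> \<psi> x = 0"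
    using \<psi> by (rule test_functionsE) blast
  have c: "continuous_on UNIV \<psi>" using \<psi> by (rule test_function_continuous)
  then have "integrable lborel (\<lambda>x. if x \<in> K then (\<psi> x)\<^sup>2 else 0)"
    using K by (intro borel_integrable_compact[unfolded set_integrable_def indicator_scaleR_eq_if])
       (auto intro!: continuous_intros intro: continuous_on_subset)
  also have "(\<lambda>x. if x \<in> K then (\<psi> x)\<^sup>2 else 0) = (\<lambda>x. (\<psi> x)\<^sup>2)" using K by auto
  finally have "integrable lebesgue (\<lambda>x. (\<psi> x)\<^sup>2)"
    using integrable_completion by (metis borel_measurable_integrable)
  then have "integrable (lebesgue_on \<Omega>) (\<lambda>x. (\<psi> x)\<^sup>2)"
    using integrable_mult_indicator[of \<Omega> lebesgue "\<lambda>x. (\<psi> x)\<^sup>2"] \<Omega>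
    by (simp add: integrable_restrict_space)
  moreover have "\<psi> \<in> borel_measurable (lebesgue_on \<Omega>)"
    using c \<Omega> by (auto intro!: continuous_imp_measurable_on_sets_lebesgue intro: continuous_on_subset)
  ultimately show ?thesis by (simp add: L2_def)
qed


section \<open>Coercivity\<close>

lemma is_weak_partialD:
  assumes "is_weak_partial \<Omega> i \<phi> g" "\<psi> \<in> test_functions \<Omega>"
  shows "l2_inner (lebesgue_on \<Omega>) \<phi> (partial i \<psi>) = - l2_inner (lebesgue_on \<Omega>) g \<psi>"
  using assms by (simp add: is_weak_partial_def l2_inner_def)

lemma weak_partial:
  assumes "weakly_differentiable \<Omega> i \<phi>"
  shows "weak_partial \<Omega> i \<phi> \<in> L2_on \<Omega>" "is_weak_partial \<Omega> i \<phi> (weak_partial \<Omega> i \<phi>)"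
proof -
  have "\<exists>g. g \<in> L2_on \<Omega> \<and> is_weak_partial \<Omega> i \<phi> g"
    using assms by (auto simp: weakly_differentiable_def)
  from someI_ex[OF this] show "weak_partial \<Omega> i \<phi> \<in> L2_on \<Omega>"
    "is_weak_partial \<Omega> i \<phi> (weak_partial \<Omega> i \<phi>)"
    by (simp_all add: weak_partial_def)
qed

text \<open>The product rule for weak derivatives: the coefficient is moved onto the test function, where the
  classical product rule applies.\<close>

lemma weakly_differentiable_smooth_mult:
  assumes a: "smooth_on_closure \<Omega> a" and \<Omega>: "bounded \<Omega>" "\<Omega> \<in> sets lebesgue"
    and \<phi>: "\<phi> \<in> L2_on \<Omega>" "weakly_differentiable \<Omega> i \<phi>"
  shows "weakly_differentiable \<Omega> i (\<lambda>x. a x * \<phi> x)"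
proof -
  let ?M = "lebesgue_on \<Omega>"
  obtain g where g: "g \<in> L2_on \<Omega>" "is_weak_partial \<Omega> i \<phi> g"
    using \<phi>(2) by (auto simp: weakly_differentiable_def)
  let ?h = "\<lambda>x. partial i a x * \<phi> x + a x * g x"
  have aL2: "(\<lambda>x. a x * f x) \<in> L2_on \<Omega>" "(\<lambda>x. partial i a x * f x) \<in> L2_on \<Omega>"
    if "f \<in> L2_on \<Omega>" for f
    using that a \<Omega> by (auto intro!: L2_smooth_mult smooth_on_closure_partial)
  have h: "?h \<in> L2_on \<Omega>" using aL2 g \<phi> by simp
  have "is_weak_partial \<Omega> i (\<lambda>x. a x * \<phi> x) ?h"
    unfolding is_weak_partial_def
  proof
    fix \<psi> assume \<psi>: "\<psi> \<in> test_functions \<Omega>"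
    let ?a\<psi> = "\<lambda>x. a x * \<psi> x"
    have a\<psi>: "?a\<psi> \<in> test_functions \<Omega>" by (rule smooth_mult_test_function[OF a \<psi>])
    have L: "\<psi> \<in> L2_on \<Omega>" "partial i ?a\<psi> \<in> L2_on \<Omega>"
      using \<psi> a\<psi> \<Omega> by (auto intro: test_function_L2 partial_test_function)
    have "(\<integral>x. a x * \<phi> x * partial i \<psi> x \<partial>?M)
        = (\<integral>x. \<phi> x * partial i ?a\<psi> x - partial i a x * \<phi> x * \<psi> x \<partial>?M)"
    proof (rule Bochner_Integration.integral_cong)
      fix x assume "x \<in> space ?M"
      then have "a differentiable at x" using a by (intro smooth_on_closure_differentiable) auto
      then have "partial i ?a\<psi> x = a x * partial i \<psi> x + partial i a x * \<psi> x"
        using test_function_differentiable[OF \<psi>] by (rule partial_mult)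
      then show "a x * \<phi> x * partial i \<psi> x
          = \<phi> x * partial i ?a\<psi> x - partial i a x * \<phi> x * \<psi> x"
        by (simp add: algebra_simps)
    qed simp
    also have "\<dots> = l2_inner ?M \<phi> (partial i ?a\<psi>) - l2_inner ?M (\<lambda>x. partial i a x * \<phi> x) \<psi>"
      unfolding l2_inner_def using L \<phi> aL2
      by (intro Bochner_Integration.integral_diff L2_integrable_mult) auto
    also have "\<dots> = - l2_inner ?M g ?a\<psi> - l2_inner ?M (\<lambda>x. partial i a x * \<phi> x) \<psi>"
      using is_weak_partialD[OF g(2) a\<psi>] by simp
    also have "l2_inner ?M g ?a\<psi> = l2_inner ?M (\<lambda>x. a x * g x) \<psi>"
      by (simp add: l2_inner_def mult_ac)
    also have "- l2_inner ?M (\<lambda>x. a x * g x) \<psi> - l2_inner ?M (\<lambda>x. partial i a x * \<phi> x) \<psi>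
        = - l2_inner ?M ?h \<psi>"
      using L \<phi> aL2 g by (simp add: l2_inner_algebra)
    finally show "(\<integral>x. a x * \<phi> x * partial i \<psi> x \<partial>?M) = - (\<integral>x. ?h x * \<psi> x \<partial>?M)"
      by (simp add: l2_inner_def)
  qed
  with h show ?thesis by (auto simp: weakly_differentiable_def)
qed

lemma weakly_differentiable_add:
  assumes \<Omega>: "\<Omega> \<in> sets lebesgue" and "\<phi> \<in> L2_on \<Omega>" "\<theta> \<in> L2_on \<Omega>"
    and "weakly_differentiable \<Omega> i \<phi>" "weakly_differentiable \<Omega> i \<theta>"
  shows "weakly_differentiable \<Omega> i (\<lambda>x. \<phi> x + \<theta> x)"
proof -
  obtain g h where gh: "g \<in> L2_on \<Omega>" "is_weak_partial \<Omega> i \<phi> g"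
    "h \<in> L2_on \<Omega>" "is_weak_partial \<Omega> i \<theta> h"
    using assms by (auto simp: weakly_differentiable_def)
  have "is_weak_partial \<Omega> i (\<lambda>x. \<phi> x + \<theta> x) (\<lambda>x. g x + h x)"
    unfolding is_weak_partial_def l2_inner_def[symmetric]
  proof
    fix \<psi> assume \<psi>: "\<psi> \<in> test_functions \<Omega>"
    have L: "\<psi> \<in> L2_on \<Omega>" "partial i \<psi> \<in> L2_on \<Omega>"
      using \<psi> \<Omega> by (auto intro: test_function_L2 partial_test_function)
    show "l2_inner (lebesgue_on \<Omega>) (\<lambda>x. \<phi> x + \<theta> x) (partial i \<psi>)
        = - l2_inner (lebesgue_on \<Omega>) (\<lambda>x. g x + h x) \<psi>"
      using assms(2,3) gh L \<psi> by (simp add: l2_inner_algebra is_weak_partialD)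
  qed
  with gh show ?thesis by (auto simp: weakly_differentiable_def)
qed

lemma weakly_differentiable_sum:
  assumes \<Omega>: "\<Omega> \<in> sets lebesgue" and "finite J"
    and "\<And>j. j \<in> J \<Longrightarrow> f j \<in> L2_on \<Omega>" "\<And>j. j \<in> J \<Longrightarrow> weakly_differentiable \<Omega> i (f j)"
  shows "weakly_differentiable \<Omega> i (\<lambda>x. \<Sum>j\<in>J. f j x)"
  using assms(2-4)
proof (induction J rule: finite_induct)
  case empty
  have "is_weak_partial \<Omega> i (\<lambda>x. 0) (\<lambda>x. 0)" by (simp add: is_weak_partial_def)
  then show ?case by (auto simp: weakly_differentiable_def intro!: bexI[of _ "\<lambda>x. 0"])
next
  case (insert j J)
  then show ?case by (auto intro!: weakly_differentiable_add[OF \<Omega>])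
qed

lemma H10_approx:
  assumes "\<phi> \<in> H10 \<Omega>"
  obtains \<psi> where "\<And>k. \<psi> k \<in> test_functions \<Omega>"
    "\<And>k. l2_norm (lebesgue_on \<Omega>) (\<lambda>x. \<phi> x - \<psi> k x) < 1 / real (Suc k)"
    "\<And>k i. l2_norm (lebesgue_on \<Omega>) (\<lambda>x. weak_partial \<Omega> i \<phi> x - partial i (\<psi> k) x) < 1 / real (Suc k)"
proof -
  have "\<forall>k. \<exists>\<psi>. \<psi> \<in> test_functions \<Omega> \<and>
     l2_norm (lebesgue_on \<Omega>) (\<lambda>x. \<phi> x - \<psi> x) < 1 / real (Suc k) \<and>
     (\<forall>i. l2_norm (lebesgue_on \<Omega>) (\<lambda>x. weak_partial \<Omega> i \<phi> x - partial i \<psi> x) < 1 / real (Suc k))"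
  proof
    fix k :: nat
    have "1 / real (Suc k) > 0" by simp
    then show "\<exists>\<psi>. \<psi> \<in> test_functions \<Omega> \<and>
     l2_norm (lebesgue_on \<Omega>) (\<lambda>x. \<phi> x - \<psi> x) < 1 / real (Suc k) \<and>
     (\<forall>i. l2_norm (lebesgue_on \<Omega>) (\<lambda>x. weak_partial \<Omega> i \<phi> x - partial i \<psi> x) < 1 / real (Suc k))"
      using assms unfolding H10_def by blast
  qed
  then show ?thesis using that by (elim choice[THEN exE]) blast
qed

lemma l2_norm_tendsto_0_of_inverse_Suc:
  assumes "\<And>k. l2_norm M (\<lambda>x. \<phi> x - \<psi> k x) < 1 / real (Suc k)"
  shows "(\<lambda>k. l2_norm M (\<lambda>x. \<psi> k x - \<phi> x)) \<longlonglongrightarrow> 0"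
proof (rule tendsto_sandwich[OF _ _ tendsto_const LIMSEQ_inverse_real_of_nat])
  show "\<forall>\<^sub>F k in sequentially. l2_norm M (\<lambda>x. \<psi> k x - \<phi> x) \<le> inverse (real (Suc k))"
    using assms by (subst l2_norm_minus_commute) (auto simp: inverse_eq_divide intro!: always_eventually less_imp_le)
qed simp

lemma elliptic_domainD:
  assumes "\<phi> \<in> elliptic_domain \<Omega>"
  shows "\<phi> \<in> L2_on \<Omega>" "\<phi> \<in> H10 \<Omega>" "weakly_differentiable \<Omega> i \<phi>" "weak_partial \<Omega> i \<phi> \<in> L2_on \<Omega>"
    "weakly_differentiable \<Omega> j (weak_partial \<Omega> i \<phi>)"
  using assms by (auto simp: elliptic_domain_def H2_def H1_def)

text \<open>Integration by parts. As a weak derivative is a chosen representative that means something only if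
  one exists, the components of the flux \<open>\<AA> \<nabla> \<phi>\<close> have to be shown weakly differentiable first; this is
  where \<open>H\<^sup>2\<close>-regularity and the smoothness of the coefficients enter. The identity then holds for test
  functions in the second slot, and passes to \<open>\<phi>\<close> because \<open>\<phi>\<close> is a limit of test functions in \<open>H\<^sup>1\<close>.\<close>

lemma elliptic_op_form:
  fixes \<Omega> :: "(real^'n) set"
  assumes \<Omega>: "bounded \<Omega>" "\<Omega> \<in> sets lebesgue" and ad: "admissible_coefficients \<Omega> \<AA> a0"
    and \<phi>: "\<phi> \<in> elliptic_domain \<Omega>"
  shows "l2_inner (lebesgue_on \<Omega>) (elliptic_op \<Omega> \<AA> a0 \<phi>) \<phi>
      = (\<Sum>i\<in>UNIV. l2_inner (lebesgue_on \<Omega>) (\<lambda>y. \<Sum>j\<in>UNIV. \<AA> y $ i $ j * weak_partial \<Omega> j \<phi> y)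
           (weak_partial \<Omega> i \<phi>))
        + l2_inner (lebesgue_on \<Omega>) (\<lambda>x. a0 x * \<phi> x) \<phi>"
proof -
  let ?M = "lebesgue_on \<Omega>"
  note \<phi>D = elliptic_domainD[OF \<phi>]
  have sm: "smooth_on_closure \<Omega> (\<lambda>x. \<AA> x $ i $ j)" "smooth_on_closure \<Omega> a0" for i j
    using ad by (auto simp: admissible_coefficients_def)
  define p where "p i y = (\<Sum>j\<in>UNIV. \<AA> y $ i $ j * weak_partial \<Omega> j \<phi> y)" for i y
  have p: "p i \<in> L2 ?M" for i
    unfolding p_def using \<phi>D sm \<Omega> by (intro L2_sum L2_smooth_mult) auto
  have "weakly_differentiable \<Omega> i (p i)" for i
    unfolding p_def using \<phi>D sm \<Omega>
    by (intro weakly_differentiable_sum weakly_differentiable_smooth_mult L2_smooth_mult) auto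
  note wp = weak_partial[OF this]
  have a0\<phi>: "(\<lambda>x. a0 x * \<phi> x) \<in> L2 ?M" using \<phi>D sm \<Omega> by (intro L2_smooth_mult) auto
  define A\<phi> where "A\<phi> = elliptic_op \<Omega> \<AA> a0 \<phi>"
  have A\<phi>: "A\<phi> = (\<lambda>x. (\<Sum>i\<in>UNIV. - weak_partial \<Omega> i (p i) x) + a0 x * \<phi> x)"
    by (simp add: A\<phi>_def elliptic_op_def p_def sum_negf flip: p_def)
  have sumL2: "(\<lambda>x. \<Sum>i\<in>UNIV. - weak_partial \<Omega> i (p i) x) \<in> L2 ?M"
    using wp by (intro L2_sum) auto
  have A\<phi>L2: "A\<phi> \<in> L2 ?M" unfolding A\<phi> using sumL2 a0\<phi> by simp
  obtain \<psi> where \<psi>: "\<And>k. \<psi> k \<in> test_functions \<Omega>"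
    "\<And>k. l2_norm ?M (\<lambda>x. \<phi> x - \<psi> k x) < 1 / real (Suc k)"
    "\<And>k i. l2_norm ?M (\<lambda>x. weak_partial \<Omega> i \<phi> x - partial i (\<psi> k) x) < 1 / real (Suc k)"
    using H10_approx[OF \<phi>D(2)] by blast
  have \<psi>L2: "\<psi> k \<in> L2 ?M" "partial i (\<psi> k) \<in> L2 ?M" for k i
    using \<psi>(1) \<Omega>(2) by (auto intro: test_function_L2 partial_test_function)
  have weak: "l2_inner ?M A\<phi> (\<psi> k)
      = (\<Sum>i\<in>UNIV. l2_inner ?M (p i) (partial i (\<psi> k))) + l2_inner ?M (\<lambda>x. a0 x * \<phi> x) (\<psi> k)" for k
  proof -
    have "l2_inner ?M (\<lambda>x. \<Sum>i\<in>UNIV. - weak_partial \<Omega> i (p i) x) (\<psi> k)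
        = (\<Sum>i\<in>UNIV. - l2_inner ?M (weak_partial \<Omega> i (p i)) (\<psi> k))"
    proof -
      have "integrable ?M (\<lambda>x. - weak_partial \<Omega> i (p i) x * \<psi> k x)" for i
        by (rule L2_integrable_mult[OF L2_uminus[OF wp(1)] \<psi>L2(1)])
      then show ?thesis
        unfolding l2_inner_def sum_distrib_right
        by (subst Bochner_Integration.integral_sum) simp_all
    qed
    then show ?thesis
      unfolding A\<phi> using sumL2 a0\<phi> \<psi>L2 is_weak_partialD[OF wp(2) \<psi>(1)]
      by (simp add: l2_inner_algebra)
  qed
  have lim1: "(\<lambda>k. l2_inner ?M f (\<psi> k)) \<longlonglongrightarrow> l2_inner ?M f \<phi>" if "f \<in> L2 ?M" for f
    using that \<psi>L2 \<phi>D(1) l2_norm_tendsto_0_of_inverse_Suc[OF \<psi>(2)]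
    by (intro l2_inner_tendsto l2_norm_const_tendsto) auto
  have lim2: "(\<lambda>k. l2_inner ?M f (partial i (\<psi> k))) \<longlonglongrightarrow> l2_inner ?M f (weak_partial \<Omega> i \<phi>)"
    if "f \<in> L2 ?M" for f i
    using that \<psi>L2 \<phi>D(4) l2_norm_tendsto_0_of_inverse_Suc[OF \<psi>(3)]
    by (intro l2_inner_tendsto l2_norm_const_tendsto) auto
  have "(\<lambda>k. l2_inner ?M A\<phi> (\<psi> k)) \<longlonglongrightarrow>
      (\<Sum>i\<in>UNIV. l2_inner ?M (p i) (weak_partial \<Omega> i \<phi>)) + l2_inner ?M (\<lambda>x. a0 x * \<phi> x) \<phi>"
    unfolding weak by (intro tendsto_intros lim1 lim2 p a0\<phi>)
  with lim1[OF A\<phi>L2] have "l2_inner ?M A\<phi> \<phi> =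
      (\<Sum>i\<in>UNIV. l2_inner ?M (p i) (weak_partial \<Omega> i \<phi>)) + l2_inner ?M (\<lambda>x. a0 x * \<phi> x) \<phi>"
    by (rule LIMSEQ_unique)
  then show ?thesis by (simp add: A\<phi>_def p_def[abs_def])
qed

lemma elliptic_op_coercive:
  fixes \<Omega> :: "(real^'n) set"
  assumes \<Omega>: "bounded \<Omega>" "\<Omega> \<in> sets lebesgue" and ad: "admissible_coefficients \<Omega> \<AA> a0"
  obtains c where "c > 0" "\<And>\<phi>. \<phi> \<in> elliptic_domain \<Omega> \<Longrightarrow>
    c * (\<Sum>i\<in>UNIV. (l2_norm (lebesgue_on \<Omega>) (weak_partial \<Omega> i \<phi>))\<^sup>2)
      \<le> l2_inner (lebesgue_on \<Omega>) (elliptic_op \<Omega> \<AA> a0 \<phi>) \<phi>"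
proof -
  let ?M = "lebesgue_on \<Omega>"
  obtain c where c: "c > 0" "\<And>x \<xi>. x \<in> \<Omega> \<Longrightarrow> c * (\<xi> \<bullet> \<xi>) \<le> \<xi> \<bullet> (\<AA> x *v \<xi>)"
    using ad by (auto simp: admissible_coefficients_def)
  have sm: "smooth_on_closure \<Omega> (\<lambda>x. \<AA> x $ i $ j)" "smooth_on_closure \<Omega> a0" for i j
    using ad by (auto simp: admissible_coefficients_def)
  have a0: "\<And>x. x \<in> \<Omega> \<Longrightarrow> 0 \<le> a0 x" using ad by (auto simp: admissible_coefficients_def)
  have "c * (\<Sum>i\<in>UNIV. (l2_norm ?M (weak_partial \<Omega> i \<phi>))\<^sup>2)
      \<le> l2_inner ?M (elliptic_op \<Omega> \<AA> a0 \<phi>) \<phi>" if \<phi>: "\<phi> \<in> elliptic_domain \<Omega>" for \<phi>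
  proof -
    let ?g = "\<lambda>i. weak_partial \<Omega> i \<phi>"
    let ?p = "\<lambda>i y. \<Sum>j\<in>UNIV. \<AA> y $ i $ j * weak_partial \<Omega> j \<phi> y"
    have g: "?g i \<in> L2 ?M" for i using elliptic_domainD[OF \<phi>] by blast
    have p: "?p i \<in> L2 ?M" for i
      using g sm \<Omega> by (intro L2_sum L2_smooth_mult) auto
    have "c * (\<Sum>i\<in>UNIV. (l2_norm ?M (?g i))\<^sup>2) = (\<integral>x. (\<Sum>i\<in>UNIV. c * (?g i x * ?g i x)) \<partial>?M)"
      using g by (subst Bochner_Integration.integral_sum)
        (auto simp: l2_norm_square l2_inner_def sum_distrib_left intro!: L2_integrable_mult)
    also have "\<dots> \<le> (\<integral>x. (\<Sum>i\<in>UNIV. ?p i x * ?g i x) \<partial>?M)"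
    proof (rule integral_mono)
      show "integrable ?M (\<lambda>x. \<Sum>i\<in>UNIV. c * (?g i x * ?g i x))"
        using g by (intro Bochner_Integration.integrable_sum integrable_mult_right L2_integrable_mult)
      show "integrable ?M (\<lambda>x. \<Sum>i\<in>UNIV. ?p i x * ?g i x)"
        using g p by (intro Bochner_Integration.integrable_sum L2_integrable_mult)
      fix x assume "x \<in> space ?M"
      then have "c * ((\<chi> i. ?g i x) \<bullet> (\<chi> i. ?g i x)) \<le> (\<chi> i. ?g i x) \<bullet> (\<AA> x *v (\<chi> i. ?g i x))"
        by (intro c) simp
      then show "(\<Sum>i\<in>UNIV. c * (?g i x * ?g i x)) \<le> (\<Sum>i\<in>UNIV. ?p i x * ?g i x)"
        by (simp add: inner_vec_def matrix_vector_mult_def sum_distrib_left mult.commute)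
    qed
    also have "\<dots> = (\<Sum>i\<in>UNIV. l2_inner ?M (?p i) (?g i))"
      unfolding l2_inner_def using g p
      by (subst Bochner_Integration.integral_sum) (auto intro!: L2_integrable_mult)
    also have "\<dots> \<le> (\<Sum>i\<in>UNIV. l2_inner ?M (?p i) (?g i)) + l2_inner ?M (\<lambda>x. a0 x * \<phi> x) \<phi>"
    proof -
      have "0 \<le> l2_inner ?M (\<lambda>x. a0 x * \<phi> x) \<phi>"
        unfolding l2_inner_def using a0
        by (intro Bochner_Integration.integral_nonneg) (auto simp: mult.assoc)
      then show ?thesis by simp
    qed
    also have "\<dots> = l2_inner ?M (elliptic_op \<Omega> \<AA> a0 \<phi>) \<phi>"
      using elliptic_op_form[OF \<Omega> ad \<phi>] by simp
    finally show ?thesis .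
  qed
  with c(1) show ?thesis by (rule that)
qed

section \<open>Friedrichs' inequality on a grid of cubes\<close>

lemma nn_integral_lborel_translate:
  fixes F :: "'a::euclidean_space \<Rightarrow> ennreal"
  assumes [measurable]: "F \<in> borel_measurable borel"
  shows "(\<integral>\<^sup>+x. F (c + x) \<partial>lborel) = (\<integral>\<^sup>+x. F x \<partial>lborel)"
proof -
  have "(\<integral>\<^sup>+x. F x \<partial>lborel) = (\<integral>\<^sup>+x. F x \<partial>distr lborel borel ((+) c))"
    by (simp add: lborel_distr_plus)
  also have "\<dots> = (\<integral>\<^sup>+x. F (c + x) \<partial>lborel)"
    by (rule nn_integral_distr) measurable
  finally show ?thesis by simp
qed

lemma frechet_derivative_eq_sum_partial:
  fixes f :: "real^'n \<Rightarrow> real"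
  assumes "f differentiable at x"
  shows "frechet_derivative f (at x) h = (\<Sum>i\<in>UNIV. h $ i * partial i f x)"
proof -
  have lin: "linear (frechet_derivative f (at x))"
    using assms by (rule linear_frechet_derivative)
  have "frechet_derivative f (at x) h = frechet_derivative f (at x) (\<Sum>i\<in>UNIV. h $ i *\<^sub>R axis i 1)"
    using basis_expansion[of h] by (simp add: scalar_mult_eq_scaleR)
  also have "\<dots> = (\<Sum>i\<in>UNIV. h $ i * partial i f x)"
    by (simp add: linear_sum[OF lin] linear_cmul[OF lin] partial_def)
  finally show ?thesis .
qed

lemma has_derivative_along_line:
  fixes f :: "real^'n \<Rightarrow> real"
  assumes "\<And>x. f differentiable at x"
  shows "((\<lambda>t. f (x + t *\<^sub>R h)) has_real_derivative
     (\<Sum>i\<in>UNIV. h $ i * partial i f (x + t *\<^sub>R h))) (at t)"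
proof -
  have "((\<lambda>t. x + t *\<^sub>R h) has_derivative (\<lambda>r. r *\<^sub>R h)) (at t)"
    by (auto intro!: derivative_eq_intros)
  moreover have "(f has_derivative frechet_derivative f (at (x + t *\<^sub>R h))) (at (x + t *\<^sub>R h))"
    using assms frechet_derivative_works by blast
  ultimately have "((\<lambda>t. f (x + t *\<^sub>R h)) has_derivative
      (\<lambda>r. frechet_derivative f (at (x + t *\<^sub>R h)) (r *\<^sub>R h))) (at t)"
    by (rule has_derivative_compose)
  then show ?thesis
    unfolding has_field_derivative_def
    by (rule has_derivative_eq_rhs)
       (simp add: assms frechet_derivative_eq_sum_partial sum_distrib_left mult_ac fun_eq_iff)
qed

text \<open>With \<open>d = g 1 - g 0\<close> being the mean of \<open>g'\<close> on \<open>[0,1]\<close>, integrating \<open>(g' - d)\<^sup>2 \<ge> 0\<close> gives the claim.\<close>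

lemma increment_square_le:
  fixes g g' :: "real \<Rightarrow> real"
  assumes g: "\<And>t. (g has_real_derivative g' t) (at t)" and c: "continuous_on UNIV g'"
  shows "ennreal ((g 1 - g 0)\<^sup>2) \<le> (\<integral>\<^sup>+t. ennreal ((g' t)\<^sup>2 * indicator {0..1} t) \<partial>lborel)"
proof -
  define d where "d = g 1 - g 0"
  have cont: "isCont g' t" for t using c by (simp add: continuous_on_eq_continuous_at)
  have int: "integrable lborel (\<lambda>t. (g' t)\<^sup>2 * indicator {0..1} t)"
    by (intro borel_integrable_atLeastAtMost continuous_intros cont)
  have "(\<integral>t. (2 * d * g' t - d\<^sup>2) * indicator {0..1} t \<partial>lborel)
      = (2 * d * g 1 - d\<^sup>2 * 1) - (2 * d * g 0 - d\<^sup>2 * 0)"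
    by (rule integral_FTC_Icc_real[where F="\<lambda>t. 2 * d * g t - d\<^sup>2 * t"])
       (auto intro!: derivative_eq_intros g continuous_intros cont)
  also have "\<dots> = d\<^sup>2" by (simp add: d_def power2_eq_square algebra_simps)
  finally have "d\<^sup>2 = (\<integral>t. (2 * d * g' t - d\<^sup>2) * indicator {0..1} t \<partial>lborel)" by simp
  also have "\<dots> \<le> (\<integral>t. (g' t)\<^sup>2 * indicator {0..1} t \<partial>lborel)"
  proof (rule integral_mono[OF _ int])
    show "integrable lborel (\<lambda>t. (2 * d * g' t - d\<^sup>2) * indicator {0..1} t)"
      by (intro borel_integrable_atLeastAtMost continuous_intros cont)
    fix t
    have "0 \<le> (g' t - d)\<^sup>2" by simp
    then have "2 * d * g' t - d\<^sup>2 \<le> (g' t)\<^sup>2" by (simp add: power2_diff mult_ac)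
    then show "(2 * d * g' t - d\<^sup>2) * indicator {0..1} t \<le> (g' t)\<^sup>2 * indicator {0..1} t"
      by (intro mult_right_mono) auto
  qed
  finally have "ennreal (d\<^sup>2) \<le> ennreal (\<integral>t. (g' t)\<^sup>2 * indicator {0..1} t \<partial>lborel)"
    by (rule ennreal_leI)
  also have "\<dots> = (\<integral>\<^sup>+t. ennreal ((g' t)\<^sup>2 * indicator {0..1} t) \<partial>lborel)"
    using int by (subst nn_integral_eq_integral) auto
  finally show ?thesis by (simp add: d_def)
qed

text \<open>On each line in direction \<open>h\<close> the increment is controlled by the directional derivative along the
  segment; after exchanging the integrals, every point of the segment contributes the same amount
  by translation invariance.\<close>

lemma translation_estimate:
  fixes f :: "real^'n \<Rightarrow> real"
  assumes d: "\<And>x. f differentiable at x" and c: "\<And>i. continuous_on UNIV (partial i f)"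
    and h: "\<And>i. \<bar>h $ i\<bar> \<le> s"
  shows "(\<integral>\<^sup>+x. ennreal ((f (x + h) - f x)\<^sup>2) \<partial>lborel)
    \<le> (\<integral>\<^sup>+x. ennreal (s\<^sup>2 * real CARD('n) * (\<Sum>i\<in>UNIV. (partial i f x)\<^sup>2)) \<partial>lborel)"
proof -
  define D where "D x = (\<Sum>i\<in>UNIV. h $ i * partial i f x)" for x
  have cD: "continuous_on UNIV D" unfolding D_def by (intro continuous_intros c)
  then have [measurable]: "D \<in> borel_measurable borel" by (rule borel_measurable_continuous_onI)
  have D_le: "(D x)\<^sup>2 \<le> s\<^sup>2 * real CARD('n) * (\<Sum>i\<in>UNIV. (partial i f x)\<^sup>2)" for x
  proof -
    have "(D x)\<^sup>2 \<le> (\<Sum>i\<in>UNIV. (h $ i * partial i f x)\<^sup>2) * real CARD('n)"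
      unfolding D_def by (rule sum_squared_le_sum_of_squares)
    also have "\<dots> \<le> (\<Sum>i\<in>UNIV. s\<^sup>2 * (partial i f x)\<^sup>2) * real CARD('n)"
    proof (intro mult_right_mono sum_mono)
      fix i
      have "\<bar>h $ i\<bar>\<^sup>2 \<le> s\<^sup>2" by (intro power_mono h) auto
      then show "(h $ i * partial i f x)\<^sup>2 \<le> s\<^sup>2 * (partial i f x)\<^sup>2"
        by (simp add: power_mult_distrib mult_right_mono)
    qed simp
    finally show ?thesis by (simp add: sum_distrib_left mult_ac)
  qed
  have "(\<integral>\<^sup>+x. ennreal ((f (x + h) - f x)\<^sup>2) \<partial>lborel)
      \<le> (\<integral>\<^sup>+x. (\<integral>\<^sup>+t. ennreal ((D (x + t *\<^sub>R h))\<^sup>2 * indicator {0..1} t) \<partial>lborel) \<partial>lborel)"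
  proof (rule nn_integral_mono)
    fix x
    have "ennreal ((f (x + 1 *\<^sub>R h) - f (x + 0 *\<^sub>R h))\<^sup>2)
        \<le> (\<integral>\<^sup>+t. ennreal ((D (x + t *\<^sub>R h))\<^sup>2 * indicator {0..1} t) \<partial>lborel)"
    proof (rule increment_square_le)
      show "((\<lambda>t. f (x + t *\<^sub>R h)) has_real_derivative D (x + t *\<^sub>R h)) (at t)" for t
        unfolding D_def by (rule has_derivative_along_line[OF d])
      show "continuous_on UNIV (\<lambda>t. D (x + t *\<^sub>R h))"
        by (rule continuous_on_compose2[OF cD]) (auto intro!: continuous_intros)
    qed
    then show "ennreal ((f (x + h) - f x)\<^sup>2)
        \<le> (\<integral>\<^sup>+t. ennreal ((D (x + t *\<^sub>R h))\<^sup>2 * indicator {0..1} t) \<partial>lborel)" by simp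
  qed
  also have "\<dots> = (\<integral>\<^sup>+t. (\<integral>\<^sup>+x. ennreal ((D (x + t *\<^sub>R h))\<^sup>2 * indicator {0..1} t) \<partial>lborel) \<partial>lborel)"
    by (rule lborel_pair.Fubini'[symmetric]) measurable
  also have "\<dots> = (\<integral>\<^sup>+t. (\<integral>\<^sup>+x. ennreal ((D x)\<^sup>2 * indicator {0..1::real} t) \<partial>lborel) \<partial>lborel)"
  proof (rule nn_integral_cong)
    fix t :: real
    show "(\<integral>\<^sup>+x. ennreal ((D (x + t *\<^sub>R h))\<^sup>2 * indicator {0..1} t) \<partial>lborel)
        = (\<integral>\<^sup>+x. ennreal ((D x)\<^sup>2 * indicator {0..1} t) \<partial>lborel)"
      using nn_integral_lborel_translate[of "\<lambda>x. ennreal ((D x)\<^sup>2 * indicator {0..1} t)" "t *\<^sub>R h"]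
      by (simp add: add.commute)
  qed
  also have "\<dots> = (\<integral>\<^sup>+t. (\<integral>\<^sup>+x. ennreal ((D x)\<^sup>2) \<partial>lborel) * indicator {0..1::real} t \<partial>lborel)"
    by (intro nn_integral_cong) (auto simp: indicator_def)
  also have "\<dots> = (\<integral>\<^sup>+x. ennreal ((D x)\<^sup>2) \<partial>lborel)"
    by (simp add: nn_integral_cmult_indicator)
  also have "\<dots> \<le> (\<integral>\<^sup>+x. ennreal (s\<^sup>2 * real CARD('n) * (\<Sum>i\<in>UNIV. (partial i f x)\<^sup>2)) \<partial>lborel)"
    by (intro nn_integral_mono ennreal_leI D_le)
  finally show ?thesis .
qed

text \<open>The half-open cubes of side \<open>s\<close> of a grid, indexed by integer vectors. Defined through the floor they
  partition the space on the nose.\<close>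

definition cell :: "real \<Rightarrow> ('n \<Rightarrow> int) \<Rightarrow> (real^'n) set" where
  "cell s k = {x. \<forall>i. \<lfloor>x $ i / s\<rfloor> = k i}"

lemma cell_borel [measurable]: "cell s k \<in> sets (borel :: (real^'n::finite) measure)"
proof -
  have [measurable]: "(\<lambda>x :: real^'n. x $ i) \<in> borel_measurable borel" for i
    by (intro borel_measurable_continuous_onI continuous_intros)
  have "{x :: real^'n. \<lfloor>x $ i / s\<rfloor> = k i} \<in> sets borel" for i by measurable
  then have "(\<Inter>i\<in>UNIV. {x :: real^'n. \<lfloor>x $ i / s\<rfloor> = k i}) \<in> sets borel"
    by (intro sets.finite_INT) auto
  moreover have "cell s k = (\<Inter>i\<in>UNIV. {x :: real^'n. \<lfloor>x $ i / s\<rfloor> = k i})"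
    by (auto simp: cell_def)
  ultimately show ?thesis by simp
qed

lemma cell_between_boxes:
  fixes k :: "'n::finite \<Rightarrow> int"
  assumes "s > 0"
  shows "box (\<chi> i. real_of_int (k i) * s) (\<chi> i. (real_of_int (k i) + 1) * s) \<subseteq> cell s k"
    "cell s k \<subseteq> cbox (\<chi> i. real_of_int (k i) * s) (\<chi> i. (real_of_int (k i) + 1) * s)"
proof -
  have "\<lfloor>x $ i / s\<rfloor> = k i \<longleftrightarrow>
      real_of_int (k i) * s \<le> x $ i \<and> x $ i < (real_of_int (k i) + 1) * s" for x :: "real^'n" and i
    using assms by (simp add: floor_eq_iff pos_le_divide_eq pos_divide_less_eq)
  then show "box (\<chi> i. real_of_int (k i) * s) (\<chi> i. (real_of_int (k i) + 1) * s) \<subseteq> cell s k"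
    "cell s k \<subseteq> cbox (\<chi> i. real_of_int (k i) * s) (\<chi> i. (real_of_int (k i) + 1) * s)"
    by (auto simp: cell_def mem_box_cart less_imp_le)
qed

lemma measure_cell:
  fixes k :: "'n::finite \<Rightarrow> int"
  assumes s: "s > 0"
  shows "measure lborel (cell s k) = s ^ CARD('n)" "emeasure lborel (cell s k) < \<infinity>"
proof -
  let ?a = "\<chi> i. real_of_int (k i) * s" and ?b = "\<chi> i. (real_of_int (k i) + 1) * s"
  have ne: "cbox ?a ?b \<noteq> {}" using s by (auto simp: interval_ne_empty_cart field_simps)
  have c: "measure lborel (cbox ?a ?b) = s ^ CARD('n)"
    using content_cbox_cart[OF ne] by (simp add: algebra_simps)
  have b: "measure lborel (box ?a ?b) = s ^ CARD('n)"
    using c by (simp add: measure_lborel_box_eq measure_lborel_cbox_eq)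
  have "emeasure lborel (cell s k) \<le> emeasure lborel (cbox ?a ?b)"
    using cell_between_boxes[OF s] by (intro emeasure_mono) auto
  then show fin: "emeasure lborel (cell s k) < \<infinity>"
    using emeasure_lborel_cbox_finite le_less_trans by blast
  have "measure lborel (cell s k) \<le> measure lborel (cbox ?a ?b)"
    using cell_between_boxes[OF s] by (intro measure_mono_fmeasurable) auto
  moreover have "measure lborel (box ?a ?b) \<le> measure lborel (cell s k)"
    using cell_between_boxes[OF s] fin by (intro measure_mono_fmeasurable) (auto simp: fmeasurable_def)
  ultimately show "measure lborel (cell s k) = s ^ CARD('n)" using b c by simp
qed

text \<open>Expanding the square: the variance of \<open>f\<close> over \<open>Q\<close> is half the mean square difference of its values
  at two independent points. Differences of values are what translations estimate.\<close>

lemma variance_as_double_integral: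
  fixes f :: "'a::euclidean_space \<Rightarrow> real"
  assumes Q [measurable]: "Q \<in> sets borel" and fin: "emeasure lborel Q < \<infinity>"
    and f: "integrable lborel f" and f2: "integrable lborel (\<lambda>x. (f x)\<^sup>2)"
  shows "(\<integral>\<^sup>+x. (\<integral>\<^sup>+y. ennreal (indicator Q x * indicator Q y * (f x - f y)\<^sup>2) \<partial>lborel) \<partial>lborel)
    = ennreal (2 * (measure lborel Q * (\<integral>x. indicator Q x * (f x)\<^sup>2 \<partial>lborel)
        - (\<integral>x. indicator Q x * f x \<partial>lborel)\<^sup>2))"
proof -
  let ?i = "indicator Q :: 'a \<Rightarrow> real"
  define V a b where "V = measure lborel Q" and "a = (\<integral>x. ?i x * (f x)\<^sup>2 \<partial>lborel)"
    and "b = (\<integral>x. ?i x * f x \<partial>lborel)"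
  have i1: "integrable lborel ?i" and iV: "(\<integral>x. ?i x \<partial>lborel) = V"
    using fin by (auto simp: V_def integrable_indicator_iff)
  have i2: "integrable lborel (\<lambda>x. ?i x * f x)" "integrable lborel (\<lambda>x. ?i x * (f x)\<^sup>2)"
    using integrable_mult_indicator[of Q lborel f] integrable_mult_indicator[of Q lborel "\<lambda>x. (f x)\<^sup>2"] f f2
    by auto
  have exp: "?i x * ?i y * (f x - f y)\<^sup>2
      = (?i x * (f x)\<^sup>2) * ?i y - (2 * ?i x * f x) * (?i y * f y) + ?i x * (?i y * (f y)\<^sup>2)" for x y
    by (simp add: power2_diff algebra_simps)
  have inty: "integrable lborel (\<lambda>y. ?i x * ?i y * (f x - f y)\<^sup>2)" for x
    unfolding exp using i1 i2 by simp
  have inner: "(\<integral>y. ?i x * ?i y * (f x - f y)\<^sup>2 \<partial>lborel)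
      = (?i x * (f x)\<^sup>2) * V - (2 * b) * (?i x * f x) + ?i x * a" for x
    unfolding exp using i1 i2 by (simp add: V_def flip: a_def b_def)
  have "(\<integral>\<^sup>+x. (\<integral>\<^sup>+y. ennreal (?i x * ?i y * (f x - f y)\<^sup>2) \<partial>lborel) \<partial>lborel)
      = (\<integral>\<^sup>+x. ennreal (\<integral>y. ?i x * ?i y * (f x - f y)\<^sup>2 \<partial>lborel) \<partial>lborel)"
    using inty by (intro nn_integral_cong nn_integral_eq_integral) auto
  also have "\<dots> = ennreal (\<integral>x. (\<integral>y. ?i x * ?i y * (f x - f y)\<^sup>2 \<partial>lborel) \<partial>lborel)"
  proof (rule nn_integral_eq_integral)
    show "integrable lborel (\<lambda>x. \<integral>y. ?i x * ?i y * (f x - f y)\<^sup>2 \<partial>lborel)"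
      unfolding inner using i1 i2 by simp
  qed (auto intro!: Bochner_Integration.integral_nonneg)
  also have "(\<integral>x. (\<integral>y. ?i x * ?i y * (f x - f y)\<^sup>2 \<partial>lborel) \<partial>lborel) = a * V - (2 * b) * b + V * a"
    unfolding inner using i1 i2 by (simp add: V_def flip: a_def b_def)
  also have "a * V - (2 * b) * b + V * a = 2 * (V * a - b\<^sup>2)"
    by (simp add: power2_eq_square algebra_simps)
  finally show ?thesis by (simp add: V_def a_def b_def)
qed

lemma cell_unique: "x \<in> cell s k \<longleftrightarrow> k = (\<lambda>i. \<lfloor>x $ i / s\<rfloor>)"
  by (auto simp: cell_def)

lemma half_le_add: "2 * (p - q) \<le> r \<Longrightarrow> p \<le> r / 2 + q" for p q r :: real
  unfolding right_diff_distrib by linarith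

lemma le_add_divide: "c * x \<le> c * y + z \<Longrightarrow> 0 < c \<Longrightarrow> x \<le> y + z / c" for c x y z :: real
  by (simp add: field_simps)

lemma sum_indicator_cell:
  fixes c :: real
  assumes "finite K" "\<exists>k\<in>K. x \<in> cell s k"
  shows "(\<Sum>k\<in>K. indicator (cell s k) x * c) = c"
proof -
  let ?q = "\<lambda>i. \<lfloor>x $ i / s\<rfloor>"
  have q: "?q \<in> K" using assms(2) by (auto simp: cell_unique)
  have "(\<Sum>k\<in>K. indicator (cell s k) x * c) = (\<Sum>k\<in>K. if k = ?q then c else 0)"
    by (rule sum.cong) (simp_all add: indicator_def cell_unique)
  also have "\<dots> = c" using assms(1) q by simp
  finally show ?thesis .
qed

text \<open>In each cube, the square integral of \<open>f\<close> consists of the square of its mean and of its variance.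
  The latter, as a double integral over pairs of points of the same cube, is bounded by an integral over all pairs
  whose difference \<open>h\<close> has components at most \<open>s\<close>, and for fixed \<open>h\<close> the translation estimate applies.
  The total error is thus of order \<open>s\<^sup>2\<close> times the Dirichlet integral, so for small \<open>s\<close> finitely many
  means determine \<open>f\<close> in \<open>L\<^sup>2\<close> up to a small error.\<close>

lemma friedrichs_inequality:
  fixes f :: "real^'n \<Rightarrow> real"
  assumes s: "s > 0" and d: "\<And>x. f differentiable at x"
    and c: "\<And>i. continuous_on UNIV (partial i f)"
    and f: "integrable lborel f" and f2: "integrable lborel (\<lambda>x. (f x)\<^sup>2)"
    and df: "\<And>i. integrable lborel (\<lambda>x. (partial i f x)\<^sup>2)"
    and K: "finite K" "\<And>x. f x \<noteq> 0 \<Longrightarrow> \<exists>k\<in>K. x \<in> cell s k"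
  shows "(\<integral>x. (f x)\<^sup>2 \<partial>lborel) \<le>
    2 ^ CARD('n) * real CARD('n) * s\<^sup>2 * (\<Sum>i\<in>UNIV. \<integral>x. (partial i f x)\<^sup>2 \<partial>lborel)
    + (\<Sum>k\<in>K. (\<integral>x. indicator (cell s k) x * f x \<partial>lborel)\<^sup>2) / s ^ CARD('n)"
proof -
  let ?n = "CARD('n)"
  let ?i = "\<lambda>k. indicator (cell s k) :: real^'n \<Rightarrow> real"
  define G where "G = (\<Sum>i\<in>UNIV. \<integral>x. (partial i f x)\<^sup>2 \<partial>lborel)"
  define E where "E = s\<^sup>2 * real ?n * G"
  define a where "a k = (\<integral>x. ?i k x * (f x)\<^sup>2 \<partial>lborel)" for k
  define b where "b k = (\<integral>x. ?i k x * f x \<partial>lborel)" for k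
  define B :: "(real^'n) set" where "B = cbox (\<chi> i. - s) (\<chi> i. s)"
  have "continuous_on UNIV f"
    using d by (auto intro!: continuous_at_imp_continuous_on differentiable_imp_continuous_within)
  then have fm [measurable]: "f \<in> borel_measurable borel" by (rule borel_measurable_continuous_onI)
  have Bm [measurable]: "B \<in> sets borel" by (simp add: B_def)
  have G0: "0 \<le> G" by (auto simp: G_def intro!: sum_nonneg)
  then have E0: "0 \<le> E" by (simp add: E_def)
  have EI: "(\<integral>\<^sup>+x. ennreal (s\<^sup>2 * real ?n * (\<Sum>i\<in>UNIV. (partial i f x)\<^sup>2)) \<partial>lborel) = ennreal E"
    using df by (subst nn_integral_eq_integral) (auto simp: E_def G_def sum_nonneg)
  have measB: "emeasure lborel B = ennreal ((2 * s) ^ ?n)"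
  proof -
    have "cbox (\<chi> i :: 'n. - s) (\<chi> i. s) \<noteq> {}" using s by (auto simp: interval_ne_empty_cart)
    from content_cbox_cart[OF this] have "measure lborel B = (2 * s) ^ ?n"
      by (simp add: B_def)
    then show ?thesis
      using emeasure_lborel_cbox_finite by (subst emeasure_eq_ennreal_measure) (auto simp: B_def less_top)
  qed
  have "(\<Sum>k\<in>K. ennreal (2 * (measure lborel (cell s k) * a k - (b k)\<^sup>2)))
      = (\<Sum>k\<in>K. \<integral>\<^sup>+x. (\<integral>\<^sup>+y. ennreal (?i k x * ?i k y * (f x - f y)\<^sup>2) \<partial>lborel) \<partial>lborel)"
    unfolding a_def b_def
    by (intro sum.cong refl variance_as_double_integral[symmetric] measure_cell s f f2) auto
  also have "\<dots> = (\<integral>\<^sup>+x. (\<integral>\<^sup>+y. (\<Sum>k\<in>K. ennreal (?i k x * ?i k y * (f x - f y)\<^sup>2)) \<partial>lborel) \<partial>lborel)"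
  proof -
    have "(\<Sum>k\<in>K. \<integral>\<^sup>+x. (\<integral>\<^sup>+y. ennreal (?i k x * ?i k y * (f x - f y)\<^sup>2) \<partial>lborel) \<partial>lborel)
        = (\<integral>\<^sup>+x. (\<Sum>k\<in>K. \<integral>\<^sup>+y. ennreal (?i k x * ?i k y * (f x - f y)\<^sup>2) \<partial>lborel) \<partial>lborel)"
      by (rule nn_integral_sum[symmetric]) measurable
    also have "\<dots> = (\<integral>\<^sup>+x. (\<integral>\<^sup>+y. (\<Sum>k\<in>K. ennreal (?i k x * ?i k y * (f x - f y)\<^sup>2)) \<partial>lborel) \<partial>lborel)"
      by (intro nn_integral_cong nn_integral_sum[symmetric]) measurable
    finally show ?thesis .
  qed
  \<comment> \<open>Only the cube containing \<open>x\<close> contributes at \<open>(x,y)\<close>, and only if \<open>y - x \<in> B\<close>.\<close>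
  also have "\<dots> \<le> (\<integral>\<^sup>+x. (\<integral>\<^sup>+y. ennreal ((f y - f x)\<^sup>2) * indicator B (y - x) \<partial>lborel) \<partial>lborel)"
  proof (intro nn_integral_mono)
    fix x y :: "real^'n"
    let ?q = "\<lambda>i. \<lfloor>x $ i / s\<rfloor>"
    have "(\<Sum>k\<in>K. ennreal (?i k x * ?i k y * (f x - f y)\<^sup>2))
        \<le> (\<Sum>k\<in>K. if k = ?q then ennreal ((f y - f x)\<^sup>2) * indicator B (y - x) else 0)"
    proof (rule sum_mono)
      fix k
      show "ennreal (?i k x * ?i k y * (f x - f y)\<^sup>2)
          \<le> (if k = ?q then ennreal ((f y - f x)\<^sup>2) * indicator B (y - x) else 0)"
      proof (cases "x \<in> cell s k \<and> y \<in> cell s k")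
        case True
        then have "x \<in> cbox (\<chi> i. real_of_int (k i) * s) (\<chi> i. (real_of_int (k i) + 1) * s)"
          "y \<in> cbox (\<chi> i. real_of_int (k i) * s) (\<chi> i. (real_of_int (k i) + 1) * s)"
          using cell_between_boxes[OF s] by blast+
        then have xy: "real_of_int (k i) * s \<le> x $ i" "x $ i \<le> (real_of_int (k i) + 1) * s"
          "real_of_int (k i) * s \<le> y $ i" "y $ i \<le> (real_of_int (k i) + 1) * s" for i
          by (simp_all add: mem_box_cart)
        have "- s \<le> y $ i - x $ i" "y $ i - x $ i \<le> s" for i
          using xy[of i] by (simp_all add: algebra_simps)
        then have "y - x \<in> B" by (simp add: B_def mem_box_cart)
        moreover have "k = ?q" using True cell_unique by blast
        ultimately show ?thesis using True by (simp add: power2_commute)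
      qed (auto simp: indicator_def)
    qed
    also have "\<dots> \<le> ennreal ((f y - f x)\<^sup>2) * indicator B (y - x)"
      using K(1) by simp
    finally show "(\<Sum>k\<in>K. ennreal (?i k x * ?i k y * (f x - f y)\<^sup>2))
        \<le> ennreal ((f y - f x)\<^sup>2) * indicator B (y - x)" .
  qed
  also have "\<dots> = (\<integral>\<^sup>+x. (\<integral>\<^sup>+h. ennreal ((f (x + h) - f x)\<^sup>2) * indicator B h \<partial>lborel) \<partial>lborel)"
  proof (rule nn_integral_cong)
    fix x :: "real^'n"
    have "(\<lambda>y. indicator B (y - x) :: ennreal) \<in> borel_measurable borel"
      by (rule measurable_compose[where g="indicator B" and N=borel])
         (auto intro: borel_measurable_continuous_onI continuous_intros)
    then have "(\<lambda>y. ennreal ((f y - f x)\<^sup>2) * indicator B (y - x)) \<in> borel_measurable borel"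
      by measurable
    from nn_integral_lborel_translate[OF this, of x]
    show "(\<integral>\<^sup>+y. ennreal ((f y - f x)\<^sup>2) * indicator B (y - x) \<partial>lborel)
        = (\<integral>\<^sup>+h. ennreal ((f (x + h) - f x)\<^sup>2) * indicator B h \<partial>lborel)"
      by simp
  qed
  also have "\<dots> = (\<integral>\<^sup>+h. (\<integral>\<^sup>+x. ennreal ((f (x + h) - f x)\<^sup>2) * indicator B h \<partial>lborel) \<partial>lborel)"
    by (rule lborel_pair.Fubini'[symmetric]) measurable
  also have "\<dots> = (\<integral>\<^sup>+h. (\<integral>\<^sup>+x. ennreal ((f (x + h) - f x)\<^sup>2) \<partial>lborel) * indicator B h \<partial>lborel)"
    by (intro nn_integral_cong nn_integral_multc) measurable
  also have "\<dots> \<le> (\<integral>\<^sup>+h. ennreal E * indicator B h \<partial>lborel)"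
  proof (rule nn_integral_mono)
    fix h :: "real^'n"
    show "(\<integral>\<^sup>+x. ennreal ((f (x + h) - f x)\<^sup>2) \<partial>lborel) * indicator B h \<le> ennreal E * indicator B h"
    proof (cases "h \<in> B")
      case True
      then have "\<bar>h $ i\<bar> \<le> s" for i by (auto simp: B_def mem_box_cart abs_le_iff minus_le_iff)
      from translation_estimate[OF d c this] show ?thesis unfolding EI by (rule mult_right_mono) simp
    qed simp
  qed
  also have "\<dots> = ennreal (E * (2 * s) ^ ?n)"
    using E0 s by (simp add: nn_integral_cmult_indicator measB ennreal_mult)
  finally have le: "(\<Sum>k\<in>K. ennreal (2 * (measure lborel (cell s k) * a k - (b k)\<^sup>2)))
      \<le> ennreal (E * (2 * s) ^ ?n)" .
  have "(\<Sum>k\<in>K. 2 * (s ^ ?n * a k - (b k)\<^sup>2)) \<le> E * (2 * s) ^ ?n"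
  proof -
    have "(\<Sum>k\<in>K. 2 * (s ^ ?n * a k - (b k)\<^sup>2)) \<le> (\<Sum>k\<in>K. max 0 (2 * (s ^ ?n * a k - (b k)\<^sup>2)))"
      by (intro sum_mono) simp
    also have "\<dots> \<le> E * (2 * s) ^ ?n"
    proof -
      have "ennreal (\<Sum>k\<in>K. max 0 (2 * (s ^ ?n * a k - (b k)\<^sup>2)))
          = (\<Sum>k\<in>K. ennreal (max 0 (2 * (s ^ ?n * a k - (b k)\<^sup>2))))"
        by (subst sum_ennreal) auto
      also have "\<dots> = (\<Sum>k\<in>K. ennreal (2 * (measure lborel (cell s k) * a k - (b k)\<^sup>2)))"
        using s by (intro sum.cong refl) (auto simp: measure_cell max_def ennreal_neg)
      also note le
      finally show ?thesis using E0 s by (subst (asm) ennreal_le_iff) simp_all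
    qed
    finally show ?thesis .
  qed
  moreover have "(\<Sum>k\<in>K. 2 * (s ^ ?n * a k - (b k)\<^sup>2))
      = 2 * (s ^ ?n * (\<Sum>k\<in>K. a k) - (\<Sum>k\<in>K. (b k)\<^sup>2))"
    by (simp only: sum_subtractf sum_distrib_left right_diff_distrib)
  ultimately have "2 * (s ^ ?n * (\<Sum>k\<in>K. a k) - (\<Sum>k\<in>K. (b k)\<^sup>2)) \<le> E * (2 * s) ^ ?n"
    by (simp only:)
  then have "s ^ ?n * (\<Sum>k\<in>K. a k) \<le> E * (2 * s) ^ ?n / 2 + (\<Sum>k\<in>K. (b k)\<^sup>2)"
    by (rule half_le_add)
  also have "(\<Sum>k\<in>K. a k) = (\<integral>x. (f x)\<^sup>2 \<partial>lborel)"
  proof -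
    have "integrable lborel (\<lambda>x. ?i k x * (f x)\<^sup>2)" for k
      using integrable_mult_indicator[OF _ f2, of "cell s k"] by simp
    then have "(\<Sum>k\<in>K. a k) = (\<integral>x. (\<Sum>k\<in>K. ?i k x * (f x)\<^sup>2) \<partial>lborel)"
      unfolding a_def by (rule Bochner_Integration.integral_sum[symmetric])
    also have "\<dots> = (\<integral>x. (f x)\<^sup>2 \<partial>lborel)"
    proof (intro Bochner_Integration.integral_cong refl)
      fix x
      show "(\<Sum>k\<in>K. ?i k x * (f x)\<^sup>2) = (f x)\<^sup>2"
      proof (cases "f x = 0")
        case False
        from K(2)[OF this] show ?thesis by (rule sum_indicator_cell[OF K(1)])
      qed simp
    qed
    finally show ?thesis .
  qed
  finally have "s ^ ?n * (\<integral>x. (f x)\<^sup>2 \<partial>lborel) \<le> E * (2 * s) ^ ?n / 2 + (\<Sum>k\<in>K. (b k)\<^sup>2)" .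
  also have "E * (2 * s) ^ ?n / 2 = s ^ ?n * (E * 2 ^ ?n / 2)"
    by (simp only: power_mult_distrib mult_ac times_divide_eq_right)
  finally have "(\<integral>x. (f x)\<^sup>2 \<partial>lborel) \<le> E * 2 ^ ?n / 2 + (\<Sum>k\<in>K. (b k)\<^sup>2) / s ^ ?n"
    using zero_less_power[OF s, of ?n] by (rule le_add_divide)
  also have "E * 2 ^ ?n / 2 \<le> 2 ^ ?n * real ?n * s\<^sup>2 * G"
    using G0 by (simp add: E_def mult_ac)
  finally show ?thesis by (simp add: G_def b_def)
qed

section \<open>Rellich compactness\<close>

lemma continuous_bounded_support_integrable:
  fixes f :: "'a::euclidean_space \<Rightarrow> real"
  assumes "continuous_on UNIV f" "bounded \<Omega>" "\<And>x. x \<notin> \<Omega> \<Longrightarrow> f x = 0"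
  shows "integrable lborel f"
proof -
  have "integrable lborel (\<lambda>x. indicator (closure \<Omega>) x *\<^sub>R f x)"
    using assms(1,2) by (intro borel_integrable_compact) (auto intro: continuous_on_subset)
  moreover have "indicator (closure \<Omega>) x *\<^sub>R f x = f x" for x
    using assms(3)[of x] closure_subset by (auto simp: indicator_def)
  ultimately show ?thesis by (simp only:)
qed

lemma l2_norm_square_eq_lborel:
  fixes f :: "real^'n \<Rightarrow> real"
  assumes "continuous_on UNIV f" "\<Omega> \<in> sets lebesgue" "\<And>x. x \<notin> \<Omega> \<Longrightarrow> f x = 0"
  shows "(\<integral>x. (f x)\<^sup>2 \<partial>lborel) = (l2_norm (lebesgue_on \<Omega>) f)\<^sup>2"
proof -
  have "(\<integral>x. f x * f x \<partial>lebesgue_on \<Omega>) = (\<integral>x. indicator \<Omega> x *\<^sub>R (f x * f x) \<partial>lebesgue)"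
    using assms(2) by (simp add: integral_restrict_space)
  also have "(\<lambda>x. indicator \<Omega> x *\<^sub>R (f x * f x)) = (\<lambda>x. (f x)\<^sup>2)"
    using assms(3) by (auto simp: indicator_def power2_eq_square fun_eq_iff)
  also have "(\<integral>x. (f x)\<^sup>2 \<partial>lebesgue) = (\<integral>x. (f x)\<^sup>2 \<partial>lborel)"
    using assms(1)
    by (intro integral_completion borel_measurable_power) (simp add: borel_measurable_continuous_onI)
  finally show ?thesis by (simp add: l2_norm_square l2_inner_def)
qed

text \<open>Tychonoff's theorem.\<close>

lemma compact_bounded_functions:
  fixes R :: real
  shows "compact {f :: 'a::countable \<Rightarrow> real. \<forall>p. f p \<in> {-R..R}}"
proof -
  have "compactin (product_topology (\<lambda>_. euclidean) UNIV) (PiE UNIV (\<lambda>p::'a. {-R..R}))"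
    by (subst compactin_PiE) auto
  then show ?thesis
    by (simp add: euclidean_product_topology PiE_def Pi_def)
qed

text \<open>On a countable index set the product topology is metrizable, so that compactness is sequential
  compactness.\<close>

lemma bounded_functions_pointwise_subsequence:
  fixes X :: "nat \<Rightarrow> 'a::countable \<Rightarrow> real"
  assumes "\<And>n p. \<bar>X n p\<bar> \<le> R"
  obtains L r where "strict_mono r" "\<And>p. (\<lambda>n. X (r n) p) \<longlonglongrightarrow> L p"
proof -
  have "\<forall>n. X n \<in> {f. \<forall>p. f p \<in> {-R..R}}"
  proof (intro allI CollectI)
    fix n p show "X n p \<in> {-R..R}" using assms[of n p] unfolding atLeastAtMost_iff by linarith
  qed
  with compact_imp_seq_compact[OF compact_bounded_functions]
  obtain L r where r: "strict_mono r" and lim: "(X \<circ> r) \<longlonglongrightarrow> L"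
    by (rule seq_compactE)
  have "(\<lambda>m. X (r m) p) \<longlonglongrightarrow> L p" for p
  proof -
    have "continuous_on UNIV (\<lambda>f :: 'a \<Rightarrow> real. f p)"
      by (rule continuous_on_product_then_coordinatewise[OF continuous_on_id])
    from continuous_on_tendsto_compose[OF this lim] show ?thesis by simp
  qed
  with r show ?thesis by (rule that)
qed

lemma partial_diff:
  assumes "f differentiable at x" "g differentiable at x"
  shows "partial i (\<lambda>y. f y - g y) x = partial i f x - partial i g x"
proof -
  have "((\<lambda>y. f y - g y) has_derivative
      (\<lambda>h. frechet_derivative f (at x) h - frechet_derivative g (at x) h)) (at x)"
    by (intro has_derivative_diff) (use assms frechet_derivative_works in blast)+
  then show ?thesis
    unfolding partial_def by (simp flip: frechet_derivative_at)
qed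

lemma test_function_zero_outside: "\<psi> \<in> test_functions \<Omega> \<Longrightarrow> x \<notin> \<Omega> \<Longrightarrow> \<psi> x = 0"
  by (auto simp: test_functions_def)

lemma friedrichs_inequality_diff:
  fixes \<Omega> :: "(real^'n) set"
  assumes \<Omega>: "bounded \<Omega>" "\<Omega> \<in> sets lebesgue" and s: "s > 0"
    and \<psi>: "\<psi> \<in> test_functions \<Omega>" "\<theta> \<in> test_functions \<Omega>"
    and K: "finite K" "\<And>x. x \<in> \<Omega> \<Longrightarrow> \<exists>k\<in>K. x \<in> cell s k"
  shows "(l2_norm (lebesgue_on \<Omega>) (\<lambda>x. \<psi> x - \<theta> x))\<^sup>2 \<le>
    2 ^ CARD('n) * real CARD('n) * s\<^sup>2 *
      (\<Sum>i\<in>UNIV. (l2_norm (lebesgue_on \<Omega>) (\<lambda>x. partial i \<psi> x - partial i \<theta> x))\<^sup>2)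
    + (\<Sum>k\<in>K. ((\<integral>x. indicator (cell s k) x * \<psi> x \<partial>lborel)
           - (\<integral>x. indicator (cell s k) x * \<theta> x \<partial>lborel))\<^sup>2) / s ^ CARD('n)"
proof -
  let ?f = "\<lambda>x. \<psi> x - \<theta> x"
  have d: "\<psi> differentiable at x" "\<theta> differentiable at x" for x
    using \<psi> test_function_differentiable by blast+
  have p: "partial i ?f = (\<lambda>x. partial i \<psi> x - partial i \<theta> x)" for i
    using partial_diff[OF d] by blast
  have c: "continuous_on UNIV \<psi>" "continuous_on UNIV \<theta>" "continuous_on UNIV (partial i \<psi>)"
    "continuous_on UNIV (partial i \<theta>)" for i
    using \<psi> by (auto intro: test_function_continuous partial_test_function)
  have z: "\<psi> x = 0" "\<theta> x = 0" "partial i \<psi> x = 0" "partial i \<theta> x = 0" if "x \<notin> \<Omega>" for x i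
    using \<psi> that by (auto intro: test_function_zero_outside partial_test_function)
  have int: "integrable lborel \<psi>" "integrable lborel \<theta>" "integrable lborel (\<lambda>x. (?f x)\<^sup>2)"
     "integrable lborel (\<lambda>x. (partial i \<psi> x - partial i \<theta> x)\<^sup>2)" for i
    using c z by (auto intro!: continuous_bounded_support_integrable[OF _ \<Omega>(1)] continuous_intros)
  have indint: "integrable lborel (\<lambda>x. indicator (cell s k) x * \<psi> x)"
    "integrable lborel (\<lambda>x. indicator (cell s k) x * \<theta> x)" for k
    using integrable_mult_indicator[OF _ int(1), of "cell s k"]
      integrable_mult_indicator[OF _ int(2), of "cell s k"] by auto
  have "(\<integral>x. (?f x)\<^sup>2 \<partial>lborel) \<le>
      2 ^ CARD('n) * real CARD('n) * s\<^sup>2 * (\<Sum>i\<in>UNIV. \<integral>x. (partial i ?f x)\<^sup>2 \<partial>lborel)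
      + (\<Sum>k\<in>K. (\<integral>x. indicator (cell s k) x * ?f x \<partial>lborel)\<^sup>2) / s ^ CARD('n)"
  proof (rule friedrichs_inequality[OF s])
    show "?f differentiable at x" for x by (intro differentiable_diff d)
    show "continuous_on UNIV (partial i ?f)" for i unfolding p by (intro continuous_intros c)
    show "integrable lborel (\<lambda>x. (partial i ?f x)\<^sup>2)" for i unfolding p by (rule int)
    show "\<exists>k\<in>K. x \<in> cell s k" if "?f x \<noteq> 0" for x
    proof (rule K(2), rule ccontr)
      assume "x \<notin> \<Omega>"
      with that z show False by simp
    qed
  qed (use int K in auto)
  moreover have "(\<integral>x. (?f x)\<^sup>2 \<partial>lborel) = (l2_norm (lebesgue_on \<Omega>) ?f)\<^sup>2"
    using c z by (intro l2_norm_square_eq_lborel \<Omega>) (auto intro!: continuous_intros)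
  moreover have "(\<integral>x. (partial i ?f x)\<^sup>2 \<partial>lborel)
      = (l2_norm (lebesgue_on \<Omega>) (\<lambda>x. partial i \<psi> x - partial i \<theta> x))\<^sup>2" for i
    unfolding p using c z by (intro l2_norm_square_eq_lborel \<Omega>) (auto intro!: continuous_intros)
  moreover have "(\<integral>x. indicator (cell s k) x * ?f x \<partial>lborel)
      = (\<integral>x. indicator (cell s k) x * \<psi> x \<partial>lborel) - (\<integral>x. indicator (cell s k) x * \<theta> x \<partial>lborel)" for k
    using indint by (simp add: right_diff_distrib)
  ultimately show ?thesis by simp
qed

lemma finitely_many_cells_cover:
  fixes \<Omega> :: "(real^'n) set"
  assumes \<Omega>: "bounded \<Omega>" and s: "s > 0"
  obtains K :: "('n \<Rightarrow> int) set" where "finite K" "\<And>x. x \<in> \<Omega> \<Longrightarrow> \<exists>k\<in>K. x \<in> cell s k"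
proof -
  obtain R where R: "\<And>x. x \<in> \<Omega> \<Longrightarrow> norm x \<le> R" using \<Omega> by (auto simp: bounded_iff)
  define K :: "('n \<Rightarrow> int) set" where "K = PiE UNIV (\<lambda>_. {\<lfloor>- R / s\<rfloor>..\<lfloor>R / s\<rfloor>})"
  have "finite K" unfolding K_def by (intro finite_PiE) auto
  moreover have "\<exists>k\<in>K. x \<in> cell s k" if "x \<in> \<Omega>" for x
  proof
    show "x \<in> cell s (\<lambda>i. \<lfloor>x $ i / s\<rfloor>)" by (simp add: cell_unique)
    have "\<bar>x $ i\<bar> \<le> R" for i using R[OF that] component_le_norm_cart[of x i] by simp
    then have "- R \<le> x $ i" "x $ i \<le> R" for i
      by (simp_all add: abs_le_iff minus_le_iff)
    then have "\<lfloor>- R / s\<rfloor> \<le> \<lfloor>x $ i / s\<rfloor>" "\<lfloor>x $ i / s\<rfloor> \<le> \<lfloor>R / s\<rfloor>" for i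
      using s by (simp_all only: floor_mono divide_right_mono less_imp_le)
    then show "(\<lambda>i. \<lfloor>x $ i / s\<rfloor>) \<in> K" by (simp add: K_def PiE_def Pi_def)
  qed
  ultimately show ?thesis by (rule that)
qed

text \<open>A bound uniform in the cube and in the mesh size, so that all these integrals lie in one compact
  product of intervals.\<close>

lemma cell_integral_bounded:
  fixes \<Omega> :: "(real^'n) set"
  assumes \<Omega>: "bounded \<Omega>" "\<Omega> \<in> sets lebesgue" and s: "0 < s" "s \<le> 1"
    and \<psi>: "\<psi> \<in> test_functions \<Omega>" and B: "l2_norm (lebesgue_on \<Omega>) \<psi> \<le> B"
  shows "\<bar>\<integral>x. indicator (cell s k) x * \<psi> x \<partial>lborel\<bar> \<le> 1 + B\<^sup>2"
proof -
  let ?i = "indicator (cell s k) :: real^'n \<Rightarrow> real"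
  have c: "continuous_on UNIV \<psi>" using \<psi> by (rule test_function_continuous)
  have z: "\<psi> x = 0" if "x \<notin> \<Omega>" for x using \<psi> that by (rule test_function_zero_outside)
  have int: "integrable lborel \<psi>" "integrable lborel (\<lambda>x. (\<psi> x)\<^sup>2)"
    using c z by (auto intro!: continuous_bounded_support_integrable[OF _ \<Omega>(1)] continuous_intros)
  have i1: "integrable lborel ?i" using measure_cell(2)[OF s(1), of k] by (simp add: integrable_indicator_iff)
  have "\<bar>\<integral>x. ?i x * \<psi> x \<partial>lborel\<bar> \<le> (\<integral>x. \<bar>?i x * \<psi> x\<bar> \<partial>lborel)"
    by (rule integral_abs_bound)
  also have "\<dots> \<le> (\<integral>x. ?i x + (\<psi> x)\<^sup>2 \<partial>lborel)"
  proof (rule integral_mono)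
    show "integrable lborel (\<lambda>x. \<bar>?i x * \<psi> x\<bar>)"
      using integrable_mult_indicator[OF _ int(1), of "cell s k"] by (intro integrable_abs) auto
    show "integrable lborel (\<lambda>x. ?i x + (\<psi> x)\<^sup>2)" using i1 int by simp
    fix x
    have "0 \<le> (1 - \<bar>\<psi> x\<bar>)\<^sup>2" by simp
    then have "2 * \<bar>\<psi> x\<bar> \<le> 1 + (\<psi> x)\<^sup>2" by (simp add: power2_diff)
    then have "\<bar>\<psi> x\<bar> \<le> 1 + (\<psi> x)\<^sup>2" using abs_ge_zero[of "\<psi> x"] by linarith
    then show "\<bar>?i x * \<psi> x\<bar> \<le> ?i x + (\<psi> x)\<^sup>2" by (auto simp: indicator_def)
  qed
  also have "\<dots> = s ^ CARD('n) + (l2_norm (lebesgue_on \<Omega>) \<psi>)\<^sup>2"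
    using i1 int measure_cell(1)[OF s(1), of k] l2_norm_square_eq_lborel[OF c \<Omega>(2) z] by simp
  also have "\<dots> \<le> 1 + B\<^sup>2"
    using s B by (intro add_mono power_le_one power_mono) auto
  finally show ?thesis .
qed

text \<open>Rellich's theorem. Along a subsequence the integrals over all cubes of all grids of mesh \<open>1/(N+1)\<close>
  converge simultaneously. For a given accuracy, Friedrichs' inequality on one sufficiently fine
  grid bounds the difference of two members of the sequence by the bounded gradients with a small
  factor and by finitely many convergent quantities.\<close>

lemma test_functions_rellich:
  fixes \<Omega> :: "(real^'n) set" and \<psi> :: "nat \<Rightarrow> real^'n \<Rightarrow> real"
  assumes \<Omega>: "bounded \<Omega>" "\<Omega> \<in> sets lebesgue" and \<psi>: "\<And>n. \<psi> n \<in> test_functions \<Omega>"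
    and B: "\<And>n. l2_norm (lebesgue_on \<Omega>) (\<psi> n) \<le> B"
    and B': "\<And>n i. l2_norm (lebesgue_on \<Omega>) (partial i (\<psi> n)) \<le> B"
  shows "\<exists>r :: nat \<Rightarrow> nat. strict_mono r \<and> (\<forall>e>0. \<exists>N. \<forall>m\<ge>N. \<forall>n\<ge>N.
      l2_norm (lebesgue_on \<Omega>) (\<lambda>x. \<psi> (r m) x - \<psi> (r n) x) < e)"
proof -
  let ?M = "lebesgue_on \<Omega>"
  let ?d = "CARD('n)"
  define X where "X n = (\<lambda>(N, k). \<integral>x. indicator (cell (1 / real (Suc N)) k) x * \<psi> n x \<partial>lborel)"
    for n :: nat
  have X_le: "\<bar>X n p\<bar> \<le> 1 + B\<^sup>2" for n and p :: "nat \<times> ('n \<Rightarrow> int)"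
    unfolding X_def by (cases p) (simp add: cell_integral_bounded[OF \<Omega> _ _ \<psi> B])
  obtain L r where r: "strict_mono r" and XL: "\<And>p. (\<lambda>m. X (r m) p) \<longlonglongrightarrow> L p"
    using bounded_functions_pointwise_subsequence[of X, OF X_le] by blast
  have "\<exists>N0. \<forall>m\<ge>N0. \<forall>n\<ge>N0. l2_norm ?M (\<lambda>x. \<psi> (r m) x - \<psi> (r n) x) < e" if e: "e > 0" for e
  proof -
    \<comment> \<open>The gradient term of Friedrichs' inequality on the grid of mesh \<open>s\<close> is at most \<open>c s\<^sup>2\<close>.\<close>
    define c where "c = 2 ^ ?d * real ?d * (real ?d * (2 * B)\<^sup>2)"
    have "(\<lambda>N. c * (1 / real (Suc N))\<^sup>2) \<longlonglongrightarrow> c * 0\<^sup>2"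
      by (intro tendsto_intros LIMSEQ_Suc[OF lim_1_over_n])
    then have "\<forall>\<^sub>F N in sequentially. c * (1 / real (Suc N))\<^sup>2 < e\<^sup>2 / 2"
      using e by (intro order_tendstoD(2)) auto
    then obtain N where N: "c * (1 / real (Suc N))\<^sup>2 < e\<^sup>2 / 2"
      by (auto simp: eventually_sequentially)
    define s where "s = 1 / real (Suc N)"
    have s: "s > 0" by (simp add: s_def)
    obtain K :: "('n \<Rightarrow> int) set" where K: "finite K" "\<And>x. x \<in> \<Omega> \<Longrightarrow> \<exists>k\<in>K. x \<in> cell s k"
      using finitely_many_cells_cover[OF \<Omega>(1) s] by blast
    define V where "V m = (\<Sum>k\<in>K. (X (r m) (N, k) - L (N, k))\<^sup>2)" for m
    have "V \<longlonglongrightarrow> (\<Sum>k\<in>K. (L (N, k) - L (N, k))\<^sup>2)"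
      unfolding V_def by (intro tendsto_intros XL)
    then have "\<forall>\<^sub>F m in sequentially. V m < e\<^sup>2 * s ^ ?d / 8"
      using e s by (intro order_tendstoD(2)) auto
    then obtain N0 where N0: "\<And>m. m \<ge> N0 \<Longrightarrow> V m < e\<^sup>2 * s ^ ?d / 8"
      by (auto simp: eventually_sequentially)
    have "l2_norm ?M (\<lambda>x. \<psi> (r m) x - \<psi> (r n) x) < e" if mn: "m \<ge> N0" "n \<ge> N0" for m n
    proof -
      have L: "\<psi> n \<in> L2 ?M" "partial i (\<psi> n) \<in> L2 ?M" for n i
        using \<psi> \<Omega>(2) by (auto intro: test_function_L2 partial_test_function)
      have grad: "(l2_norm ?M (\<lambda>x. partial i (\<psi> (r m)) x - partial i (\<psi> (r n)) x))\<^sup>2 \<le> (2 * B)\<^sup>2" for i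
      proof (rule power_mono)
        have "l2_norm ?M (\<lambda>x. partial i (\<psi> (r m)) x + (-1) * partial i (\<psi> (r n)) x)
            \<le> l2_norm ?M (partial i (\<psi> (r m))) + l2_norm ?M (\<lambda>x. (-1) * partial i (\<psi> (r n)) x)"
          using L by (intro l2_norm_triangle L2_cmult) auto
        then show "l2_norm ?M (\<lambda>x. partial i (\<psi> (r m)) x - partial i (\<psi> (r n)) x) \<le> 2 * B"
          using B'[of i "r m"] B'[of i "r n"] unfolding l2_norm_cmult by simp
      qed simp
      have "(\<Sum>k\<in>K. (X (r m) (N, k) - X (r n) (N, k))\<^sup>2) \<le> 2 * V m + 2 * V n"
        unfolding V_def sum_distrib_left sum.distrib[symmetric]
      proof (rule sum_mono)
        fix k
        have "0 \<le> (X (r m) (N, k) - L (N, k) + (X (r n) (N, k) - L (N, k)))\<^sup>2" by simp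
        then show "(X (r m) (N, k) - X (r n) (N, k))\<^sup>2
          \<le> 2 * (X (r m) (N, k) - L (N, k))\<^sup>2 + 2 * (X (r n) (N, k) - L (N, k))\<^sup>2"
          by (simp add: power2_eq_square algebra_simps)
      qed
      also have "\<dots> < e\<^sup>2 / 2 * s ^ ?d" using N0[OF mn(1)] N0[OF mn(2)] by simp
      finally have cells: "(\<Sum>k\<in>K. (X (r m) (N, k) - X (r n) (N, k))\<^sup>2) / s ^ ?d < e\<^sup>2 / 2"
        using s by (simp add: pos_divide_less_eq)
      have "(l2_norm ?M (\<lambda>x. \<psi> (r m) x - \<psi> (r n) x))\<^sup>2 \<le>
        2 ^ ?d * real ?d * s\<^sup>2 *
          (\<Sum>i\<in>UNIV. (l2_norm ?M (\<lambda>x. partial i (\<psi> (r m)) x - partial i (\<psi> (r n)) x))\<^sup>2)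
        + (\<Sum>k\<in>K. (X (r m) (N, k) - X (r n) (N, k))\<^sup>2) / s ^ ?d"
        using friedrichs_inequality_diff[OF \<Omega> s \<psi> \<psi> K, of "r m" "r n"]
        by (simp add: X_def s_def)
      also have "2 ^ ?d * real ?d * s\<^sup>2 *
          (\<Sum>i\<in>UNIV. (l2_norm ?M (\<lambda>x. partial i (\<psi> (r m)) x - partial i (\<psi> (r n)) x))\<^sup>2)
        \<le> 2 ^ ?d * real ?d * s\<^sup>2 * (\<Sum>i\<in>(UNIV :: 'n set). (2 * B)\<^sup>2)"
        by (intro mult_left_mono sum_mono grad) auto
      also have "\<dots> = c * s\<^sup>2" by (simp add: c_def)
      finally have "(l2_norm ?M (\<lambda>x. \<psi> (r m) x - \<psi> (r n) x))\<^sup>2 < e\<^sup>2"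
        using N cells unfolding s_def[symmetric] by linarith
      then show ?thesis by (rule power2_less_imp_less) (use e in simp)
    qed
    then show ?thesis by blast
  qed
  with r show ?thesis by blast
qed

section \<open>The Rayleigh quotient\<close>

lemma L2_operatorD:
  assumes "L2_operator M D T"
  shows "\<phi> \<in> D \<Longrightarrow> \<phi> \<in> L2 M" "\<phi> \<in> D \<Longrightarrow> T \<phi> \<in> L2 M"
    "\<phi> \<in> D \<Longrightarrow> \<psi> \<in> D \<Longrightarrow> (\<lambda>x. a * \<phi> x + b * \<psi> x) \<in> D"
    "\<phi> \<in> D \<Longrightarrow> \<psi> \<in> D \<Longrightarrow> AE x in M. T (\<lambda>x. a * \<phi> x + b * \<psi> x) x = a * T \<phi> x + b * T \<psi> x"
    "\<phi> \<in> D \<Longrightarrow> \<psi> \<in> L2 M \<Longrightarrow> (AE x in M. \<phi> x = \<psi> x) \<Longrightarrow> \<psi> \<in> D"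
    "\<phi> \<in> D \<Longrightarrow> \<psi> \<in> L2 M \<Longrightarrow> (AE x in M. \<phi> x = \<psi> x) \<Longrightarrow> AE x in M. T \<phi> x = T \<psi> x"
  using assms by (auto simp: L2_operator_def)

lemma L2_operator_inner_lincomb:
  assumes T: "L2_operator M D T" and D: "\<phi> \<in> D" "\<psi> \<in> D" and h: "h \<in> L2 M"
  shows "l2_inner M (T (\<lambda>x. a * \<phi> x + b * \<psi> x)) h
    = a * l2_inner M (T \<phi>) h + b * l2_inner M (T \<psi>) h"
proof -
  have L: "T \<phi> \<in> L2 M" "T \<psi> \<in> L2 M" using L2_operatorD(2)[OF T] D by blast+
  have "l2_inner M (T (\<lambda>x. a * \<phi> x + b * \<psi> x)) h
      = l2_inner M (\<lambda>x. a * T \<phi> x + b * T \<psi> x) h"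
    using L2_operatorD(2)[OF T L2_operatorD(3)[OF T D]] L2_operatorD(4)[OF T D] L h
    by (intro l2_inner_cong_AE) simp_all
  then show ?thesis using L h by (simp add: l2_inner_algebra)
qed

lemma self_adjointD:
  assumes "self_adjoint M D T"
  shows "L2_operator M D T"
    "\<phi> \<in> D \<Longrightarrow> \<psi> \<in> D \<Longrightarrow> l2_inner M (T \<phi>) \<psi> = l2_inner M \<phi> (T \<psi>)"
    "\<phi> \<in> L2 M \<Longrightarrow> f \<in> L2 M \<Longrightarrow> (\<And>\<psi>. \<psi> \<in> D \<Longrightarrow> l2_inner M \<phi> (T \<psi>) = l2_inner M f \<psi>) \<Longrightarrow> \<phi> \<in> D"
    "densely_defined M D"
  using assms unfolding self_adjoint_def by blast+

lemma orthogonal_to_dense_imp_AE_zero: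
  assumes dense: "densely_defined M D" and D: "D \<subseteq> L2 M" and f: "f \<in> L2 M"
    and orth: "\<And>\<psi>. \<psi> \<in> D \<Longrightarrow> l2_inner M f \<psi> = 0"
  shows "AE x in M. f x = 0"
proof (rule l2_norm_eq_0_imp_AE[OF f], rule ccontr)
  assume nz: "l2_norm M f \<noteq> 0"
  then have pos: "l2_norm M f > 0" using l2_norm_nonneg[of M f] by linarith
  then obtain \<psi> where \<psi>: "\<psi> \<in> D" "l2_norm M (\<lambda>x. f x - \<psi> x) < l2_norm M f"
    using dense f unfolding densely_defined_def by blast
  have "(l2_norm M f)\<^sup>2 = l2_inner M f (\<lambda>x. f x - \<psi> x)"
    using \<psi>(1) D f orth by (simp add: l2_norm_square l2_inner_diff_right subset_iff)
  also have "\<dots> \<le> l2_norm M f * l2_norm M (\<lambda>x. f x - \<psi> x)"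
    using l2_Cauchy_Schwarz[OF f, of "\<lambda>x. f x - \<psi> x"] \<psi>(1) D f by (auto simp: subset_iff)
  also have "\<dots> < l2_norm M f * l2_norm M f" using \<psi>(2) pos by (rule mult_strict_left_mono)
  finally show False by (simp add: power2_eq_square)
qed

text \<open>Let \<open>\<theta>\<close> be the limit of the minimizing sequence. It is only known to lie in \<open>L\<^sup>2\<close>, but the
  Cauchy-Schwarz inequality for the nonnegative form of \<open>T - m\<close> shows that \<open>\<theta>\<close> is orthogonal to the
  range of \<open>T - m\<close>, since the form vanishes along the sequence in the limit. Self-adjointness then puts
  \<open>\<theta>\<close> into the domain and makes it an eigenfunction.\<close>

lemma rayleigh_quotient_infimum_is_eigenvalue:
  assumes sa: "self_adjoint M D T"
    and \<phi>: "\<And>n. \<phi> n \<in> D" "\<And>n. l2_norm M (\<phi> n) = 1"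
    and min: "(\<lambda>n. l2_inner M (T (\<phi> n)) (\<phi> n)) \<longlonglongrightarrow> m"
    and lower: "\<And>\<psi>. \<psi> \<in> D \<Longrightarrow> m * l2_inner M \<psi> \<psi> \<le> l2_inner M (T \<psi>) \<psi>"
    and cauchy: "\<And>e. e > 0 \<Longrightarrow> \<exists>N. \<forall>m\<ge>N. \<forall>n\<ge>N. l2_norm M (\<lambda>x. \<phi> m x - \<phi> n x) < e"
  shows "is_eigenvalue M D T m"
proof -
  note op = L2_operatorD[OF self_adjointD(1)[OF sa]]
  have \<phi>L: "\<phi> n \<in> L2 M" "T (\<phi> n) \<in> L2 M" for n using op(1,2)[OF \<phi>(1)] by blast+
  obtain \<theta> where l: "\<theta> \<in> L2 M" "(\<lambda>n. l2_norm M (\<lambda>x. \<phi> n x - \<theta> x)) \<longlonglongrightarrow> 0"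
    using L2_complete[OF \<phi>L(1) cauchy] by blast
  have lim: "(\<lambda>n. l2_inner M (\<phi> n) h) \<longlonglongrightarrow> l2_inner M \<theta> h" if "h \<in> L2 M" for h
    using that l \<phi>L by (intro l2_inner_tendsto l2_norm_const_tendsto) auto
  have "(\<lambda>n. l2_inner M (\<phi> n) (\<phi> n)) \<longlonglongrightarrow> l2_inner M \<theta> \<theta>"
    using l \<phi>L by (intro l2_inner_tendsto) auto
  moreover have one: "l2_inner M (\<phi> n) (\<phi> n) = 1" for n
    using \<phi>(2)[of n] l2_norm_square[of M "\<phi> n"] by simp
  ultimately have norm1: "l2_inner M \<theta> \<theta> = 1" by (simp add: LIMSEQ_const_iff)
  have weak: "l2_inner M \<theta> (T \<psi>) = l2_inner M (\<lambda>x. m * \<theta> x) \<psi>" if \<psi>: "\<psi> \<in> D" for \<psi>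
  proof -
    have \<psi>L: "\<psi> \<in> L2 M" "T \<psi> \<in> L2 M" using op(1,2)[OF \<psi>] by blast+
    let ?b = "l2_inner M \<theta> (T \<psi>) - m * l2_inner M \<theta> \<psi>"
    let ?c = "l2_inner M (T \<psi>) \<psi> - m * l2_inner M \<psi> \<psi>"
    have "?b\<^sup>2 \<le> 0 * ?c"
    proof (rule quadratic_nonneg_imp_discriminant)
      fix t
      have "0 \<le> (l2_inner M (T (\<phi> n)) (\<phi> n) - m)
          + 2 * t * (l2_inner M (\<phi> n) (T \<psi>) - m * l2_inner M (\<phi> n) \<psi>) + t\<^sup>2 * ?c" for n
      proof -
        let ?\<psi> = "\<lambda>x. 1 * \<phi> n x + t * \<psi> x"
        have D: "?\<psi> \<in> D" using op(3)[OF \<phi>(1) \<psi>] .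
        have "l2_inner M (T ?\<psi>) ?\<psi> = 1 * l2_inner M (T (\<phi> n)) ?\<psi> + t * l2_inner M (T \<psi>) ?\<psi>"
          using op(1)[OF D] \<phi>(1) \<psi> by (intro L2_operator_inner_lincomb[OF self_adjointD(1)[OF sa]])
        moreover have "l2_inner M (T (\<phi> n)) \<psi> = l2_inner M (\<phi> n) (T \<psi>)"
          "l2_inner M (T \<psi>) (\<phi> n) = l2_inner M (\<phi> n) (T \<psi>)" "l2_inner M \<psi> (\<phi> n) = l2_inner M (\<phi> n) \<psi>"
          using self_adjointD(2)[OF sa] \<phi>(1) \<psi> l2_inner_commute by metis+
        ultimately show ?thesis using lower[OF D] \<phi>L \<psi>L one
          by (simp add: l2_inner_algebra power2_eq_square algebra_simps)
      qed
      moreover have "(\<lambda>n. (l2_inner M (T (\<phi> n)) (\<phi> n) - m)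
          + 2 * t * (l2_inner M (\<phi> n) (T \<psi>) - m * l2_inner M (\<phi> n) \<psi>) + t\<^sup>2 * ?c)
          \<longlonglongrightarrow> (m - m) + 2 * t * ?b + t\<^sup>2 * ?c"
        by (intro tendsto_intros min lim \<psi>L)
      ultimately have "0 \<le> (m - m) + 2 * t * ?b + t\<^sup>2 * ?c"
        by (intro LIMSEQ_le_const) auto
      then show "0 \<le> 0 + 2 * t * ?b + t\<^sup>2 * ?c" by simp
    qed
    then show ?thesis using \<psi>L l by (simp add: l2_inner_algebra)
  qed
  have mL: "(\<lambda>x. m * \<theta> x) \<in> L2 M" using l by simp
  have \<theta>D: "\<theta> \<in> D" by (rule self_adjointD(3)[OF sa l(1) mL weak])
  have TL: "T \<theta> \<in> L2 M" using op(2)[OF \<theta>D] .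
  have "AE x in M. T \<theta> x - m * \<theta> x = 0"
  proof (rule orthogonal_to_dense_imp_AE_zero[OF self_adjointD(4)[OF sa]])
    show "D \<subseteq> L2 M" using op(1) by (rule subsetI)
    show "(\<lambda>x. T \<theta> x - m * \<theta> x) \<in> L2 M" using TL mL by simp
    fix \<psi> assume \<psi>: "\<psi> \<in> D"
    then show "l2_inner M (\<lambda>x. T \<theta> x - m * \<theta> x) \<psi> = 0"
      using weak[OF \<psi>] self_adjointD(2)[OF sa \<theta>D \<psi>] TL mL op(1)[OF \<psi>]
      by (simp add: l2_inner_diff_left)
  qed
  then have "AE x in M. T \<theta> x = m * \<theta> x" by eventually_elim simp
  moreover have "\<not> (AE x in M. \<theta> x = 0)"
  proof
    assume "AE x in M. \<theta> x = 0"
    then have "l2_inner M \<theta> \<theta> = l2_inner M (\<lambda>x. 0) (\<lambda>x. 0)"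
      using l by (intro l2_inner_cong_AE) auto
    with norm1 show False by (simp add: l2_inner_def)
  qed
  ultimately show ?thesis using \<theta>D by (auto simp: is_eigenvalue_def)
qed

text \<open>The infimum of the Rayleigh quotient is attained by compactness, hence is an eigenvalue, and
  therefore not below the smallest one.\<close>

lemma rayleigh_inequality:
  assumes sa: "self_adjoint M D T"
    and nonneg: "\<And>\<psi>. \<psi> \<in> D \<Longrightarrow> 0 \<le> l2_inner M (T \<psi>) \<psi>"
    and least: "\<And>\<mu>. is_eigenvalue M D T \<mu> \<Longrightarrow> lam \<le> \<mu>"
    and compact: "\<And>\<phi> C. (\<And>n. \<phi> n \<in> D) \<Longrightarrow> (\<And>n. l2_norm M (\<phi> n) = 1) \<Longrightarrow>
      (\<And>n. l2_inner M (T (\<phi> n)) (\<phi> n) \<le> C) \<Longrightarrow>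
      \<exists>r :: nat \<Rightarrow> nat. strict_mono r \<and> (\<forall>e>0. \<exists>N. \<forall>m\<ge>N. \<forall>n\<ge>N. l2_norm M (\<lambda>x. \<phi> (r m) x - \<phi> (r n) x) < e)"
    and \<psi>: "\<psi> \<in> D"
  shows "lam * l2_inner M \<psi> \<psi> \<le> l2_inner M (T \<psi>) \<psi>"
proof -
  note op = L2_operatorD[OF self_adjointD(1)[OF sa]]
  define Z where "Z = {l2_inner M (T \<phi>) \<phi> |\<phi>. \<phi> \<in> D \<and> l2_norm M \<phi> = 1}"
  have bdd: "bdd_below Z" using nonneg by (auto simp: Z_def intro!: bdd_belowI[of _ 0])
  have normalized: "l2_inner M (T \<phi>) \<phi> / l2_inner M \<phi> \<phi> \<in> Z"
    if D: "\<phi> \<in> D" and nz: "l2_norm M \<phi> \<noteq> 0" for \<phi>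
  proof -
    let ?a = "1 / l2_norm M \<phi>"
    let ?\<phi> = "\<lambda>x. ?a * \<phi> x + 0 * \<phi> x"
    have D': "?\<phi> \<in> D" using op(3)[OF D D] .
    have L: "\<phi> \<in> L2 M" "T \<phi> \<in> L2 M" using op(1,2)[OF D] by blast+
    have "l2_norm M ?\<phi> = 1" using nz l2_norm_cmult[of M ?a \<phi>] by simp
    moreover have "l2_inner M (T ?\<phi>) ?\<phi> = l2_inner M (T \<phi>) \<phi> / l2_inner M \<phi> \<phi>"
      using L2_operator_inner_lincomb[OF self_adjointD(1)[OF sa] D D op(1)[OF D'], of ?a 0] L
      by (simp add: l2_inner_algebra power2_eq_square flip: l2_norm_square)
    ultimately show ?thesis using D' unfolding Z_def mem_Collect_eq
      by (intro exI[of _ ?\<phi>] conjI) (simp_all only:)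
  qed
  show ?thesis
  proof (cases "l2_norm M \<psi> = 0")
    case True
    then show ?thesis using nonneg[OF \<psi>] by (simp flip: l2_norm_square)
  next
    case False
    have ne: "Z \<noteq> {}" using normalized[OF \<psi> False] by blast
    define m where "m = Inf Z"
    have lower: "m * l2_inner M \<phi> \<phi> \<le> l2_inner M (T \<phi>) \<phi>" if D: "\<phi> \<in> D" for \<phi>
    proof (cases "l2_norm M \<phi> = 0")
      case True
      then show ?thesis using nonneg[OF D] by (simp flip: l2_norm_square)
    next
      case False
      then have "0 < l2_inner M \<phi> \<phi>" by (simp flip: l2_norm_square)
      moreover have "m \<le> l2_inner M (T \<phi>) \<phi> / l2_inner M \<phi> \<phi>"
        unfolding m_def by (rule cInf_lower[OF normalized[OF D False] bdd])
      ultimately show ?thesis by (simp add: pos_le_divide_eq)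
    qed
    have "\<exists>\<phi>. \<phi> \<in> D \<and> l2_norm M \<phi> = 1 \<and> l2_inner M (T \<phi>) \<phi> < m + 1 / real (Suc n)" for n
    proof -
      have "Inf Z < m + 1 / real (Suc n)" by (simp add: m_def)
      from cInf_lessD[OF ne this] show ?thesis by (auto simp: Z_def)
    qed
    then obtain \<phi> where \<phi>: "\<And>n. \<phi> n \<in> D" "\<And>n. l2_norm M (\<phi> n) = 1"
      "\<And>n. l2_inner M (T (\<phi> n)) (\<phi> n) < m + 1 / real (Suc n)" by metis
    have bound: "l2_inner M (T (\<phi> n)) (\<phi> n) \<le> m + 1" for n
    proof -
      have "1 / real (Suc n) \<le> 1" by simp
      with \<phi>(3)[of n] show ?thesis by linarith
    qed
    have "\<exists>r :: nat \<Rightarrow> nat. strict_mono r \<and>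
        (\<forall>e>0. \<exists>N. \<forall>m\<ge>N. \<forall>n\<ge>N. l2_norm M (\<lambda>x. \<phi> (r m) x - \<phi> (r n) x) < e)"
      by (rule compact[where C="m + 1"]) (rule \<phi> bound)+
    then obtain r :: "nat \<Rightarrow> nat" where r: "strict_mono r" and
      cauchy: "\<forall>e>0. \<exists>N. \<forall>m\<ge>N. \<forall>n\<ge>N. l2_norm M (\<lambda>x. \<phi> (r m) x - \<phi> (r n) x) < e"
      by (elim exE conjE)
    have lim: "(\<lambda>n. l2_inner M (T (\<phi> n)) (\<phi> n)) \<longlonglongrightarrow> m"
    proof (rule tendsto_sandwich)
      show "\<forall>\<^sub>F n in sequentially. m \<le> l2_inner M (T (\<phi> n)) (\<phi> n)"
        using lower[OF \<phi>(1)] \<phi>(2) by (simp flip: l2_norm_square)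
      show "\<forall>\<^sub>F n in sequentially. l2_inner M (T (\<phi> n)) (\<phi> n) \<le> m + 1 / real (Suc n)"
        using \<phi>(3) by (intro always_eventually allI less_imp_le)
      have "(\<lambda>n. m + 1 / real (Suc n)) \<longlonglongrightarrow> m + 0"
        by (intro tendsto_intros LIMSEQ_Suc[OF lim_1_over_n])
      then show "(\<lambda>n. m + 1 / real (Suc n)) \<longlonglongrightarrow> m" by simp
    qed simp
    have "is_eigenvalue M D T m"
    proof (rule rayleigh_quotient_infimum_is_eigenvalue[OF sa, where \<phi>="\<lambda>n. \<phi> (r n)"])
      show "(\<lambda>n. l2_inner M (T (\<phi> (r n))) (\<phi> (r n))) \<longlonglongrightarrow> m"
        using LIMSEQ_subseq_LIMSEQ[OF lim r] by (simp add: o_def)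
    qed (use \<phi> lower cauchy in auto)
    then have "lam \<le> m" by (rule least)
    then have "lam * l2_inner M \<psi> \<psi> \<le> m * l2_inner M \<psi> \<psi>"
      by (intro mult_right_mono l2_inner_self_nonneg)
    also have "\<dots> \<le> l2_inner M (T \<psi>) \<psi>" by (rule lower[OF \<psi>])
    finally show ?thesis .
  qed
qed

text \<open>Coercivity bounds the gradients, and a nearby sequence of test functions inherits compactness from
  Rellich's theorem.\<close>

lemma elliptic_form_bounded_sequence_compact:
  fixes \<Omega> :: "(real^'n) set"
  assumes \<Omega>: "bounded \<Omega>" "\<Omega> \<in> sets lebesgue" and ad: "admissible_coefficients \<Omega> \<AA> a0"
    and \<phi>: "\<And>n. \<phi> n \<in> elliptic_domain \<Omega>" "\<And>n. l2_norm (lebesgue_on \<Omega>) (\<phi> n) = 1"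
    and C: "\<And>n. l2_inner (lebesgue_on \<Omega>) (elliptic_op \<Omega> \<AA> a0 (\<phi> n)) (\<phi> n) \<le> C"
  shows "\<exists>r :: nat \<Rightarrow> nat. strict_mono r \<and> (\<forall>e>0. \<exists>N. \<forall>m\<ge>N. \<forall>n\<ge>N.
      l2_norm (lebesgue_on \<Omega>) (\<lambda>x. \<phi> (r m) x - \<phi> (r n) x) < e)"
proof -
  let ?M = "lebesgue_on \<Omega>"
  obtain c where c: "c > 0" "\<And>\<phi>. \<phi> \<in> elliptic_domain \<Omega> \<Longrightarrow>
      c * (\<Sum>i\<in>UNIV. (l2_norm ?M (weak_partial \<Omega> i \<phi>))\<^sup>2) \<le> l2_inner ?M (elliptic_op \<Omega> \<AA> a0 \<phi>) \<phi>"
    using elliptic_op_coercive[OF \<Omega> ad] by blast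
  note \<phi>D = elliptic_domainD[OF \<phi>(1)]
  define G where "G = sqrt (C / c)"
  have grad: "l2_norm ?M (weak_partial \<Omega> i (\<phi> n)) \<le> G" for i n
  proof -
    have "(l2_norm ?M (weak_partial \<Omega> i (\<phi> n)))\<^sup>2 \<le> (\<Sum>i\<in>UNIV. (l2_norm ?M (weak_partial \<Omega> i (\<phi> n)))\<^sup>2)"
      by (rule member_le_sum) auto
    also have "\<dots> \<le> C / c"
      using order_trans[OF c(2)[OF \<phi>(1)] C, of n] c(1) by (simp add: pos_le_divide_eq mult.commute)
    finally show ?thesis unfolding G_def by (rule real_le_rsqrt)
  qed
  have "\<exists>\<psi>. \<psi> \<in> test_functions \<Omega> \<and> l2_norm ?M (\<lambda>x. \<phi> n x - \<psi> x) < 1 / real (Suc n) \<and>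
     (\<forall>i. l2_norm ?M (\<lambda>x. weak_partial \<Omega> i (\<phi> n) x - partial i \<psi> x) < 1 / real (Suc n))" for n
  proof -
    have "1 / real (Suc n) > 0" by simp
    with \<phi>D(2)[of n] show ?thesis unfolding H10_def by blast
  qed
  then have "\<forall>n. \<exists>\<psi>. \<psi> \<in> test_functions \<Omega> \<and> l2_norm ?M (\<lambda>x. \<phi> n x - \<psi> x) < 1 / real (Suc n) \<and>
     (\<forall>i. l2_norm ?M (\<lambda>x. weak_partial \<Omega> i (\<phi> n) x - partial i \<psi> x) < 1 / real (Suc n))" by blast
  from choice[OF this] obtain \<psi> where \<psi>: "\<And>n. \<psi> n \<in> test_functions \<Omega>"
    "\<And>n. l2_norm ?M (\<lambda>x. \<phi> n x - \<psi> n x) < 1 / real (Suc n)"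
    "\<And>n i. l2_norm ?M (\<lambda>x. weak_partial \<Omega> i (\<phi> n) x - partial i (\<psi> n) x) < 1 / real (Suc n)"
    by blast
  have L: "\<psi> n \<in> L2 ?M" "partial i (\<psi> n) \<in> L2 ?M" for n i
    using \<psi>(1) \<Omega>(2) by (auto intro: test_function_L2 partial_test_function)
  have le1: "1 / real (Suc n) \<le> 1" for n by simp
  have B1: "l2_norm ?M (\<psi> n) \<le> G + 2" for n
  proof -
    have "0 \<le> G" using order_trans[OF l2_norm_nonneg grad[of undefined 0]] .
    moreover have "l2_norm ?M (\<psi> n) \<le> l2_norm ?M (\<lambda>x. \<psi> n x - \<phi> n x) + l2_norm ?M (\<phi> n)"
      using L \<phi>D by (intro l2_norm_triangle_le) auto
    ultimately show ?thesis
      using \<psi>(2)[of n] le1[of n] \<phi>(2)[of n] by (subst (asm) l2_norm_minus_commute) linarith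
  qed
  have B2: "l2_norm ?M (partial i (\<psi> n)) \<le> G + 2" for n i
  proof -
    have "l2_norm ?M (partial i (\<psi> n))
        \<le> l2_norm ?M (\<lambda>x. partial i (\<psi> n) x - weak_partial \<Omega> i (\<phi> n) x) + l2_norm ?M (weak_partial \<Omega> i (\<phi> n))"
      using L \<phi>D by (intro l2_norm_triangle_le) auto
    then show ?thesis
      using \<psi>(3)[of i n] le1[of n] grad[of i n] by (subst (asm) l2_norm_minus_commute) linarith
  qed
  obtain r :: "nat \<Rightarrow> nat" where r: "strict_mono r"
    "\<And>e. e > 0 \<Longrightarrow> \<exists>N. \<forall>m\<ge>N. \<forall>n\<ge>N. l2_norm ?M (\<lambda>x. \<psi> (r m) x - \<psi> (r n) x) < e"
    using test_functions_rellich[of \<Omega> \<psi>, OF \<Omega> \<psi>(1) B1 B2] by blast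
  have "\<exists>N. \<forall>m\<ge>N. \<forall>n\<ge>N. l2_norm ?M (\<lambda>x. \<phi> (r m) x - \<phi> (r n) x) < e" if e: "e > 0" for e
  proof -
    obtain N where N: "\<And>m n. m \<ge> N \<Longrightarrow> n \<ge> N \<Longrightarrow> l2_norm ?M (\<lambda>x. \<psi> (r m) x - \<psi> (r n) x) < e / 3"
      using r(2)[of "e / 3"] e by auto
    obtain N' where N': "1 / real (Suc N') < e / 3"
      using e reals_Archimedean[of "e / 3"] by (auto simp: inverse_eq_divide)
    have small: "l2_norm ?M (\<lambda>x. \<phi> (r m) x - \<psi> (r m) x) < e / 3" if "m \<ge> N'" for m
    proof -
      have "N' \<le> r m" using that seq_suble[OF r(1), of m] by linarith
      then have "1 / real (Suc (r m)) \<le> 1 / real (Suc N')" by (intro divide_left_mono) auto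
      with \<psi>(2)[of "r m"] N' show ?thesis by linarith
    qed
    have "l2_norm ?M (\<lambda>x. \<phi> (r m) x - \<phi> (r n) x) < e" if "m \<ge> max N N'" "n \<ge> max N N'" for m n
    proof -
      have "l2_norm ?M (\<lambda>x. \<phi> (r m) x - \<phi> (r n) x)
          \<le> l2_norm ?M (\<lambda>x. \<phi> (r m) x - \<psi> (r m) x) + l2_norm ?M (\<lambda>x. \<psi> (r m) x - \<phi> (r n) x)"
        using L \<phi>D by (intro l2_norm_triangle_diff) auto
      also have "l2_norm ?M (\<lambda>x. \<psi> (r m) x - \<phi> (r n) x)
          \<le> l2_norm ?M (\<lambda>x. \<psi> (r m) x - \<psi> (r n) x) + l2_norm ?M (\<lambda>x. \<psi> (r n) x - \<phi> (r n) x)"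
        using L \<phi>D by (intro l2_norm_triangle_diff) auto
      finally show ?thesis
        using small[of m] small[of n] N[of m n] that l2_norm_minus_commute[of ?M "\<psi> (r n)" "\<phi> (r n)"]
        by simp
    qed
    then show ?thesis by blast
  qed
  with r(1) show ?thesis by blast
qed

lemma polyhedral_domain_bounded_measurable:
  assumes "convex_polyhedral_domain \<Omega>"
  shows "bounded \<Omega>" "\<Omega> \<in> sets lebesgue"
proof -
  obtain P where P: "polytope P" "\<Omega> = interior P"
    using assms by (auto simp: convex_polyhedral_domain_def)
  show "bounded \<Omega>" using P polytope_imp_bounded bounded_subset interior_subset by metis
  show "\<Omega> \<in> sets lebesgue" using P by (simp add: lmeasurable_interior open_interior borel_open)
qed

lemma elliptic_rayleigh_inequality:
  fixes \<Omega> :: "(real^'n) set"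
  assumes set: "elliptic_setting \<Omega> \<AA> a0 S lam" and \<phi>: "\<phi> \<in> elliptic_domain \<Omega>"
  shows "lam * l2_inner (lebesgue_on \<Omega>) \<phi> \<phi> \<le> l2_inner (lebesgue_on \<Omega>) (elliptic_op \<Omega> \<AA> a0 \<phi>) \<phi>"
proof -
  have \<Omega>: "bounded \<Omega>" "\<Omega> \<in> sets lebesgue"
    using set polyhedral_domain_bounded_measurable by (auto simp: elliptic_setting_def Let_def)
  have ad: "admissible_coefficients \<Omega> \<AA> a0"
    and sa: "self_adjoint (lebesgue_on \<Omega>) (elliptic_domain \<Omega>) (elliptic_op \<Omega> \<AA> a0)"
    and least: "\<And>\<mu>. is_eigenvalue (lebesgue_on \<Omega>) (elliptic_domain \<Omega>) (elliptic_op \<Omega> \<AA> a0) \<mu> \<Longrightarrow> lam \<le> \<mu>"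
    using set by (auto simp: elliptic_setting_def Let_def)
  obtain c where c: "c > 0" "\<And>\<phi>. \<phi> \<in> elliptic_domain \<Omega> \<Longrightarrow>
      c * (\<Sum>i\<in>UNIV. (l2_norm (lebesgue_on \<Omega>) (weak_partial \<Omega> i \<phi>))\<^sup>2)
        \<le> l2_inner (lebesgue_on \<Omega>) (elliptic_op \<Omega> \<AA> a0 \<phi>) \<phi>"
    using elliptic_op_coercive[OF \<Omega> ad] by blast
  show ?thesis
  proof (rule rayleigh_inequality[OF sa _ _ _ \<phi>])
    fix \<psi> assume "\<psi> \<in> elliptic_domain \<Omega>"
    from c(2)[OF this] show "0 \<le> l2_inner (lebesgue_on \<Omega>) (elliptic_op \<Omega> \<AA> a0 \<psi>) \<psi>"
      using c(1) by (elim order_trans[rotated]) (auto intro!: mult_nonneg_nonneg sum_nonneg)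
  next
    fix \<mu> assume "is_eigenvalue (lebesgue_on \<Omega>) (elliptic_domain \<Omega>) (elliptic_op \<Omega> \<AA> a0) \<mu>"
    then show "lam \<le> \<mu>" by (rule least)
  qed (rule elliptic_form_bounded_sequence_compact[OF \<Omega> ad])
qed

section \<open>Lipschitz functions with a nonpositive derivative almost everywhere\<close>

text \<open>If \<open>f b > f a\<close>, choose a level \<open>y\<close> strictly in between which \<open>f\<close> does not take on the exceptional set
  \<open>N\<close>; it exists because a Lipschitz function maps null sets to null sets. At the last point where
  \<open>f\<close> is at most \<open>y\<close>, the derivative exists and is negative, although \<open>f\<close> exceeds \<open>y\<close> from there on.
  The derivative is taken along the complement of \<open>N\<close>; as this set is dense, it meets every right
  neighbourhood of that point.\<close>

lemma lipschitz_strictly_decreasing_imp_le: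
  fixes f :: "real \<Rightarrow> real"
  assumes ab: "a \<le> b" and lip: "K-lipschitz_on {a..b} f" and N: "negligible N"
    and dec: "\<And>t. t \<in> {a<..<b} - N \<Longrightarrow> \<exists>d<0. (f has_real_derivative d) (at t within {a<..<b} - N)"
  shows "f b \<le> f a"
proof (rule ccontr)
  assume "\<not> f b \<le> f a"
  then have fab: "f a < f b" by simp
  have cont: "continuous_on {a..b} f" using lip by (rule lipschitz_on_continuous_on)
  have "negligible (f ` (N \<inter> {a..b}))"
  proof (rule negligible_locally_Lipschitz_image)
    show "negligible (N \<inter> {a..b})" using N by (simp add: negligible_Int)
    fix x assume "x \<in> N \<inter> {a..b}"
    then have "\<forall>y\<in>(N \<inter> {a..b}) \<inter> UNIV. norm (f y - f x) \<le> K * norm (y - x)"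
      using lipschitz_onD[OF lip] by (auto simp: dist_norm)
    then show "\<exists>T B. open T \<and> x \<in> T
        \<and> (\<forall>y\<in>(N \<inter> {a..b}) \<inter> T. norm (f y - f x) \<le> B * norm (y - x))"
      by (intro exI[of _ UNIV] exI[of _ K]) simp
  qed simp
  moreover have "\<not> negligible {f a<..<f b}"
    using fab by (simp add: negligible_interval box_ne_empty flip: box_real(1))
  ultimately obtain y where y: "f a < y" "y < f b" "y \<notin> f ` (N \<inter> {a..b})"
    by (meson negligible_subset greaterThanLessThan_iff subsetI)
  define S where "S = {x \<in> {a..b}. f x \<le> y}"
  have "closed S" unfolding S_def using cont
    by (intro continuous_on_closed_Collect_le continuous_on_const) auto
  moreover have "S \<subseteq> {a..b}" by (auto simp: S_def)
  ultimately have "compact S"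
    by (meson bounded_closed_interval bounded_subset compact_eq_bounded_closed)
  moreover have "a \<in> S" using ab y by (auto simp: S_def)
  ultimately obtain x where x: "x \<in> S" and last: "\<And>z. z \<in> S \<Longrightarrow> z \<le> x"
    using compact_attains_sup[of S] by auto
  have above: "y < f z" if "x < z" "z \<le> b" for z
    using last[of z] that x by (force simp: S_def)
  have xb: "x < b" using x y(2) by (cases "x = b") (auto simp: S_def)
  have "f x = y"
  proof (rule antisym)
    show "f x \<le> y" using x by (simp add: S_def)
    have "(f \<longlongrightarrow> f x) (at x within {x..b})"
    proof (rule tendsto_within_subset)
      show "(f \<longlongrightarrow> f x) (at x within {a..b})"
        using cont x by (auto simp: continuous_on_def S_def)
      show "{x..b} \<subseteq> {a..b}" using x by (auto simp: S_def)
    qed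
    moreover have "at x within {x..b} \<noteq> bot" 
      using xb by (simp add: at_within_Icc_at_right)
    moreover have "\<forall>\<^sub>F z in at x within {x..b}. y \<le> f z"
      by (auto simp: eventually_at_filter intro!: always_eventually less_imp_le above)
    ultimately show "y \<le> f x" by (intro tendsto_lowerbound)
  qed
  then have xI: "x \<in> {a<..<b} - N"
    using y x xb by (auto simp: S_def order.strict_iff_order)
  then obtain d where d: "d < 0" "(f has_real_derivative d) (at x within {a<..<b} - N)"
    using dec by blast
  then have "\<forall>\<^sub>F z in at x within {a<..<b} - N. (f z - f x) / (z - x) < 0"
    by (intro order_tendstoD(2)[of _ d]) (auto simp: has_field_derivative_iff)
  then obtain e where e: "e > 0"
    "\<And>z. z \<in> {a<..<b} - N \<Longrightarrow> z \<noteq> x \<Longrightarrow> dist z x < e \<Longrightarrow> (f z - f x) / (z - x) < 0"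
    unfolding eventually_at by auto
  have "\<not> negligible {x<..<min b (x + e)}"
    using e xb by (simp add: negligible_interval box_ne_empty flip: box_real(1))
  then obtain z where z: "x < z" "z < min b (x + e)" "z \<notin> N"
    by (meson N negligible_subset greaterThanLessThan_iff subsetI)
  then have "(f z - f x) / (z - x) < 0"
    using e(2)[of z] xI by (auto simp: dist_real_def)
  with above[of z] z \<open>f x = y\<close> show False by (simp add: divide_less_0_iff)
qed

lemma lipschitz_derivative_nonpos_AE_imp_le:
  fixes f :: "real \<Rightarrow> real"
  assumes ab: "a \<le> b" and lip: "K-lipschitz_on {a..b} f" and N: "negligible N"
    and dec: "\<And>t. t \<in> {a<..<b} - N \<Longrightarrow> \<exists>d\<le>0. (f has_real_derivative d) (at t within {a<..<b} - N)"
  shows "f b \<le> f a"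
proof (rule field_le_epsilon)
  fix e :: real assume e: "e > 0"
  \<comment> \<open>Tilting \<open>f\<close> by the slope \<open>-c\<close> makes the derivative negative and costs at most \<open>e\<close>.\<close>
  define c where "c = e / (b - a + 1)"
  have c: "c > 0" using e ab by (simp add: c_def)
  have "f b - c * b \<le> f a - c * a"
  proof (rule lipschitz_strictly_decreasing_imp_le[OF ab _ N])
    show "(K + \<bar>c\<bar> * 1)-lipschitz_on {a..b} (\<lambda>x. f x - c * x)"
      by (intro lipschitz_intros lip)
    fix t assume "t \<in> {a<..<b} - N"
    then obtain d where d: "d \<le> 0" "(f has_real_derivative d) (at t within {a<..<b} - N)"
      using dec by blast
    have "((\<lambda>x. f x - c * x) has_real_derivative d - c) (at t within {a<..<b} - N)"
      using d by (auto intro!: derivative_eq_intros)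
    then show "\<exists>d<0. ((\<lambda>x. f x - c * x) has_real_derivative d) (at t within {a<..<b} - N)"
      using c d by (intro exI[of _ "d - c"]) auto
  qed
  moreover have "c * (b - a) \<le> e"
    using e ab by (simp add: c_def field_simps)
  ultimately show "f b \<le> f a + e" by (simp add: algebra_simps)
qed

lemma lipschitz_on_mult_bounded:
  fixes f g :: "real \<Rightarrow> real"
  assumes f: "K-lipschitz_on S f" and g: "L-lipschitz_on S g"
    and bf: "\<And>x. x \<in> S \<Longrightarrow> \<bar>f x\<bar> \<le> A" and bg: "\<And>x. x \<in> S \<Longrightarrow> \<bar>g x\<bar> \<le> B"
    and AB: "0 \<le> A" "0 \<le> B"
  shows "(K * B + A * L)-lipschitz_on S (\<lambda>x. f x * g x)"
proof (rule lipschitz_onI)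
  fix x y assume xy: "x \<in> S" "y \<in> S"
  have "f x * g x - f y * g y = (f x - f y) * g x + f y * (g x - g y)"
    by (simp add: algebra_simps)
  then have "dist (f x * g x) (f y * g y) \<le> \<bar>f x - f y\<bar> * \<bar>g x\<bar> + \<bar>f y\<bar> * \<bar>g x - g y\<bar>"
    by (simp add: dist_real_def flip: abs_mult) 
  also have "\<dots> \<le> (K * dist x y) * B + A * (L * dist x y)"
    using lipschitz_onD[OF f] lipschitz_onD[OF g] xy bf bg AB lipschitz_on_nonneg[OF f]
    by (intro add_mono mult_mono) (auto simp: dist_real_def)
  finally show "dist (f x * g x) (f y * g y) \<le> (K * B + A * L) * dist x y"
    by (simp add: algebra_simps)
qed (use lipschitz_on_nonneg[OF f] lipschitz_on_nonneg[OF g] AB in simp)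

section \<open>Differentiation in \<open>L\<^sup>2\<close>\<close>

lemma has_L2_derivative_imp_tendsto:
  assumes f: "\<And>s. 0 \<le> s \<Longrightarrow> f s \<in> L2 M" and f': "f' \<in> L2 M" and t: "0 \<le> t"
    and d: "has_L2_derivative M f f' t"
  shows "((\<lambda>s. l2_norm M (\<lambda>x. f s x - f t x)) \<longlongrightarrow> 0) (at t within {0..})"
proof (rule Lim_null_comparison)
  let ?q = "\<lambda>s. l2_norm M (\<lambda>x. (f s x - f t x) / (s - t) - f' x)"
  have q: "(?q \<longlongrightarrow> 0) (at t within {0..})" using d by (simp add: has_L2_derivative_def)
  have "((\<lambda>s. \<bar>s - t\<bar> * (?q s + l2_norm M f')) \<longlongrightarrow> \<bar>t - t\<bar> * (0 + l2_norm M f')) (at t within {0..})"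
    by (intro tendsto_intros q)
  then show "((\<lambda>s. \<bar>s - t\<bar> * (?q s + l2_norm M f')) \<longlongrightarrow> 0) (at t within {0..})" by simp
  have "norm (l2_norm M (\<lambda>x. f s x - f t x)) \<le> \<bar>s - t\<bar> * (?q s + l2_norm M f')"
    if s: "s \<noteq> t" "0 \<le> s" for s
  proof -
    have "l2_norm M (\<lambda>x. f s x - f t x) = l2_norm M (\<lambda>x. (s - t) * ((f s x - f t x) / (s - t)))"
      using s by simp
    also have "\<dots> = \<bar>s - t\<bar> * l2_norm M (\<lambda>x. (f s x - f t x) / (s - t))" by (rule l2_norm_cmult)
    also have "\<dots> \<le> \<bar>s - t\<bar> * (?q s + l2_norm M f')"
      using f[OF s(2)] f[OF t] f' by (intro mult_left_mono l2_norm_triangle_le) auto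
    finally show ?thesis by simp
  qed
  then show "\<forall>\<^sub>F s in at t within {0..}. norm (l2_norm M (\<lambda>x. f s x - f t x)) \<le> \<bar>s - t\<bar> * (?q s + l2_norm M f')"
    by (auto simp: eventually_at_filter)
qed

lemma has_derivative_l2_inner:
  assumes f: "\<And>s. 0 \<le> s \<Longrightarrow> f s \<in> L2 M" and g: "\<And>s. 0 \<le> s \<Longrightarrow> g s \<in> L2 M"
    and f': "f' \<in> L2 M" and g': "g' \<in> L2 M" and t: "0 \<le> t"
    and df: "has_L2_derivative M f f' t" and dg: "has_L2_derivative M g g' t"
  shows "((\<lambda>s. l2_inner M (f s) (g s)) has_real_derivative l2_inner M f' (g t) + l2_inner M (f t) g')
    (at t within {0..})"
  unfolding has_field_derivative_iff
proof (rule Lim_transform_eventually)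
  let ?F = "at t within {0..}"
  let ?qf = "\<lambda>s x. (f s x - f t x) / (s - t)" and ?qg = "\<lambda>s x. (g s x - g t x) / (s - t)"
  have ev: "\<forall>\<^sub>F s in ?F. 0 \<le> s \<and> s \<noteq> t" by (auto simp: eventually_at_filter)
  have qL: "?qf s \<in> L2 M" "?qg s \<in> L2 M" if "0 \<le> s" for s
    using f[OF that] f[OF t] g[OF that] g[OF t] by simp_all
  have fL: "\<forall>\<^sub>F s in ?F. g s \<in> L2 M" "\<forall>\<^sub>F s in ?F. ?qf s \<in> L2 M" "\<forall>\<^sub>F s in ?F. ?qg s \<in> L2 M"
    using ev by (rule eventually_mono; simp add: g qL)+
  show "((\<lambda>s. l2_inner M (?qf s) (g s) + l2_inner M (f t) (?qg s))
      \<longlongrightarrow> l2_inner M f' (g t) + l2_inner M (f t) g') ?F"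
  proof (rule tendsto_add)
    show "((\<lambda>s. l2_inner M (?qf s) (g s)) \<longlongrightarrow> l2_inner M f' (g t)) ?F"
      using df has_L2_derivative_imp_tendsto[OF g g' t dg]
      by (intro l2_inner_tendsto fL f' g[OF t]) (simp_all add: has_L2_derivative_def)
    show "((\<lambda>s. l2_inner M (f t) (?qg s)) \<longlongrightarrow> l2_inner M (f t) g') ?F"
      using dg f[OF t]
      by (intro l2_inner_tendsto fL g' f[OF t] l2_norm_const_tendsto) (simp_all add: has_L2_derivative_def)
  qed
  show "\<forall>\<^sub>F s in ?F. l2_inner M (?qf s) (g s) + l2_inner M (f t) (?qg s)
      = (l2_inner M (f s) (g s) - l2_inner M (f t) (g t)) / (s - t)"
    using ev
  proof eventually_elim
    case (elim s)
    then show ?case using f[of s] g[of s] f[OF t] g[OF t]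
      by (simp add: l2_inner_algebra diff_divide_distrib)
  qed
qed

lemma has_L2_derivative_const: "has_L2_derivative M (\<lambda>s. f) (\<lambda>x. 0) t"
  by (simp add: has_L2_derivative_def l2_norm_def l2_inner_def)

text \<open>The mean value theorem is applied to the real function obtained by pairing \<open>f\<close> with the increment
  itself.\<close>

lemma has_L2_derivative_imp_lipschitz:
  assumes f: "\<And>s. 0 \<le> s \<Longrightarrow> f s \<in> L2 M" and f': "\<And>s. 0 \<le> s \<Longrightarrow> f' s \<in> L2 M"
    and d: "\<And>s. 0 \<le> s \<Longrightarrow> has_L2_derivative M f (f' s) s"
    and B: "\<And>s. s \<in> {0..T} \<Longrightarrow> l2_norm M (f' s) \<le> B"
    and st: "s \<in> {0..T}" "t \<in> {0..T}"
  shows "l2_norm M (\<lambda>x. f s x - f t x) \<le> B * \<bar>s - t\<bar>"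
proof -
  let ?z = "\<lambda>x. f s x - f t x"
  have fs: "f s \<in> L2 M" "f t \<in> L2 M" and z: "?z \<in> L2 M" using f st by auto
  have "norm (l2_inner M (f s) ?z - l2_inner M (f t) ?z) \<le> (B * l2_norm M ?z) * norm (s - t)"
  proof (rule field_differentiable_bound[where S="{0..T}"])
    fix r assume r: "r \<in> {0..T}"
    then have r0: "0 \<le> r" by simp
    have "((\<lambda>s. l2_inner M (f s) ?z) has_real_derivative l2_inner M (f' r) ?z + l2_inner M (f r) (\<lambda>x. 0))
        (at r within {0..})"
      by (rule has_derivative_l2_inner[OF f z f'[OF r0] L2_zero r0 d[OF r0] has_L2_derivative_const])
    then have "((\<lambda>s. l2_inner M (f s) ?z) has_real_derivative l2_inner M (f' r) ?z + l2_inner M (f r) (\<lambda>x. 0))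
        (at r within {0..T})"
      by (rule has_field_derivative_subset) auto
    then show "((\<lambda>s. l2_inner M (f s) ?z) has_real_derivative l2_inner M (f' r) ?z) (at r within {0..T})"
      by (simp only: l2_inner_def[of M "f r"] mult_zero_right integral_zero add_0_right)
    have "norm (l2_inner M (f' r) ?z) \<le> l2_norm M (f' r) * l2_norm M ?z"
      using l2_Cauchy_Schwarz[OF f'[OF r0] z] by simp
    also have "\<dots> \<le> B * l2_norm M ?z" using B[OF r] by (intro mult_right_mono) auto
    finally show "norm (l2_inner M (f' r) ?z) \<le> B * l2_norm M ?z" .
  qed (use st in auto)
  moreover have "l2_inner M (f s) ?z - l2_inner M (f t) ?z = l2_norm M ?z * l2_norm M ?z"
    using l2_inner_diff_left[OF fs z] l2_norm_square[of M ?z] by (simp only: power2_eq_square)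
  ultimately have "l2_norm M ?z * l2_norm M ?z \<le> l2_norm M ?z * (B * \<bar>s - t\<bar>)"
    by (simp add: mult_ac)
  moreover have "0 \<le> B * \<bar>s - t\<bar>"
    using order_trans[OF l2_norm_nonneg B[OF st(1)]] by simp
  ultimately show ?thesis
  proof (cases "l2_norm M ?z = 0")
    case False
    then have "0 < l2_norm M ?z" using l2_norm_nonneg[of M ?z] by linarith
    with \<open>l2_norm M ?z * l2_norm M ?z \<le> l2_norm M ?z * (B * \<bar>s - t\<bar>)\<close>
    show ?thesis by (rule mult_left_le_imp_le)
  qed simp
qed

lemma lipschitz_on_l2_inner:
  assumes f: "\<And>s. s \<in> X \<Longrightarrow> f s \<in> L2 M" and g: "\<And>s. s \<in> X \<Longrightarrow> g s \<in> L2 M"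
    and lf: "\<And>s t. s \<in> X \<Longrightarrow> t \<in> X \<Longrightarrow> l2_norm M (\<lambda>x. f s x - f t x) \<le> K * \<bar>s - t\<bar>"
    and lg: "\<And>s t. s \<in> X \<Longrightarrow> t \<in> X \<Longrightarrow> l2_norm M (\<lambda>x. g s x - g t x) \<le> L * \<bar>s - t\<bar>"
    and bf: "\<And>s. s \<in> X \<Longrightarrow> l2_norm M (f s) \<le> A" and bg: "\<And>s. s \<in> X \<Longrightarrow> l2_norm M (g s) \<le> B"
    and nonneg: "0 \<le> K" "0 \<le> L" "0 \<le> A" "0 \<le> B"
  shows "(K * B + A * L)-lipschitz_on X (\<lambda>s. l2_inner M (f s) (g s))"
proof (rule lipschitz_onI)
  fix s t assume st: "s \<in> X" "t \<in> X"
  have "l2_inner M (f s) (g s) - l2_inner M (f t) (g t)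
      = l2_inner M (\<lambda>x. f s x - f t x) (g s) + l2_inner M (f t) (\<lambda>x. g s x - g t x)"
    using f[OF st(1)] f[OF st(2)] g[OF st(1)] g[OF st(2)] by (simp add: l2_inner_algebra)
  also have "\<bar>\<dots>\<bar> \<le> \<bar>l2_inner M (\<lambda>x. f s x - f t x) (g s)\<bar> + \<bar>l2_inner M (f t) (\<lambda>x. g s x - g t x)\<bar>"
    by (rule abs_triangle_ineq)
  also have "\<dots> \<le> l2_norm M (\<lambda>x. f s x - f t x) * l2_norm M (g s) + l2_norm M (f t) * l2_norm M (\<lambda>x. g s x - g t x)"
    using f[OF st(1)] f[OF st(2)] g[OF st(1)] g[OF st(2)]
    by (intro add_mono l2_Cauchy_Schwarz) simp_all
  also have "\<dots> \<le> (K * \<bar>s - t\<bar>) * B + A * (L * \<bar>s - t\<bar>)"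
    using lf[OF st] lg[OF st] bf[OF st(2)] bg[OF st(1)] nonneg by (intro add_mono mult_mono) simp_all
  finally show "dist (l2_inner M (f s) (g s)) (l2_inner M (f t) (g t)) \<le> (K * B + A * L) * dist s t"
    by (simp add: dist_real_def algebra_simps)
qed (use nonneg in simp)

lemma L2_continuous_imp_continuous_on_norm_square:
  assumes f: "\<And>s. 0 \<le> s \<Longrightarrow> f s \<in> L2 M" and c: "L2_continuous M f"
  shows "continuous_on {0..} (\<lambda>s. l2_inner M (f s) (f s))"
  unfolding continuous_on_def
proof
  fix t :: real assume "t \<in> {0..}"
  then have t: "0 \<le> t" by simp
  have lim: "((\<lambda>s. l2_norm M (\<lambda>x. f s x - f t x)) \<longlongrightarrow> 0) (at t within {0..})"
    using c t by (simp add: L2_continuous_def)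
  have "\<forall>\<^sub>F s in at t within {0..}. f s \<in> L2 M" using f by (auto simp: eventually_at_filter)
  then show "((\<lambda>s. l2_inner M (f s) (f s)) \<longlongrightarrow> l2_inner M (f t) (f t)) (at t within {0..})"
    using lim f[OF t] by (intro l2_inner_tendsto) auto
qed

lemma closure_interval_minus_negligible:
  fixes T :: real
  assumes N: "negligible N" and T: "0 < T"
  shows "closure ({0<..<T} - N) = {0..T}"
proof
  show "closure ({0<..<T} - N) \<subseteq> {0..T}" by (rule closure_minimal) auto
  have "interior N = {}"
  proof (rule ccontr)
    assume "interior N \<noteq> {}"
    from open_not_negligible[OF open_interior this] negligible_subset[OF N interior_subset]
    show False by contradiction
  qed
  then have "closure (- N) = UNIV" by (simp add: closure_complement)
  then have "{0<..<T} \<subseteq> closure ({0<..<T} \<inter> - N)"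
    using open_Int_closure_subset[of "{0<..<T}" "- N"] by simp
  then have "closure {0<..<T} \<subseteq> closure ({0<..<T} - N)"
    by (simp add: closure_minimal Diff_eq)
  then show "{0..T} \<subseteq> closure ({0<..<T} - N)" using T by simp
qed

section \<open>Decay of the energy\<close>

text \<open>For \<open>\<phi>\<close> in the domain of \<open>A\<close>, the function \<open>S \<phi>\<close> lies in the domain of \<open>S\<close> again, so that \<open>S\<close> can be
  moved across.\<close>

lemma sqrt_operator_form:
  assumes sq: "is_sqrt_operator M D A E S" and \<phi>: "\<phi> \<in> D" and \<psi>: "\<psi> \<in> E"
    and A\<phi>: "A \<phi> \<in> L2 M"
  shows "l2_inner M (S \<phi>) (S \<psi>) = l2_inner M (A \<phi>) \<psi>"
proof -
  have sa: "self_adjoint M E S" and D: "S \<phi> \<in> E" and AE: "AE x in M. S (S \<phi>) x = A \<phi> x"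
    using sq \<phi> by (auto simp: is_sqrt_operator_def)
  note op = L2_operatorD[OF self_adjointD(1)[OF sa]]
  have "l2_inner M (S \<phi>) (S \<psi>) = l2_inner M (S (S \<phi>)) \<psi>"
    using self_adjointD(2)[OF sa D \<psi>] by simp
  also have "\<dots> = l2_inner M (A \<phi>) \<psi>"
    by (rule l2_inner_cong_AE[OF op(2)[OF D] A\<phi> op(1)[OF \<psi>] op(1)[OF \<psi>] AE]) simp
  finally show ?thesis .
qed

text \<open>For two times at which \<open>u\<close> lies in the domain of \<open>A\<close>, symmetry gives
  \<open>\<parallel>S u(s)\<parallel>\<^sup>2 - \<parallel>S u(t)\<parallel>\<^sup>2 = (A u(s) + A u(t), u(s) - u(t))\<close>.
  The right-hand side is bounded by a multiple of \<open>\<bar>s - t\<bar>\<close>. Such times are dense, and \<open>S u\<close> is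
  continuous, so that the bound extends to all times.\<close>

lemma sqrt_energy_lipschitz:
  assumes sa: "self_adjoint M D A" and sq: "is_sqrt_operator M D A E S" and T: "0 < T"
    and u: "\<And>t. 0 \<le> t \<Longrightarrow> u t \<in> E" and cont: "L2_continuous M (\<lambda>t. S (u t))"
    and lip: "\<And>s t. s \<in> {0..T} \<Longrightarrow> t \<in> {0..T} \<Longrightarrow> l2_norm M (\<lambda>x. u s x - u t x) \<le> L * \<bar>s - t\<bar>"
    and L: "0 \<le> L" and N: "negligible N" and K: "0 \<le> K"
    and good: "\<And>t. t \<in> {0<..<T} - N \<Longrightarrow> u t \<in> D \<and> l2_norm M (A (u t)) \<le> K"
  shows "(2 * K * L)-lipschitz_on {0..T} (\<lambda>t. l2_inner M (S (u t)) (S (u t)))"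
proof -
  let ?e = "\<lambda>t. l2_inner M (S (u t)) (S (u t))"
  let ?H = "{0<..<T} - N"
  have saS: "self_adjoint M E S" using sq by (simp add: is_sqrt_operator_def)
  note op = L2_operatorD[OF self_adjointD(1)[OF sa]]
  note opS = L2_operatorD[OF self_adjointD(1)[OF saS]]
  have eq: "closure ?H = {0..T}" by (rule closure_interval_minus_negligible[OF N T])
  have "(2 * K * L)-lipschitz_on (closure ?H) ?e"
  proof (rule lipschitz_on_closure)
    have "continuous_on {0..} ?e"
      by (rule L2_continuous_imp_continuous_on_norm_square[OF opS(2)[OF u] cont])
    then show "continuous_on (closure ?H) ?e"
      unfolding eq by (rule continuous_on_subset) auto
    show "(2 * K * L)-lipschitz_on ?H ?e"
    proof (rule lipschitz_onI)
      fix s t assume st: "s \<in> ?H" "t \<in> ?H"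
      then have st0: "s \<in> {0..T}" "t \<in> {0..T}" "0 \<le> s" "0 \<le> t" by auto
      have D: "u s \<in> D" "u t \<in> D" using good st by auto
      have AL: "A (u s) \<in> L2 M" "A (u t) \<in> L2 M" using op(2) D by blast+
      have uL: "u s \<in> L2 M" "u t \<in> L2 M" using op(1) D by blast+
      have e: "?e s = l2_inner M (A (u s)) (u s)" "?e t = l2_inner M (A (u t)) (u t)"
        using sqrt_operator_form[OF sq D(1) u[OF st0(3)] AL(1)]
          sqrt_operator_form[OF sq D(2) u[OF st0(4)] AL(2)] by auto
      have "?e s - ?e t = l2_inner M (\<lambda>x. A (u s) x + A (u t) x) (\<lambda>x. u s x - u t x)"
        unfolding e using AL uL self_adjointD(2)[OF sa D(1) D(2)] l2_inner_commute[of M "u s" "A (u t)"]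
        by (simp add: l2_inner_algebra)
      also have "\<bar>\<dots>\<bar> \<le> l2_norm M (\<lambda>x. A (u s) x + A (u t) x) * l2_norm M (\<lambda>x. u s x - u t x)"
        using AL uL by (intro l2_Cauchy_Schwarz) auto
      also have "\<dots> \<le> (2 * K) * (L * \<bar>s - t\<bar>)"
      proof (rule mult_mono)
        show "l2_norm M (\<lambda>x. A (u s) x + A (u t) x) \<le> 2 * K"
          using l2_norm_triangle[OF AL] good[OF st(1)] good[OF st(2)] by linarith
      qed (use lip[OF st0(1,2)] K in auto)
      finally show "dist (?e s) (?e t) \<le> (2 * K * L) * dist s t"
        by (simp add: dist_real_def mult.assoc)
    qed (use K L in simp)
  qed
  then show ?thesis unfolding eq .
qed

text \<open>The same identity is divided by \<open>s - t\<close>. The functions \<open>A u(s)\<close> need not converge in norm as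
  \<open>s\<close> tends to \<open>t\<close>; but they are bounded, and tested against \<open>u' \<in> E\<close> they converge, because
  \<open>(A u(s), u') = (S u(s), S u')\<close>.\<close>

lemma sqrt_energy_derivative:
  assumes sa: "self_adjoint M D A" and sq: "is_sqrt_operator M D A E S" and H: "H \<subseteq> {0..}"
    and u: "\<And>t. 0 \<le> t \<Longrightarrow> u t \<in> E" and cont: "L2_continuous M (\<lambda>t. S (u t))"
    and good: "\<And>t. t \<in> H \<Longrightarrow> u t \<in> D \<and> l2_norm M (A (u t)) \<le> K"
    and t: "t \<in> H" and u': "u' \<in> E" and du: "has_L2_derivative M u u' t"
  shows "((\<lambda>t. l2_inner M (S (u t)) (S (u t))) has_real_derivative 2 * l2_inner M (A (u t)) u')
    (at t within H)"
  unfolding has_field_derivative_iff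
proof (rule Lim_transform_eventually)
  let ?F = "at t within H"
  let ?q = "\<lambda>s x. (u s x - u t x) / (s - t)"
  have saS: "self_adjoint M E S" using sq by (simp add: is_sqrt_operator_def)
  note op = L2_operatorD[OF self_adjointD(1)[OF sa]]
  note opS = L2_operatorD[OF self_adjointD(1)[OF saS]]
  have t0: "0 \<le> t" using t H by auto
  have D: "s \<in> H \<Longrightarrow> u s \<in> D" for s using good by blast
  have uL: "u s \<in> L2 M" "A (u s) \<in> L2 M" "S (u s) \<in> L2 M" "u s \<in> E" if "s \<in> H" for s
  proof -
    show "u s \<in> L2 M" "A (u s) \<in> L2 M" using op(1,2)[OF D[OF that]] by blast+
    show "u s \<in> E" using u[of s] that H by auto
    then show "S (u s) \<in> L2 M" by (rule opS(2))
  qed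
  have u'L: "u' \<in> L2 M" "S u' \<in> L2 M" using opS(1,2)[OF u'] by blast+
  have ev: "\<forall>\<^sub>F s in ?F. s \<in> H \<and> s \<noteq> t" by (auto simp: eventually_at_filter)
  have qL: "?q s \<in> L2 M" if "s \<in> H" for s using uL(1)[OF that] uL(1)[OF t] by simp
  have evq: "\<forall>\<^sub>F s in ?F. ?q s \<in> L2 M" using ev by eventually_elim (simp add: qL)
  have dq: "((\<lambda>s. l2_norm M (\<lambda>x. ?q s x - u' x)) \<longlongrightarrow> 0) ?F"
    using du H unfolding has_L2_derivative_def by (rule tendsto_within_subset)
  have dS: "((\<lambda>s. l2_norm M (\<lambda>x. S (u s) x - S (u t) x)) \<longlongrightarrow> 0) ?F"
    using cont t0 H unfolding L2_continuous_def by (blast intro: tendsto_within_subset)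
  have lim1: "((\<lambda>s. l2_inner M (A (u s)) (\<lambda>x. ?q s x - u' x)) \<longlongrightarrow> 0) ?F"
  proof (rule Lim_null_comparison)
    show "\<forall>\<^sub>F s in ?F. norm (l2_inner M (A (u s)) (\<lambda>x. ?q s x - u' x)) \<le> K * l2_norm M (\<lambda>x. ?q s x - u' x)"
      using ev
    proof eventually_elim
      case (elim s)
      have "\<bar>l2_inner M (A (u s)) (\<lambda>x. ?q s x - u' x)\<bar> \<le> l2_norm M (A (u s)) * l2_norm M (\<lambda>x. ?q s x - u' x)"
        using elim uL qL u'L by (intro l2_Cauchy_Schwarz L2_diff) auto
      also have "\<dots> \<le> K * l2_norm M (\<lambda>x. ?q s x - u' x)"
        using good elim by (intro mult_right_mono) auto
      finally show ?case by simp
    qed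
    show "((\<lambda>s. K * l2_norm M (\<lambda>x. ?q s x - u' x)) \<longlongrightarrow> 0) ?F"
      using tendsto_mult_left[OF dq, of K] by simp
  qed
  have lim2: "((\<lambda>s. l2_inner M (S (u s)) (S u')) \<longlongrightarrow> l2_inner M (S (u t)) (S u')) ?F"
  proof (rule l2_inner_tendsto[OF _ _ uL(3)[OF t] u'L(2) dS l2_norm_const_tendsto])
    show "\<forall>\<^sub>F s in ?F. S (u s) \<in> L2 M" using ev by eventually_elim (simp add: uL)
  qed (simp add: u'L)
  have lim3: "((\<lambda>s. l2_inner M (A (u t)) (?q s)) \<longlongrightarrow> l2_inner M (A (u t)) u') ?F"
    by (rule l2_inner_tendsto[OF _ evq uL(2)[OF t] u'L(1) l2_norm_const_tendsto dq]) (simp add: uL t)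
  have St: "l2_inner M (S (u t)) (S u') = l2_inner M (A (u t)) u'"
    by (rule sqrt_operator_form[OF sq D[OF t] u' uL(2)[OF t]])
  show "((\<lambda>s. l2_inner M (A (u s)) (\<lambda>x. ?q s x - u' x) + l2_inner M (S (u s)) (S u') + l2_inner M (A (u t)) (?q s))
      \<longlongrightarrow> 2 * l2_inner M (A (u t)) u') ?F"
    using tendsto_add[OF tendsto_add[OF lim1 lim2] lim3] unfolding St by simp
  show "\<forall>\<^sub>F s in ?F.
      l2_inner M (A (u s)) (\<lambda>x. ?q s x - u' x) + l2_inner M (S (u s)) (S u') + l2_inner M (A (u t)) (?q s)
      = (l2_inner M (S (u s)) (S (u s)) - l2_inner M (S (u t)) (S (u t))) / (s - t)"
    using ev
  proof eventually_elim
    case (elim s)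
    then have s: "s \<in> H" by simp
    have "l2_inner M (A (u s)) (\<lambda>x. ?q s x - u' x) + l2_inner M (S (u s)) (S u')
        = l2_inner M (A (u s)) (?q s)"
      using sqrt_operator_form[OF sq D[OF s] u' uL(2)[OF s]] uL(2)[OF s] qL[OF s] u'L
      by (simp add: l2_inner_diff_right)
    moreover have "l2_inner M (S (u s)) (S (u s)) = l2_inner M (A (u s)) (u s)"
      "l2_inner M (S (u t)) (S (u t)) = l2_inner M (A (u t)) (u t)"
      using sqrt_operator_form[OF sq D[OF s] uL(4)[OF s] uL(2)[OF s]]
        sqrt_operator_form[OF sq D[OF t] uL(4)[OF t] uL(2)[OF t]] by auto
    moreover have "l2_inner M (A (u s)) (u t) = l2_inner M (A (u t)) (u s)"
      using self_adjointD(2)[OF sa D[OF s] D[OF t]] l2_inner_commute by metis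
    moreover have "l2_inner M (A (u r)) (?q s)
        = (l2_inner M (A (u r)) (u s) - l2_inner M (A (u r)) (u t)) / (s - t)" if "r \<in> H" for r
      using uL(2)[OF that] uL(1)[OF s] uL(1)[OF t]
      by (simp add: l2_inner_divide_right l2_inner_diff_right)
    ultimately show ?case using s t by (simp add: diff_divide_distrib)
  qed
qed

text \<open>Here \<open>p\<close>, \<open>c\<close>, \<open>w\<close>, \<open>e\<close> stand for \<open>\<parallel>u'\<parallel>\<^sup>2\<close>, \<open>(u',u)\<close>, \<open>\<parallel>u\<parallel>\<^sup>2\<close>, \<open>\<parallel>S u\<parallel>\<^sup>2\<close>, so that \<open>F\<close> is half of
  \<open>\<parallel>v\<parallel>\<^sup>2 + \<parallel>S u\<parallel>\<^sup>2 + \<gamma> \<parallel>u\<parallel>\<^sup>2\<close> with \<open>v = u' + \<delta> u\<close>. The coefficients are such that the wave equation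
  becomes \<open>v' = -\<delta> (2 + \<delta>) v - \<gamma> u - A u\<close>, \<open>u' = v - \<delta> u\<close>: the coupling terms cancel in the derivative of
  \<open>F\<close>, and \<open>F' + 2 \<delta> F = - (\<delta> + \<delta>\<^sup>2) \<parallel>v\<parallel>\<^sup>2\<close> at almost every time.\<close>

lemma damped_wave_lyapunov_decay:
  fixes \<delta> :: real
  defines "\<alpha> \<equiv> \<delta> * (3 + \<delta>)" and "\<beta> \<equiv> \<delta> * (2 + 3 * \<delta> + 2 * \<delta>\<^sup>2)" and "\<gamma> \<equiv> \<delta> * (2 + \<delta> + \<delta>\<^sup>2)"
  defines "F \<equiv> \<lambda>p c w e. (p + 2 * \<delta> * c + \<delta>\<^sup>2 * w + e + \<gamma> * w) / 2"
  assumes sa: "self_adjoint M D A" and sq: "is_sqrt_operator M D A E S" and \<delta>: "0 < \<delta>" and T: "0 < T"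
    and u: "\<And>t. 0 \<le> t \<Longrightarrow> u t \<in> E" and u': "\<And>t. 0 \<le> t \<Longrightarrow> u' t \<in> L2 M"
    and cont: "L2_continuous M (\<lambda>t. S (u t))"
    and du: "\<And>t. 0 \<le> t \<Longrightarrow> has_L2_derivative M u (u' t) t"
    and lip: "\<And>s t. s \<in> {0..T} \<Longrightarrow> t \<in> {0..T} \<Longrightarrow> l2_norm M (\<lambda>x. u' s x - u' t x) \<le> L * \<bar>s - t\<bar>"
    and N: "negligible N"
    and good: "\<And>t. t \<in> {0<..<T} - N \<Longrightarrow> u t \<in> D \<and> l2_norm M (A (u t)) \<le> K \<and> u' t \<in> E \<and>
      u'' t \<in> L2 M \<and> has_L2_derivative M u' (u'' t) t \<and>
      (AE x in M. u'' t x + \<alpha> * u' t x + \<beta> * u t x + A (u t) x = 0)"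
  shows "exp (2 * \<delta> * T) * F (l2_inner M (u' T) (u' T)) (l2_inner M (u' T) (u T)) (l2_inner M (u T) (u T))
      (l2_inner M (S (u T)) (S (u T)))
    \<le> F (l2_inner M (u' 0) (u' 0)) (l2_inner M (u' 0) (u 0)) (l2_inner M (u 0) (u 0))
      (l2_inner M (S (u 0)) (S (u 0)))"
proof -
  let ?H = "{0<..<T} - N"
  define p c w e where "p t = l2_inner M (u' t) (u' t)" and "c t = l2_inner M (u' t) (u t)"
    and "w t = l2_inner M (u t) (u t)" and "e t = l2_inner M (S (u t)) (S (u t))" for t
  define \<Phi> where "\<Phi> t = F (p t) (c t) (w t) (e t)" for t
  have saS: "self_adjoint M E S" using sq by (simp add: is_sqrt_operator_def)
  note op = L2_operatorD[OF self_adjointD(1)[OF sa]]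
  note opS = L2_operatorD[OF self_adjointD(1)[OF saS]]
  have uL: "u t \<in> L2 M" if "0 \<le> t" for t using opS(1)[OF u[OF that]] .
  have "?H \<noteq> {}"
  proof
    assume "?H = {}"
    then have "closure ?H = {}" by (simp only: closure_empty)
    with closure_interval_minus_negligible[OF N T] T show False by simp
  qed
  then obtain t0 where "t0 \<in> ?H" by blast
  from good[OF this] have K: "0 \<le> K" using l2_norm_nonneg order_trans by blast
  have L: "0 \<le> L"
    using order_trans[OF l2_norm_nonneg lip[of T 0]] T by (simp add: zero_le_mult_iff)
  \<comment> \<open>On \<open>[0,T]\<close> every summand of the functional is Lipschitz: \<open>u'\<close> is Lipschitz, hence bounded,
    hence \<open>u\<close> is Lipschitz and bounded as well.\<close>
  define B' where "B' = L * T + l2_norm M (u' 0)"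
  have B': "l2_norm M (u' s) \<le> B'" if s: "s \<in> {0..T}" for s
  proof -
    have "l2_norm M (u' s) \<le> l2_norm M (\<lambda>x. u' s x - u' 0 x) + l2_norm M (u' 0)"
      using s by (intro l2_norm_triangle_le u') auto
    also have "l2_norm M (\<lambda>x. u' s x - u' 0 x) \<le> L * \<bar>s - 0\<bar>" using s T by (intro lip) auto
    also have "L * \<bar>s - 0\<bar> \<le> L * T" using s L by (intro mult_left_mono) auto
    finally show ?thesis by (simp add: B'_def)
  qed
  have B'0: "0 \<le> B'" using order_trans[OF l2_norm_nonneg B'[of 0]] T by simp
  have lipu: "l2_norm M (\<lambda>x. u s x - u t x) \<le> B' * \<bar>s - t\<bar>" if "s \<in> {0..T}" "t \<in> {0..T}" for s t
    by (rule has_L2_derivative_imp_lipschitz[OF uL u' du B' that])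
  define B where "B = B' * T + l2_norm M (u 0)"
  have B: "l2_norm M (u s) \<le> B" if s: "s \<in> {0..T}" for s
  proof -
    have "l2_norm M (u s) \<le> l2_norm M (\<lambda>x. u s x - u 0 x) + l2_norm M (u 0)"
      using s by (intro l2_norm_triangle_le uL) auto
    also have "l2_norm M (\<lambda>x. u s x - u 0 x) \<le> B' * \<bar>s - 0\<bar>" using s T by (intro lipu) auto
    also have "B' * \<bar>s - 0\<bar> \<le> B' * T" using s B'0 by (intro mult_left_mono) auto
    finally show ?thesis by (simp add: B_def)
  qed
  have B0: "0 \<le> B" using order_trans[OF l2_norm_nonneg B[of 0]] T by simp
  have "(L * B' + B' * L)-lipschitz_on {0..T} p"
    unfolding p_def by (rule lipschitz_on_l2_inner) (use u' lip B' L B'0 in auto)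
  moreover have "(L * B + B' * B')-lipschitz_on {0..T} c"
    unfolding c_def by (rule lipschitz_on_l2_inner) (use u' uL lip lipu B B' L B'0 B0 in auto)
  moreover have "(B' * B + B * B')-lipschitz_on {0..T} w"
    unfolding w_def by (rule lipschitz_on_l2_inner) (use uL lipu B B'0 B0 in auto)
  moreover have "(2 * K * B')-lipschitz_on {0..T} e"
    unfolding e_def using good
    by (intro sqrt_energy_lipschitz[OF sa sq T u cont lipu B'0 N K]) auto
  ultimately obtain L1 where L1: "L1-lipschitz_on {0..T} \<Phi>"
  proof -
    assume p: "(L * B' + B' * L)-lipschitz_on {0..T} p" and c: "(L * B + B' * B')-lipschitz_on {0..T} c"
      and w: "(B' * B + B * B')-lipschitz_on {0..T} w" and e: "(2 * K * B')-lipschitz_on {0..T} e"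
    have eq: "\<Phi> = (\<lambda>t. (1/2) * p t + \<delta> * c t + ((\<delta>\<^sup>2 + \<gamma>) / 2) * w t + (1/2) * e t)"
      by (auto simp: \<Phi>_def F_def field_simps)
    note lipschitz_on_add[OF lipschitz_on_add[OF lipschitz_on_add[OF
      lipschitz_on_cmult_real[OF p, of "1/2"] lipschitz_on_cmult_real[OF c, of \<delta>]]
      lipschitz_on_cmult_real[OF w, of "(\<delta>\<^sup>2 + \<gamma>) / 2"]] lipschitz_on_cmult_real[OF e, of "1/2"]]
    then show thesis unfolding eq[symmetric] by (rule that)
  qed
  have L1bound: "\<bar>\<Phi> s\<bar> \<le> \<bar>\<Phi> 0\<bar> + L1 * T" if s: "s \<in> {0..T}" for s
  proof -
    have "\<bar>\<Phi> s - \<Phi> 0\<bar> \<le> L1 * \<bar>s - 0\<bar>"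
      using lipschitz_onD[OF L1 s, of 0] T by (simp add: dist_real_def)
    also have "\<dots> \<le> L1 * T" using s lipschitz_on_nonneg[OF L1] by (intro mult_left_mono) auto
    finally show ?thesis by linarith
  qed
  have expL: "(2 * \<delta> * exp (2 * \<delta> * T))-lipschitz_on {0..T} (\<lambda>t. exp (2 * \<delta> * t))"
  proof (rule lipschitz_onI)
    fix s t assume st: "s \<in> {0..T}" "t \<in> {0..T}"
    have "norm (exp (2 * \<delta> * s) - exp (2 * \<delta> * t)) \<le> (2 * \<delta> * exp (2 * \<delta> * T)) * norm (s - t)"
    proof (rule field_differentiable_bound[where S="{0..T}" and f'="\<lambda>r. 2 * \<delta> * exp (2 * \<delta> * r)"])
      show "((\<lambda>t. exp (2 * \<delta> * t)) has_field_derivative 2 * \<delta> * exp (2 * \<delta> * r)) (at r within {0..T})" for r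
        by (auto intro!: derivative_eq_intros)
    qed (use st \<delta> in auto)
    then show "dist (exp (2 * \<delta> * s)) (exp (2 * \<delta> * t)) \<le> (2 * \<delta> * exp (2 * \<delta> * T)) * dist s t"
      by (simp add: dist_norm)
  qed (use \<delta> in simp)
  have "exp (2 * \<delta> * T) * \<Phi> T \<le> exp (2 * \<delta> * 0) * \<Phi> 0"
  proof (rule lipschitz_derivative_nonpos_AE_imp_le[OF _ _ N, where f="\<lambda>t. exp (2 * \<delta> * t) * \<Phi> t"])
    show "(2 * \<delta> * exp (2 * \<delta> * T) * (\<bar>\<Phi> 0\<bar> + L1 * T) + exp (2 * \<delta> * T) * L1)-lipschitz_on {0..T}
        (\<lambda>t. exp (2 * \<delta> * t) * \<Phi> t)"
      by (rule lipschitz_on_mult_bounded[OF expL L1 _ L1bound])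
         (use \<delta> T lipschitz_on_nonneg[OF L1] in auto)
    fix t assume t: "t \<in> ?H"
    then have t0: "0 \<le> t" by auto
    have H0: "?H \<subseteq> {0..}" by auto
    have g: "u t \<in> D" "u' t \<in> E" "u'' t \<in> L2 M" "has_L2_derivative M u' (u'' t) t"
      and eqn: "AE x in M. u'' t x + \<alpha> * u' t x + \<beta> * u t x + A (u t) x = 0"
      using good[OF t] by blast+
    have AL: "A (u t) \<in> L2 M" using op(2)[OF g(1)] .
    have dp: "(p has_real_derivative l2_inner M (u'' t) (u' t) + l2_inner M (u' t) (u'' t)) (at t within ?H)"
      unfolding p_def
      by (rule has_field_derivative_subset[OF has_derivative_l2_inner[OF u' u' g(3) g(3) t0 g(4) g(4)] H0])
    have dc: "(c has_real_derivative l2_inner M (u'' t) (u t) + l2_inner M (u' t) (u' t)) (at t within ?H)"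
      unfolding c_def
      by (rule has_field_derivative_subset[OF has_derivative_l2_inner[OF u' uL g(3) u'[OF t0] t0 g(4) du[OF t0]] H0])
    have dw: "(w has_real_derivative l2_inner M (u' t) (u t) + l2_inner M (u t) (u' t)) (at t within ?H)"
      unfolding w_def
      by (rule has_field_derivative_subset[OF has_derivative_l2_inner[OF uL uL u'[OF t0] u'[OF t0] t0 du[OF t0] du[OF t0]] H0])
    have de: "(e has_real_derivative 2 * l2_inner M (A (u t)) (u' t)) (at t within ?H)"
    proof -
      have D: "u t \<in> D \<and> l2_norm M (A (u t)) \<le> K" if "t \<in> ?H" for t using good[OF that] by simp
      show ?thesis
        unfolding e_def by (rule sqrt_energy_derivative[OF sa sq H0 u cont D t g(2) du[OF t0]])
    qed
    define a where "a = l2_inner M (A (u t)) (u' t)"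
    have eq: "l2_inner M (u'' t) h = - \<alpha> * l2_inner M (u' t) h - \<beta> * l2_inner M (u t) h - l2_inner M (A (u t)) h"
      if h: "h \<in> L2 M" for h
    proof -
      have "l2_inner M (u'' t) h = l2_inner M (\<lambda>x. (- \<alpha>) * u' t x - \<beta> * u t x - A (u t) x) h"
      proof (rule l2_inner_cong_AE)
        show "AE x in M. u'' t x = (- \<alpha>) * u' t x - \<beta> * u t x - A (u t) x"
          using eqn by eventually_elim simp
      qed (use g h AL u'[OF t0] uL[OF t0] in auto)
      then show ?thesis using h AL u'[OF t0] uL[OF t0]
        using l2_inner_cmult_left[of M "- \<alpha>" "u' t" h]
        by (simp add: l2_inner_diff_left l2_inner_cmult_left)
    qed
    have e_eq: "l2_inner M (A (u t)) (u t) = e t"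
      unfolding e_def by (rule sqrt_operator_form[OF sq g(1) u[OF t0] AL, symmetric])
    have pp: "l2_inner M (u'' t) (u' t) = - \<alpha> * p t - \<beta> * c t - a"
      unfolding eq[OF u'[OF t0]] by (simp add: p_def c_def a_def l2_inner_commute)
    have cc: "l2_inner M (u'' t) (u t) = - \<alpha> * c t - \<beta> * w t - e t"
      unfolding eq[OF uL[OF t0]] e_eq by (simp add: w_def c_def)
    define \<Phi>' where "\<Phi>' = ((2 * (- \<alpha> * p t - \<beta> * c t - a)) + 2 * \<delta> * (- \<alpha> * c t - \<beta> * w t - e t + p t)
        + \<delta>\<^sup>2 * (2 * c t) + 2 * a + \<gamma> * (2 * c t)) / 2"
    have d\<Phi>: "(\<Phi> has_real_derivative \<Phi>') (at t within ?H)"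
    proof -
      have "p' = 2 * (- \<alpha> * p t - \<beta> * c t - a)"
        if "p' = l2_inner M (u'' t) (u' t) + l2_inner M (u' t) (u'' t)" for p'
        using that pp l2_inner_commute[of M "u' t" "u'' t"] by simp
      with dp have dp': "(p has_real_derivative 2 * (- \<alpha> * p t - \<beta> * c t - a)) (at t within ?H)" by simp
      have dc': "(c has_real_derivative - \<alpha> * c t - \<beta> * w t - e t + p t) (at t within ?H)"
        using dc unfolding cc by (simp add: p_def)
      have dw': "(w has_real_derivative 2 * c t) (at t within ?H)"
        using dw l2_inner_commute[of M "u t" "u' t"] by (simp add: c_def)
      have de': "(e has_real_derivative 2 * a) (at t within ?H)" using de by (simp add: a_def)
      show ?thesis unfolding \<Phi>_def F_def \<Phi>'_def
        by (intro DERIV_cdivide DERIV_add DERIV_cmult dp' dc' dw' de')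
    qed
    have "p t + 2 * \<delta> * c t + \<delta>\<^sup>2 * w t = l2_inner M (\<lambda>x. u' t x + \<delta> * u t x) (\<lambda>x. u' t x + \<delta> * u t x)"
      using u'[OF t0] uL[OF t0] l2_inner_commute[of M "u t" "u' t"]
      by (simp add: l2_inner_algebra p_def c_def w_def power2_eq_square algebra_simps)
    then have V: "0 \<le> p t + 2 * \<delta> * c t + \<delta>\<^sup>2 * w t" by (simp add: l2_inner_self_nonneg)
    have "\<Phi>' + 2 * \<delta> * \<Phi> t = - (\<delta> + \<delta>\<^sup>2) * (p t + 2 * \<delta> * c t + \<delta>\<^sup>2 * w t)"
      unfolding \<Phi>'_def \<Phi>_def F_def \<alpha>_def \<beta>_def \<gamma>_def
      by (simp add: field_simps power2_eq_square)
    also have "\<dots> \<le> 0"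
      using V \<delta> zero_le_power2[of \<delta>] by (intro mult_nonpos_nonneg) linarith+
    finally have "exp (2 * \<delta> * t) * (\<Phi>' + 2 * \<delta> * \<Phi> t) \<le> 0"
      by (intro mult_nonneg_nonpos) auto
    moreover have "((\<lambda>t. exp (2 * \<delta> * t) * \<Phi> t) has_real_derivative exp (2 * \<delta> * t) * (\<Phi>' + 2 * \<delta> * \<Phi> t)) (at t within ?H)"
      by (rule derivative_eq_intros d\<Phi> refl | simp)+ (simp add: algebra_simps)
    ultimately show "\<exists>d\<le>0. ((\<lambda>t. exp (2 * \<delta> * t) * \<Phi> t) has_real_derivative d) (at t within ?H)" by blast
  qed (use T in auto)
  then show ?thesis by (simp add: \<Phi>_def p_def c_def w_def e_def)
qed

text \<open>A factor \<open>2\<close> for passing from the energy to the Lyapunov functional at time \<open>t\<close>, and the remaining factor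
  for passing back at time \<open>0\<close>.\<close>

definition decay_constant :: "real \<Rightarrow> real \<Rightarrow> real" where
  "decay_constant lam \<delta> = 2 * (2 + (2 * \<delta>\<^sup>2 + \<delta> * (2 + \<delta> + \<delta>\<^sup>2)) / lam)"

text \<open>The assumptions \<open>v\<close> and \<open>v0\<close> are \<open>\<parallel>u' + 2 \<delta> u\<parallel>\<^sup>2 \<ge> 0\<close> and \<open>\<parallel>u' - \<delta> u\<parallel>\<^sup>2 \<ge> 0\<close>. They absorb the mixed
  terms, using \<open>\<gamma> \<ge> \<delta>\<^sup>2\<close> at time \<open>t\<close> and the Rayleigh inequality at time \<open>0\<close>.\<close>

lemma lyapunov_energy_comparison:
  fixes p c w e p0 c0 w0 e0 \<delta> lam q :: real
  defines "\<gamma> \<equiv> \<delta> * (2 + \<delta> + \<delta>\<^sup>2)"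
  assumes \<delta>: "0 < \<delta>" and lam: "0 < lam" and q: "0 \<le> q"
    and F: "(p + 2 * \<delta> * c + \<delta>\<^sup>2 * w + e + \<gamma> * w) / 2
      \<le> q * ((p0 + 2 * \<delta> * c0 + \<delta>\<^sup>2 * w0 + e0 + \<gamma> * w0) / 2)"
    and nn: "0 \<le> w" "0 \<le> e" "0 \<le> p0" "0 \<le> e0" and v: "0 \<le> p + 4 * \<delta> * c + 4 * \<delta>\<^sup>2 * w"
    and v0: "0 \<le> p0 - 2 * \<delta> * c0 + \<delta>\<^sup>2 * w0" and ray: "lam * w0 \<le> e0"
  shows "1 / 2 * (p + e) \<le> decay_constant lam \<delta> * q * (1 / 2 * (p0 + e0))"
proof -
  define k where "k = 2 * \<delta>\<^sup>2 + \<gamma>"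
  have \<gamma>: "\<delta>\<^sup>2 \<le> \<gamma>" using \<delta> by (simp add: \<gamma>_def algebra_simps power2_eq_square)
  have k0: "0 \<le> k" using \<gamma> zero_le_power2[of \<delta>] unfolding k_def by linarith
  have "\<delta>\<^sup>2 * w \<le> \<gamma> * w" using \<gamma> nn by (intro mult_right_mono)
  then have 1: "1 / 2 * (p + e) \<le> 2 * ((p + 2 * \<delta> * c + \<delta>\<^sup>2 * w + e + \<gamma> * w) / 2)"
    using v nn by (simp add: algebra_simps)
  have "k * w0 \<le> k * (e0 / lam)"
    using ray lam k0 by (intro mult_left_mono) (simp_all add: pos_le_divide_eq mult.commute)
  then have "2 * p0 + k * w0 + e0 \<le> 2 * p0 + (1 + k / lam) * e0"
    by (simp add: distrib_right)
  moreover have "p0 + 2 * \<delta> * c0 + \<delta>\<^sup>2 * w0 + e0 + \<gamma> * w0 \<le> 2 * p0 + k * w0 + e0"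
    using v0 by (simp add: k_def algebra_simps)
  ultimately have "p0 + 2 * \<delta> * c0 + \<delta>\<^sup>2 * w0 + e0 + \<gamma> * w0 \<le> 2 * p0 + (1 + k / lam) * e0"
    by (rule order_trans[rotated])
  then have 2: "(p0 + 2 * \<delta> * c0 + \<delta>\<^sup>2 * w0 + e0 + \<gamma> * w0) / 2 \<le> (2 * p0 + (1 + k / lam) * e0) / 2"
    by (rule divide_right_mono) simp
  have "0 \<le> e0 + (k / lam) * p0" using k0 nn lam by simp
  then have 3: "(2 * p0 + (1 + k / lam) * e0) / 2 \<le> (2 + k / lam) * (1 / 2 * (p0 + e0))"
    by (simp add: algebra_simps add_divide_distrib)
  have "1 / 2 * (p + e) \<le> 2 * (q * ((p0 + 2 * \<delta> * c0 + \<delta>\<^sup>2 * w0 + e0 + \<gamma> * w0) / 2))"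
    using 1 F by linarith
  also have "\<dots> \<le> 2 * (q * ((2 + k / lam) * (1 / 2 * (p0 + e0))))"
    using order_trans[OF 2 3] q by (intro mult_left_mono) auto
  also have "\<dots> = decay_constant lam \<delta> * q * (1 / 2 * (p0 + e0))"
    by (simp add: decay_constant_def k_def \<gamma>_def mult_ac)
  finally show ?thesis .
qed

text \<open>At time \<open>0\<close> the solution lies in the domain of \<open>A\<close>, so that the Rayleigh inequality
  applies. The good times are those at which the almost-everywhere clauses hold
  together.\<close>

lemma elliptic_energy_decay:
  fixes \<Omega> :: "(real^'n) set"
  assumes set: "elliptic_setting \<Omega> \<AA> a0 S lam" and \<delta>: "0 < \<delta>"
    and sol: "strong_solution \<Omega> \<AA> a0 S (\<delta> * (3 + \<delta>)) (\<delta> * (2 + 3 * \<delta> + 2 * \<delta>\<^sup>2)) u0 u1 u u' u''"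
    and T: "0 \<le> T"
  shows "energy1 \<Omega> S u u' T \<le> decay_constant lam \<delta> * exp (- \<delta> * T) * energy1 \<Omega> S u u' 0"
proof -
  define M where "M = lebesgue_on \<Omega>"
  define D where "D = elliptic_domain \<Omega>"
  define A where "A = elliptic_op \<Omega> \<AA> a0"
  define E where "E = H10 \<Omega>"
  note defs = M_def D_def A_def E_def
  have sa: "self_adjoint M D A" and sq: "is_sqrt_operator M D A E S" and lam: "0 < lam"
    using set unfolding elliptic_setting_def Let_def defs by blast+
  have u0: "u0 \<in> D" "AE x in M. u 0 x = u0 x"
    and u: "\<And>t. 0 \<le> t \<Longrightarrow> u t \<in> E" and u': "\<And>t. 0 \<le> t \<Longrightarrow> u' t \<in> L2 M"
    and cont: "L2_continuous M (\<lambda>t. S (u t))"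
    and du: "\<And>t. 0 \<le> t \<Longrightarrow> has_L2_derivative M u (u' t) t"
    and lip: "\<And>T. 0 < T \<Longrightarrow> \<exists>K. \<forall>s\<in>{0..T}. \<forall>t\<in>{0..T}. l2_norm M (\<lambda>x. u' s x - u' t x) \<le> K * \<bar>s - t\<bar>"
    and bounds: "\<And>T. 0 < T \<Longrightarrow> \<exists>K. AE t in lebesgue_on {0<..<T}.
          u t \<in> D \<and> l2_norm M (u t) \<le> K \<and> l2_norm M (A (u t)) \<le> K \<and>
          u' t \<in> E \<and> l2_norm M (u' t) \<le> K \<and> l2_norm M (S (u' t)) \<le> K \<and>
          u'' t \<in> L2 M \<and> l2_norm M (u'' t) \<le> K"
    and ddu: "AE t in lebesgue_on {0<..}. has_L2_derivative M u' (u'' t) t"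
    and eqn: "AE t in lebesgue_on {0<..}. AE x in M.
          u'' t x + \<delta> * (3 + \<delta>) * u' t x + \<delta> * (2 + 3 * \<delta> + 2 * \<delta>\<^sup>2) * u t x + A (u t) x = 0"
    using sol unfolding strong_solution_def Let_def defs by blast+
  note op = L2_operatorD[OF self_adjointD(1)[OF sa]]
  have saS: "self_adjoint M E S" using sq by (simp add: is_sqrt_operator_def)
  note opS = L2_operatorD[OF self_adjointD(1)[OF saS]]
  have uL: "u t \<in> L2 M" if "0 \<le> t" for t using opS(1)[OF u[OF that]] .
  define F where "F p c w e = (p + 2 * \<delta> * c + \<delta>\<^sup>2 * w + e + \<delta> * (2 + \<delta> + \<delta>\<^sup>2) * w) / 2" for p c w e :: real
  define \<Phi> where "\<Phi> t = F (l2_inner M (u' t) (u' t)) (l2_inner M (u' t) (u t)) (l2_inner M (u t) (u t))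
      (l2_inner M (S (u t)) (S (u t)))" for t
  have decay: "\<Phi> T \<le> exp (- (2 * \<delta> * T)) * \<Phi> 0"
  proof (cases "T = 0")
    case False
    with T have T': "0 < T" by simp
    obtain L where L: "\<And>s t. s \<in> {0..T} \<Longrightarrow> t \<in> {0..T} \<Longrightarrow> l2_norm M (\<lambda>x. u' s x - u' t x) \<le> L * \<bar>s - t\<bar>"
      using lip[OF T'] by blast
    obtain K where K: "AE t in lebesgue_on {0<..<T}.
          u t \<in> D \<and> l2_norm M (u t) \<le> K \<and> l2_norm M (A (u t)) \<le> K \<and>
          u' t \<in> E \<and> l2_norm M (u' t) \<le> K \<and> l2_norm M (S (u' t)) \<le> K \<and>
          u'' t \<in> L2 M \<and> l2_norm M (u'' t) \<le> K"
      using bounds[OF T'] by blast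
    let ?good = "\<lambda>t. u t \<in> D \<and> l2_norm M (A (u t)) \<le> K \<and> u' t \<in> E \<and>
      u'' t \<in> L2 M \<and> has_L2_derivative M u' (u'' t) t \<and>
      (AE x in M. u'' t x + \<delta> * (3 + \<delta>) * u' t x + \<delta> * (2 + 3 * \<delta> + 2 * \<delta>\<^sup>2) * u t x + A (u t) x = 0)"
    have "AE t in lebesgue. t \<in> {0<..<T} \<longrightarrow> ?good t"
    proof -
      have on: "AE t in lebesgue. t \<in> I \<longrightarrow> P t" if "AE t in lebesgue_on I. P t" "I \<in> sets lebesgue"
        for P :: "real \<Rightarrow> bool" and I
        using that by (subst (asm) AE_restrict_space_iff) simp_all
      have I: "{0<..<T} \<in> sets lebesgue" "{0<..} \<in> sets (lebesgue :: real measure)" by simp_all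
      from on[OF K I(1)] on[OF ddu I(2)] on[OF eqn I(2)] show ?thesis
        by eventually_elim simp
    qed
    then obtain N where N: "N \<in> null_sets lebesgue" "{t. \<not> (t \<in> {0<..<T} \<longrightarrow> ?good t)} \<subseteq> N"
      by (auto elim!: AE_E2 simp: eventually_ae_filter)
    have neg: "negligible N" using N(1) by (simp add: negligible_iff_null_sets)
    have good: "?good t" if "t \<in> {0<..<T} - N" for t
      using N(2) that by blast
    have "exp (2 * \<delta> * T) * \<Phi> T \<le> \<Phi> 0"
      unfolding \<Phi>_def F_def
      by (rule damped_wave_lyapunov_decay[OF sa sq \<delta> T' u u' cont du L neg good])
    then show ?thesis by (simp add: exp_minus field_simps)
  qed simp
  have u0D: "u 0 \<in> D"
  proof (rule op(5)[OF u0(1) uL[OF order_refl]])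
    show "AE x in M. u0 x = u 0 x" using u0(2) by eventually_elim simp
  qed
  have "lam * l2_inner M (u 0) (u 0) \<le> l2_inner M (A (u 0)) (u 0)"
    using elliptic_rayleigh_inequality[OF set] u0D unfolding defs by blast
  also have "\<dots> = l2_inner M (S (u 0)) (S (u 0))"
    by (rule sqrt_operator_form[OF sq u0D u[OF order_refl] op(2)[OF u0D], symmetric])
  finally have ray: "lam * l2_inner M (u 0) (u 0) \<le> l2_inner M (S (u 0)) (S (u 0))" .
  have square: "0 \<le> l2_inner M (u' t) (u' t) + 2 * b * l2_inner M (u' t) (u t) + b\<^sup>2 * l2_inner M (u t) (u t)"
    if t: "0 \<le> t" for t b
  proof -
    have "l2_inner M (u' t) (u' t) + 2 * b * l2_inner M (u' t) (u t) + b\<^sup>2 * l2_inner M (u t) (u t)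
        = l2_inner M (\<lambda>x. u' t x + b * u t x) (\<lambda>x. u' t x + b * u t x)"
      using u'[OF t] uL[OF t] l2_inner_commute[of M "u t" "u' t"]
      by (simp add: l2_inner_algebra power2_eq_square algebra_simps)
    then show ?thesis by (simp add: l2_inner_self_nonneg)
  qed
  have energy: "energy1 \<Omega> S u u' t = 1 / 2 * (l2_inner M (u' t) (u' t) + l2_inner M (S (u t)) (S (u t)))" for t
    by (simp add: energy1_def l2_norm_square M_def)
  have "energy1 \<Omega> S u u' T \<le> decay_constant lam \<delta> * exp (- (2 * \<delta> * T)) * energy1 \<Omega> S u u' 0"
    unfolding energy
  proof (rule lyapunov_energy_comparison[OF \<delta> lam _ decay[unfolded \<Phi>_def F_def]])
    show "0 \<le> l2_inner M (u' T) (u' T) + 4 * \<delta> * l2_inner M (u' T) (u T) + 4 * \<delta>\<^sup>2 * l2_inner M (u T) (u T)"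
      using square[OF T, of "2 * \<delta>"] by (simp add: power_mult_distrib)
    show "0 \<le> l2_inner M (u' 0) (u' 0) - 2 * \<delta> * l2_inner M (u' 0) (u 0) + \<delta>\<^sup>2 * l2_inner M (u 0) (u 0)"
      using square[of 0 "- \<delta>"] by simp
  qed (auto simp: l2_inner_self_nonneg ray)
  also have "\<dots> \<le> decay_constant lam \<delta> * exp (- \<delta> * T) * energy1 \<Omega> S u u' 0"
  proof (intro mult_right_mono mult_left_mono)
    show "exp (- (2 * \<delta> * T)) \<le> exp (- \<delta> * T)" using \<delta> T by simp
    show "0 \<le> decay_constant lam \<delta>"
      using \<delta> lam by (auto simp: decay_constant_def intro!: divide_nonneg_pos add_nonneg_nonneg mult_nonneg_nonneg)
    show "0 \<le> energy1 \<Omega> S u u' 0" by (simp add: energy l2_inner_self_nonneg)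
  qed
  finally show ?thesis .
qed

lemma decay_constant_pos: "0 < lam \<Longrightarrow> 0 < \<delta> \<Longrightarrow> 0 < decay_constant lam \<delta>"
  by (auto simp: decay_constant_def intro!: add_pos_nonneg divide_nonneg_pos mult_nonneg_nonneg)

lemma decay_constant_bigo:
  assumes "0 < lam"
  shows "(\<lambda>\<delta>. decay_constant lam \<delta>) \<in> O[at_top](\<lambda>\<delta>. \<delta> ^ 3)"
proof (rule bigoI)
  show "\<forall>\<^sub>F \<delta> in at_top. norm (decay_constant lam \<delta>) \<le> (4 + 12 / lam) * norm (\<delta> ^ 3 :: real)"
    using eventually_ge_at_top[of 1]
  proof eventually_elim
    case (elim \<delta>)
    have d: "1 \<le> \<delta> ^ 3" "\<delta> \<le> \<delta> ^ 3" "\<delta>\<^sup>2 \<le> \<delta> ^ 3"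
      using elim power_increasing[of 1 3 \<delta>] power_increasing[of 2 3 \<delta>] by (auto simp: one_le_power)
    have "2 * \<delta>\<^sup>2 + \<delta> * (2 + \<delta> + \<delta>\<^sup>2) = 3 * \<delta>\<^sup>2 + 2 * \<delta> + \<delta> ^ 3"
      by (simp add: power2_eq_square power3_eq_cube algebra_simps)
    also have "\<dots> \<le> 6 * \<delta> ^ 3" using d by linarith
    finally have "(2 * \<delta>\<^sup>2 + \<delta> * (2 + \<delta> + \<delta>\<^sup>2)) / lam \<le> 6 * \<delta> ^ 3 / lam"
      using assms by (intro divide_right_mono) auto
    then have "decay_constant lam \<delta> \<le> 2 * (2 * \<delta> ^ 3 + 6 * \<delta> ^ 3 / lam)"
      unfolding decay_constant_def using d(1) by (intro mult_left_mono add_mono) auto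
    also have "\<dots> = (4 + 12 / lam) * \<delta> ^ 3" by (simp add: algebra_simps)
    finally show ?case
      using decay_constant_pos[OF assms, of \<delta>] elim by simp
  qed
qed

theorem theorem4p2:
  shows "\<exists>C :: real \<Rightarrow> real \<Rightarrow> real.
       (\<forall>lam>0. \<forall>\<delta>>0. 0 < C lam \<delta>) \<and>
       (\<forall>lam>0. (\<lambda>\<delta>. C lam \<delta>) \<in> O[at_top](\<lambda>\<delta>. \<delta> ^ 3)) \<and>
       (\<forall>(\<Omega> :: (real^2) set) \<AA> a0 S lam \<delta> u0 u1 u u' u''.
          elliptic_setting \<Omega> \<AA> a0 S lam \<longrightarrow> 0 < \<delta> \<longrightarrow>
          strong_solution \<Omega> \<AA> a0 S (\<delta> * (3 + \<delta>)) (\<delta> * (2 + 3 * \<delta> + 2 * \<delta>\<^sup>2)) u0 u1 u u' u'' \<longrightarrow>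
          (\<forall>t\<ge>0. energy1 \<Omega> S u u' t \<le> C lam \<delta> * exp (- \<delta> * t) * energy1 \<Omega> S u u' 0)) \<and>
       (\<forall>(\<Omega> :: (real^3) set) \<AA> a0 S lam \<delta> u0 u1 u u' u''.
          elliptic_setting \<Omega> \<AA> a0 S lam \<longrightarrow> 0 < \<delta> \<longrightarrow>
          strong_solution \<Omega> \<AA> a0 S (\<delta> * (3 + \<delta>)) (\<delta> * (2 + 3 * \<delta> + 2 * \<delta>\<^sup>2)) u0 u1 u u' u'' \<longrightarrow>
          (\<forall>t\<ge>0. energy1 \<Omega> S u u' t \<le> C lam \<delta> * exp (- \<delta> * t) * energy1 \<Omega> S u u' 0)) \<and>
       (\<forall>(\<Omega> :: (real^'n) set) \<AA> a0 S lam \<delta> u0 u1 u u' u''.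
          elliptic_setting \<Omega> \<AA> a0 S lam \<longrightarrow> 0 < \<delta> \<longrightarrow>
          strong_solution \<Omega> \<AA> a0 S (\<delta> * (3 + \<delta>)) (\<delta> * (2 + 3 * \<delta> + 2 * \<delta>\<^sup>2)) u0 u1 u u' u'' \<longrightarrow>
          (\<forall>t\<ge>0. energy1 \<Omega> S u u' t \<le> C lam \<delta> * exp (- \<delta> * t) * energy1 \<Omega> S u u' 0))"
proof (intro exI[of _ decay_constant] conjI allI impI)
  show "0 < decay_constant lam \<delta>" if "0 < lam" "0 < \<delta>" for lam \<delta>
    using that by (rule decay_constant_pos)
  show "(\<lambda>\<delta>. decay_constant lam \<delta>) \<in> O[at_top](\<lambda>\<delta>. \<delta> ^ 3)" if "0 < lam" for lam
    using that by (rule decay_constant_bigo)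
qed (rule elliptic_energy_decay; assumption)+

end
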